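(* If $\mathcal R\in\{\mathrm{NC}(d),\mathrm{NCP}(k): d,k\in\mathbb N\}$, and if $\phi:\mathcal R\to\mathcal B(\mathcal H)$ is a unital completely positive map, then there exists a unital completely positive map $\Phi:\mathrm C^*_{\min}(\mathcal R)\to\phi(\mathcal R)''$, where $\phi(\mathcal R)''$ is the von Neumann algebra generated by $\phi(\mathcal R)$, such that $\Phi|_{\mathcal R}=\phi$.
   Context: $\mathrm{NC}(d)=\mathrm{Span}\{1,u_1,\dots,u_d\}\subseteq\mathrm C^*( *_1^d\mathbb Z_2)$, where $u_1,\dots,u_d$ are the canonical generating symmetries of the full group C$^*$-algebra of the free product of $d$ copies of $\mathbb Z_2$. $\mathrm{NCP}(k)=\mathrm{Span}\{1,w,\dots,w^{k-1},v\}\subseteq\mathrm C^*(\mathbb Z_k*\mathbb Z_2)$, where $w,v$ are the canonical unitaries from the generators of $\mathbb Z_k$ and $\mathbb Z_2$. $\mathrm C^*_{\min}(\mathcal R)$ denotes the C$^*$-envelope (minimal C$^*$-cover) of $\mathcal R$: a unital C$^*$-algebra generated by a unital completely order embedded copy $\iota_{\mathrm e}(\mathcal R)$ of $\mathcal R$ such that, for every unital complete order embedding $\kappa:\mathcal R\to\mathcal A$ with $\mathcal A=\mathrm C^*(\kappa(\mathcal R))$, there is a unital $*$-homomorphism $\pi:\mathcal A\to\mathrm C^*_{\min}(\mathcal R)$ with $\iota_{\mathrm e}=\pi\circ\kappa$. For these systems it is known that $\mathrm C^*_{\min}(\mathrm{NC}(d))=\mathrm C^*( *_1^d\mathbb Z_2)$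 and $\mathrm C^*_{\min}(\mathrm{NCP}(k))=\mathrm C^*(\mathbb Z_k*\mathbb Z_2)$. *)

theory Defs
  imports "HOL-Analysis.Analysis" "HOL-Algebra.Elementary_Groups"
begin

section \<open>Complex Hilbert spaces\<close>

class scaleC =
  fixes scaleC :: "complex \<Rightarrow> 'a \<Rightarrow> 'a"  (infixr "*\<^sub>C" 75)

text \<open>The inner product is linear in its first argument. The norm and the topology are those of
  the underlying real Hilbert space, whose inner product is the real part.\<close>

class chilbert_space = banach + real_inner + scaleC +
  fixes cinner :: "'a \<Rightarrow> 'a \<Rightarrow> complex"
  assumes scaleC_add_right: "c *\<^sub>C (x + y) = c *\<^sub>C x + c *\<^sub>C y"
    and scaleC_add_left: "(c + d) *\<^sub>C x = c *\<^sub>C x + d *\<^sub>C x"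
    and scaleC_scaleC: "c *\<^sub>C d *\<^sub>C x = (c * d) *\<^sub>C x"
    and scaleR_scaleC: "r *\<^sub>R x = complex_of_real r *\<^sub>C x"
    and cinner_add_left: "cinner (x + y) z = cinner x z + cinner y z"
    and cinner_scaleC_left: "cinner (c *\<^sub>C x) y = c * cinner x y"
    and cinner_commute: "cinner x y = cnj (cinner y x)"
    and inner_eq_Re_cinner: "inner x y = Re (cinner x y)"

lemma cinner_add_right: "cinner x (y + z) = cinner x y + cinner x z"
  for x :: "'a::chilbert_space"
  by (metis cinner_add_left cinner_commute complex_cnj_add)

lemma cinner_scaleC_right: "cinner x (c *\<^sub>C y) = cnj c * cinner x y"
  for x :: "'a::chilbert_space"
  by (metis cinner_commute cinner_scaleC_left complex_cnj_mult)

lemma norm_scaleC: "norm (c *\<^sub>C x) = cmod c * norm x" for x :: "'a::chilbert_space"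
proof -
  have "cinner (c *\<^sub>C x) (c *\<^sub>C x) = (c * cnj c) * cinner x x"
    by (simp add: cinner_scaleC_left cinner_scaleC_right)
  then have "inner (c *\<^sub>C x) (c *\<^sub>C x) = (cmod c)\<^sup>2 * inner x x"
    by (simp add: inner_eq_Re_cinner complex_norm_square[symmetric])
  then have "(norm (c *\<^sub>C x))\<^sup>2 = (cmod c * norm x)\<^sup>2"
    by (simp add: power2_norm_eq_inner power_mult_distrib)
  then show ?thesis
    by (simp add: power2_eq_iff_nonneg)
qed

lemma scaleC_zero_right: "c *\<^sub>C 0 = (0 :: 'a::chilbert_space)"
  using scaleC_add_right[of c "0 :: 'a" 0] by simp

lemma scaleC_minus_right: "c *\<^sub>C (- x) = - (c *\<^sub>C x)" for x :: "'a::chilbert_space"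
  using scaleC_add_right[of c "- x" x] by (simp add: scaleC_zero_right eq_neg_iff_add_eq_0)

lemma scaleC_diff_right: "c *\<^sub>C (x - y) = c *\<^sub>C x - c *\<^sub>C y" for x :: "'a::chilbert_space"
  by (metis diff_conv_add_uminus scaleC_add_right scaleC_minus_right)

lemma scaleC_scaleR: "c *\<^sub>C r *\<^sub>R x = r *\<^sub>R c *\<^sub>C x" for x :: "'a::chilbert_space"
  by (simp add: scaleR_scaleC scaleC_scaleC mult.commute)

lemma bounded_linear_scaleC: "bounded_linear (\<lambda>x :: 'a::chilbert_space. c *\<^sub>C x)"
  by (rule bounded_linear_intro[where K = "cmod c"])
    (simp_all add: scaleC_add_right scaleC_scaleR norm_scaleC mult.commute)


section \<open>The algebra of bounded operators\<close>

typedef (overloaded) 'h bop =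
    "{T :: 'h::chilbert_space \<Rightarrow>\<^sub>L 'h. \<forall>c x. blinfun_apply T (c *\<^sub>C x) = c *\<^sub>C blinfun_apply T x}"
  morphisms blinfun_of_bop Bop
  by (rule exI[of _ 0]) (simp add: scaleC_zero_right)

setup_lifting type_definition_bop

lift_definition bapp :: "'h::chilbert_space bop \<Rightarrow> 'h \<Rightarrow> 'h" is blinfun_apply .

lemma bapp_scaleC: "bapp T (c *\<^sub>C x) = c *\<^sub>C bapp T x"
  by transfer simp

lemma bounded_linear_bapp: "bounded_linear (bapp T)"
  by transfer (rule blinfun.bounded_linear_right)

lemma bop_eqI: "(\<And>x. bapp S x = bapp T x) \<Longrightarrow> S = T"
  by transfer (rule blinfun_eqI)

instantiation bop :: (chilbert_space) "{real_normed_algebra, monoid_mult, scaleC}"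
begin

lift_definition zero_bop :: "'a bop" is 0
  by (simp add: scaleC_zero_right)
lift_definition one_bop :: "'a bop" is id_blinfun
  by simp
lift_definition plus_bop :: "'a bop \<Rightarrow> 'a bop \<Rightarrow> 'a bop" is "(+)"
  by (simp add: blinfun.add_left scaleC_add_right)
lift_definition minus_bop :: "'a bop \<Rightarrow> 'a bop \<Rightarrow> 'a bop" is "(-)"
  by (simp add: blinfun.diff_left scaleC_diff_right)
lift_definition uminus_bop :: "'a bop \<Rightarrow> 'a bop" is uminus
  by (simp add: blinfun.minus_left scaleC_minus_right)
lift_definition times_bop :: "'a bop \<Rightarrow> 'a bop \<Rightarrow> 'a bop" is "(o\<^sub>L)"
  by simp
lift_definition scaleR_bop :: "real \<Rightarrow> 'a bop \<Rightarrow> 'a bop" is scaleR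
  by (simp add: blinfun.scaleR_left scaleC_scaleR)
lift_definition scaleC_bop :: "complex \<Rightarrow> 'a bop \<Rightarrow> 'a bop"
  is "\<lambda>c T. Blinfun (\<lambda>x. c *\<^sub>C x) o\<^sub>L T"
  by (simp add: bounded_linear_Blinfun_apply bounded_linear_scaleC scaleC_scaleC mult.commute)
lift_definition norm_bop :: "'a bop \<Rightarrow> real" is norm .

definition dist_bop :: "'a bop \<Rightarrow> 'a bop \<Rightarrow> real" where "dist_bop S T = norm (S - T)"
definition sgn_bop :: "'a bop \<Rightarrow> 'a bop" where "sgn_bop T = inverse (norm T) *\<^sub>R T"
definition "(uniformity :: ('a bop \<times> 'a bop) filter) =
  (INF e\<in>{0<..}. principal {(x, y). dist x y < e})"
definition open_bop :: "'a bop set \<Rightarrow> bool" where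
  "open_bop U = (\<forall>x\<in>U. \<forall>\<^sub>F (x', y) in uniformity. x' = x \<longrightarrow> y \<in> U)"

instance
proof
  fix a b c :: "'a bop" and r s :: real
  show "a + b + c = a + (b + c)" by transfer simp
  show "a + b = b + a" by transfer simp
  show "0 + a = a" by transfer simp
  show "- a + a = 0" by transfer simp
  show "a - b = a + - b" by transfer simp
  show "r *\<^sub>R (a + b) = r *\<^sub>R a + r *\<^sub>R b" by transfer (simp add: scaleR_add_right)
  show "(r + s) *\<^sub>R a = r *\<^sub>R a + s *\<^sub>R a" by transfer (simp add: scaleR_add_left)
  show "r *\<^sub>R s *\<^sub>R a = (r * s) *\<^sub>R a" by transfer simp
  show "1 *\<^sub>R a = a" by transfer simp
  show "a * b * c = a * (b * c)" by transfer (rule blinfun_eqI, simp)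
  show "(a + b) * c = a * c + b * c" by transfer (rule blinfun_eqI, simp add: blinfun.add_left)
  show "a * (b + c) = a * b + a * c"
    by transfer (rule blinfun_eqI, simp add: blinfun.add_left blinfun.add_right)
  show "r *\<^sub>R a * b = r *\<^sub>R (a * b)" by transfer (rule blinfun_eqI, simp add: blinfun.scaleR_left)
  show "a * r *\<^sub>R b = r *\<^sub>R (a * b)"
    by transfer (rule blinfun_eqI, simp add: blinfun.scaleR_left blinfun.scaleR_right)
  show "1 * a = a" by transfer (rule blinfun_eqI, simp)
  show "a * 1 = a" by transfer (rule blinfun_eqI, simp)
  show "dist a b = norm (a - b)" by (rule dist_bop_def)
  show "sgn a = inverse (norm a) *\<^sub>R a" by (rule sgn_bop_def)
  show "(norm a = 0) = (a = 0)" by transfer simp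
  show "norm (a + b) \<le> norm a + norm b" by transfer (rule norm_triangle_ineq)
  show "norm (r *\<^sub>R a) = \<bar>r\<bar> * norm a" by transfer simp
  show "norm (a * b) \<le> norm a * norm b" by transfer (rule norm_blinfun_compose)
  show "(uniformity :: ('a bop \<times> 'a bop) filter) =
      (INF e\<in>{0<..}. principal {(x, y). dist x y < e})"
    by (rule uniformity_bop_def)
  fix U :: "'a bop set"
  show "open U = (\<forall>x\<in>U. \<forall>\<^sub>F (x', y) in uniformity. x' = x \<longrightarrow> y \<in> U)"
    by (rule open_bop_def)
qed

end

lemma bapp_simps:
  "bapp 0 x = 0" "bapp 1 x = x" "bapp (S + T) x = bapp S x + bapp T x"
  "bapp (S - T) x = bapp S x - bapp T x" "bapp (- T) x = - bapp T x"
  "bapp (S * T) x = bapp S (bapp T x)" "bapp (r *\<^sub>R T) x = r *\<^sub>R bapp T x"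
  "bapp (c *\<^sub>C T) x = c *\<^sub>C bapp T x"
  by (transfer, simp add: blinfun.add_left blinfun.diff_left blinfun.minus_left blinfun.scaleR_left
      bounded_linear_Blinfun_apply bounded_linear_scaleC)+

lemma module_scaleC_bop: "module ((*\<^sub>C) :: complex \<Rightarrow> 'h::chilbert_space bop \<Rightarrow> 'h bop)"
proof
  fix c d :: complex and S T :: "'h bop"
  show "c *\<^sub>C (S + T) = c *\<^sub>C S + c *\<^sub>C T" "(c + d) *\<^sub>C T = c *\<^sub>C T + d *\<^sub>C T"
    "c *\<^sub>C d *\<^sub>C T = (c * d) *\<^sub>C T"
    by (rule bop_eqI, simp add: bapp_simps scaleC_add_right scaleC_add_left scaleC_scaleC)+
  show "1 *\<^sub>C T = T"
    by (rule bop_eqI) (simp add: bapp_simps scaleR_scaleC[of 1, simplified, symmetric])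
qed

instance bop :: (chilbert_space) banach
proof
  fix X :: "nat \<Rightarrow> 'a bop"
  assume X: "Cauchy X"
  have dist: "dist (blinfun_of_bop S) (blinfun_of_bop T) = dist S T" for S T :: "'a bop"
    unfolding dist_norm by (simp add: norm_bop.rep_eq minus_bop.rep_eq)
  from X have "Cauchy (\<lambda>n. blinfun_of_bop (X n))"
    by (simp add: Cauchy_def dist)
  then obtain L where L: "(\<lambda>n. blinfun_of_bop (X n)) \<longlonglongrightarrow> L"
    using Cauchy_convergent convergent_def by blast
  have hom: "blinfun_apply (blinfun_of_bop (X n)) (c *\<^sub>C x) = c *\<^sub>C blinfun_apply (blinfun_of_bop (X n)) x"
    for n c x
    using blinfun_of_bop[of "X n"] by simp
  have "blinfun_apply L (c *\<^sub>C x) = c *\<^sub>C blinfun_apply L x" for c x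
  proof (rule LIMSEQ_unique)
    show "(\<lambda>n. blinfun_apply (blinfun_of_bop (X n)) (c *\<^sub>C x)) \<longlonglongrightarrow> blinfun_apply L (c *\<^sub>C x)"
      by (intro tendsto_intros L)
    have "(\<lambda>n. c *\<^sub>C blinfun_apply (blinfun_of_bop (X n)) x) \<longlonglongrightarrow> c *\<^sub>C blinfun_apply L x"
      by (intro bounded_linear.tendsto[OF bounded_linear_scaleC] tendsto_intros L)
    then show "(\<lambda>n. blinfun_apply (blinfun_of_bop (X n)) (c *\<^sub>C x)) \<longlonglongrightarrow> c *\<^sub>C blinfun_apply L x"
      by (simp only: hom)
  qed
  then have "L = blinfun_of_bop (Bop L)"
    by (simp add: Bop_inverse)
  with L have "X \<longlonglongrightarrow> Bop L"
    by (metis (no_types, lifting) dist lim_sequentially)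
  then show "convergent X"
    by (rule convergentI)
qed

lemma Riesz_real:
  fixes f :: "'h::{banach,real_inner} \<Rightarrow> real"
  assumes f: "bounded_linear f"
  shows "\<exists>z. \<forall>x. f x = inner x z"
proof -
  interpret f: bounded_linear f by (rule f)
  obtain K where K: "\<And>x. norm (f x) \<le> norm x * K"
    using f.bounded by blast
  define J where "J x = inner x x - 2 * f x" for x
  have J_ge: "- K\<^sup>2 \<le> J x" for x
  proof -
    have "f x \<le> norm x * K" using K[of x] by simp
    moreover have "0 \<le> (norm x - K)\<^sup>2" by simp
    ultimately show ?thesis
      unfolding J_def power2_diff power2_norm_eq_inner by linarith
  qed
  define m where "m = Inf (range J)"
  have m_le: "m \<le> J x" for x
    unfolding m_def by (rule cInf_lower) (auto intro!: bdd_belowI[of _ "- K\<^sup>2"] J_ge)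
  have "\<exists>x. J x < m + inverse (real (Suc k))" for k
  proof -
    have "Inf (range J) < m + inverse (real (Suc k))"
      unfolding m_def by simp
    from cInf_lessD[OF _ this] show ?thesis by auto
  qed
  then obtain X where X: "\<And>k. J (X k) < m + inverse (real (Suc k))"
    by metis
  have mid: "(norm (x - y))\<^sup>2 = 2 * J x + 2 * J y - 4 * J ((1/2) *\<^sub>R (x + y))" for x y
    unfolding J_def power2_norm_eq_inner
    by (simp add: inner_diff_left inner_diff_right inner_add_left inner_add_right inner_commute
        f.add f.scaleR algebra_simps)
  have "Cauchy X"
  proof (rule metric_CauchyI)
    fix e :: real assume e: "0 < e"
    obtain N where N: "inverse (real (Suc N)) < e\<^sup>2 / 4"
      using reals_Archimedean[of "e\<^sup>2 / 4"] e by auto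
    have "dist (X k) (X l) < e" if "N \<le> k" "N \<le> l" for k l
    proof -
      have "inverse (real (Suc k)) \<le> inverse (real (Suc N))"
        and "inverse (real (Suc l)) \<le> inverse (real (Suc N))"
        using that by (auto intro!: le_imp_inverse_le)
      with X[of k] X[of l] N m_le[of "(1/2) *\<^sub>R (X k + X l)"]
      have "(norm (X k - X l))\<^sup>2 < e\<^sup>2"
        unfolding mid by linarith
      then show ?thesis
        unfolding dist_norm using e by (simp add: power2_less_imp_less)
    qed
    then show "\<exists>N. \<forall>k\<ge>N. \<forall>l\<ge>N. dist (X k) (X l) < e" by blast
  qed
  then obtain z where z: "X \<longlonglongrightarrow> z"
    using Cauchy_convergent convergent_def by blast
  have "(\<lambda>k. J (X k)) \<longlonglongrightarrow> J z"
    unfolding J_def by (intro tendsto_intros f.tendsto z)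
  moreover have "(\<lambda>k. m + inverse (real (Suc k))) \<longlonglongrightarrow> m + 0"
    by (intro tendsto_intros LIMSEQ_inverse_real_of_nat)
  ultimately have "J z \<le> m + 0"
    by (rule LIMSEQ_le) (use X less_imp_le in blast)
  then have Jz: "J z \<le> J x" for x
    using m_le[of x] by linarith
  have "f x = inner x z" for x
  proof (rule ccontr)
    define a where "a = inner x z - f x"
    define b where "b = inner x x"
    assume "f x \<noteq> inner x z"
    then have a: "a \<noteq> 0" and "x \<noteq> 0"
      unfolding a_def by auto
    then have b: "0 < b"
      unfolding b_def by simp
    have "J (z + t *\<^sub>R x) = J z + 2 * t * a + t\<^sup>2 * b" for t
      unfolding J_def a_def b_def
      by (simp add: inner_add_left inner_add_right f.add f.scaleR power2_eq_square
          inner_commute algebra_simps)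
    from this[of "- a / b"] Jz[of "z + (- a / b) *\<^sub>R x"]
    have "0 \<le> 2 * (- a / b) * a + (- a / b)\<^sup>2 * b"
      by linarith
    also have "\<dots> = - (a\<^sup>2 / b)"
      using b by (simp add: power2_eq_square field_simps)
    finally show False
      using a b by (simp add: divide_le_0_iff)
  qed
  then show ?thesis by blast
qed

lemma cinner_zero_left [simp]: "cinner 0 y = 0" for y :: "'a::chilbert_space"
  by (metis add_cancel_right_right cinner_add_left)

lemma cinner_zero_right [simp]: "cinner y 0 = 0" for y :: "'a::chilbert_space"
  by (metis add_cancel_right_right cinner_add_right)

lemma cinner_extI:
  fixes u v :: "'h::chilbert_space"
  assumes "\<And>x. cinner x u = cinner x v"
  shows "u = v"
proof -
  have "inner (u - v) u = inner (u - v) v"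
    using assms by (simp add: inner_eq_Re_cinner)
  then have "inner (u - v) (u - v) = 0"
    by (simp add: inner_diff_right)
  then show ?thesis by simp
qed

lemma ex_adjoint:
  fixes T :: "'h::chilbert_space bop"
  shows "\<exists>!S. \<forall>x y. cinner (bapp T x) y = cinner x (bapp S y)"
proof -
  have "\<exists>z. \<forall>x. cinner (bapp T x) y = cinner x z" for y
  proof -
    have "bounded_linear (\<lambda>x. inner (bapp T x) y)"
      by (intro bounded_linear_compose[OF bounded_linear_inner_left bounded_linear_bapp])
    then obtain z where z: "\<And>x. inner (bapp T x) y = inner x z"
      using Riesz_real by blast
    have Re: "Re (cinner (bapp T x) y) = Re (cinner x z)" for x
      using z[of x] by (simp add: inner_eq_Re_cinner)
    have "Im (cinner (bapp T x) y) = Im (cinner x z)" for x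
      using Re[of "\<i> *\<^sub>C x"] by (simp add: bapp_scaleC cinner_scaleC_left)
    with Re have "\<forall>x. cinner (bapp T x) y = cinner x z"
      by (simp add: complex_eq_iff)
    then show ?thesis by blast
  qed
  then obtain S where S: "\<And>x y. cinner (bapp T x) y = cinner x (S y)"
    by metis
  have add: "S (y + z) = S y + S z" for y z
    by (rule cinner_extI) (simp add: S[symmetric] cinner_add_right)
  have scale: "S (c *\<^sub>C y) = c *\<^sub>C S y" for c y
    by (rule cinner_extI) (simp add: S[symmetric] cinner_scaleC_right)
  obtain K where K: "\<And>x. norm (bapp T x) \<le> norm x * K"
    using bounded_linear.bounded[OF bounded_linear_bapp] by blast
  have bound: "norm (S y) \<le> norm y * K" for y
  proof (cases "S y = 0")
    case True
    have "0 \<le> norm y * K"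
      using K[of y] norm_ge_zero[of "bapp T y"] by linarith
    with True show ?thesis by simp
  next
    case False
    have "(norm (S y))\<^sup>2 = inner (bapp T (S y)) y"
      using S[of "S y" y] by (simp add: inner_eq_Re_cinner power2_norm_eq_inner)
    also have "\<dots> \<le> norm (bapp T (S y)) * norm y"
      by (rule norm_cauchy_schwarz)
    also have "\<dots> \<le> norm (S y) * K * norm y"
      by (rule mult_right_mono[OF K]) simp
    finally have "norm (S y) * norm (S y) \<le> norm (S y) * (norm y * K)"
      by (simp add: power2_eq_square mult_ac)
    with False show ?thesis by simp
  qed
  have bl: "bounded_linear S"
    using add bound by (intro bounded_linear_intro[where K = K]) (simp_all add: scaleR_scaleC scale)
  define S' where "S' = Bop (Blinfun S)"
  have "bapp S' y = S y" for y
    unfolding S'_def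
    by (simp add: bapp.rep_eq Bop_inverse bounded_linear_Blinfun_apply[OF bl] scale)
  then have S': "\<forall>x y. cinner (bapp T x) y = cinner x (bapp S' y)"
    using S by simp
  show ?thesis
  proof (rule ex1I[of _ S'])
    fix R assume "\<forall>x y. cinner (bapp T x) y = cinner x (bapp R y)"
    with S' show "R = S'"
      by (intro bop_eqI cinner_extI) metis
  qed (rule S')
qed

definition adj :: "'h::chilbert_space bop \<Rightarrow> 'h bop" where
  "adj T = (THE S. \<forall>x y. cinner (bapp T x) y = cinner x (bapp S y))"

lemma cinner_adj: "cinner (bapp T x) y = cinner x (bapp (adj T) y)"
  using theI'[OF ex_adjoint[of T]] unfolding adj_def by blast


section \<open>The Hilbert space of square-summable sequences\<close>

typedef ell2 = "{f :: nat \<Rightarrow> complex. summable (\<lambda>n. (cmod (f n))\<^sup>2)}"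
  morphisms ell2_coord Ell2
  by (rule exI[of _ "\<lambda>_. 0"]) simp

setup_lifting type_definition_ell2

lemma ell2_summable_add:
  assumes "summable (\<lambda>n. (cmod (f n))\<^sup>2)" and "summable (\<lambda>n. (cmod (g n))\<^sup>2)"
  shows "summable (\<lambda>n. (cmod (f n + g n))\<^sup>2)"
proof (rule summable_comparison_test)
  show "summable (\<lambda>n. 2 * (cmod (f n))\<^sup>2 + 2 * (cmod (g n))\<^sup>2)"
    by (intro summable_add summable_mult assms)
  have "(cmod (f n + g n))\<^sup>2 \<le> 2 * (cmod (f n))\<^sup>2 + 2 * (cmod (g n))\<^sup>2" for n
  proof -
    have "(cmod (f n + g n))\<^sup>2 \<le> (cmod (f n) + cmod (g n))\<^sup>2"
      by (intro power_mono norm_triangle_ineq) simp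
    also have "\<dots> \<le> 2 * (cmod (f n))\<^sup>2 + 2 * (cmod (g n))\<^sup>2"
      using zero_le_power2[of "cmod (f n) - cmod (g n)"]
      by (simp add: power2_sum power2_diff)
    finally show ?thesis .
  qed
  then show "\<exists>N. \<forall>n\<ge>N. norm ((cmod (f n + g n))\<^sup>2) \<le> 2 * (cmod (f n))\<^sup>2 + 2 * (cmod (g n))\<^sup>2"
    by simp
qed

lemma ell2_summable_scale:
  assumes "summable (\<lambda>n. (cmod (f n))\<^sup>2)"
  shows "summable (\<lambda>n. (cmod (c * f n))\<^sup>2)"
  using summable_mult[OF assms, of "(cmod c)\<^sup>2"] by (simp add: norm_mult power_mult_distrib)

lemma ell2_summable_prod:
  assumes "summable (\<lambda>n. (cmod (f n))\<^sup>2)" and "summable (\<lambda>n. (cmod (g n))\<^sup>2)"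
  shows "summable (\<lambda>n. f n * cnj (g n))"
proof (rule summable_norm_cancel, rule summable_comparison_test)
  show "summable (\<lambda>n. (cmod (f n))\<^sup>2 + (cmod (g n))\<^sup>2)"
    by (intro summable_add assms)
  have "cmod (f n) * cmod (g n) \<le> (cmod (f n))\<^sup>2 + (cmod (g n))\<^sup>2" for n
  proof -
    have "2 * (cmod (f n) * cmod (g n)) \<le> (cmod (f n))\<^sup>2 + (cmod (g n))\<^sup>2"
      using sum_squares_bound[of "cmod (f n)" "cmod (g n)"] by (simp add: mult.assoc)
    moreover have "0 \<le> cmod (f n) * cmod (g n)" by simp
    ultimately show ?thesis by linarith
  qed
  then show "\<exists>N. \<forall>n\<ge>N. norm (norm (f n * cnj (g n))) \<le> (cmod (f n))\<^sup>2 + (cmod (g n))\<^sup>2"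
    by (simp add: norm_mult)
qed

instantiation ell2 :: "{real_inner, scaleC}"
begin

lift_definition zero_ell2 :: ell2 is "\<lambda>_. 0"
  by simp
lift_definition plus_ell2 :: "ell2 \<Rightarrow> ell2 \<Rightarrow> ell2" is "\<lambda>f g n. f n + g n"
  by (rule ell2_summable_add)
lift_definition uminus_ell2 :: "ell2 \<Rightarrow> ell2" is "\<lambda>f n. - f n"
  by simp
lift_definition minus_ell2 :: "ell2 \<Rightarrow> ell2 \<Rightarrow> ell2" is "\<lambda>f g n. f n - g n"
  using ell2_summable_add[where g = "\<lambda>n. - g n" for g] by simp
lift_definition scaleC_ell2 :: "complex \<Rightarrow> ell2 \<Rightarrow> ell2" is "\<lambda>c f n. c * f n"
  by (rule ell2_summable_scale)
lift_definition scaleR_ell2 :: "real \<Rightarrow> ell2 \<Rightarrow> ell2" is "\<lambda>r f n. complex_of_real r * f n"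
  by (rule ell2_summable_scale)
lift_definition inner_ell2 :: "ell2 \<Rightarrow> ell2 \<Rightarrow> real" is "\<lambda>f g. Re (\<Sum>n. f n * cnj (g n))" .

definition norm_ell2 :: "ell2 \<Rightarrow> real" where "norm_ell2 x = sqrt (inner x x)"
definition dist_ell2 :: "ell2 \<Rightarrow> ell2 \<Rightarrow> real" where "dist_ell2 x y = norm (x - y)"
definition sgn_ell2 :: "ell2 \<Rightarrow> ell2" where "sgn_ell2 x = inverse (norm x) *\<^sub>R x"
definition "(uniformity :: (ell2 \<times> ell2) filter) =
  (INF e\<in>{0<..}. principal {(x, y). dist x y < e})"
definition open_ell2 :: "ell2 set \<Rightarrow> bool" where
  "open_ell2 U = (\<forall>x\<in>U. \<forall>\<^sub>F (x', y) in uniformity. x' = x \<longrightarrow> y \<in> U)"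

lemma inner_ell2_self: "inner x x = (\<Sum>n. (cmod (ell2_coord x n))\<^sup>2)" for x :: ell2
proof -
  have "summable (\<lambda>n. (cmod (ell2_coord x n))\<^sup>2)"
    using ell2_coord by simp
  then have "(\<Sum>n. complex_of_real ((cmod (ell2_coord x n))\<^sup>2)) =
      complex_of_real (\<Sum>n. (cmod (ell2_coord x n))\<^sup>2)"
    by (rule suminf_of_real[symmetric])
  then show ?thesis
    by (simp only: inner_ell2.rep_eq complex_norm_square[symmetric] Re_complex_of_real)
qed

instance
proof
  fix x y z :: ell2 and r s :: real
  show "x + y + z = x + (y + z)" by transfer (simp add: add.assoc)
  show "x + y = y + x" by transfer (simp add: add.commute)
  show "0 + x = x" by transfer simp
  show "- x + x = 0" by transfer simp
  show "x - y = x + - y" by transfer simp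
  show "r *\<^sub>R (x + y) = r *\<^sub>R x + r *\<^sub>R y" by transfer (simp add: algebra_simps)
  show "(r + s) *\<^sub>R x = r *\<^sub>R x + s *\<^sub>R x" by transfer (simp add: algebra_simps)
  show "r *\<^sub>R s *\<^sub>R x = (r * s) *\<^sub>R x" by transfer (simp add: algebra_simps)
  show "1 *\<^sub>R x = x" by transfer simp
  show "dist x y = norm (x - y)" by (rule dist_ell2_def)
  show "sgn x = inverse (norm x) *\<^sub>R x" by (rule sgn_ell2_def)
  show "norm x = sqrt (inner x x)" by (rule norm_ell2_def)
  show "inner x y = inner y x"
  proof transfer
    fix f g :: "nat \<Rightarrow> complex"
    assume "summable (\<lambda>n. (cmod (f n))\<^sup>2)" and "summable (\<lambda>n. (cmod (g n))\<^sup>2)"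
    then have "summable (\<lambda>n. f n * cnj (g n))" and "summable (\<lambda>n. g n * cnj (f n))"
      by (auto intro: ell2_summable_prod)
    then show "Re (\<Sum>n. f n * cnj (g n)) = Re (\<Sum>n. g n * cnj (f n))"
      by (simp add: Re_suminf mult.commute)
  qed
  show "inner (x + y) z = inner x z + inner y z"
  proof transfer
    fix f g h :: "nat \<Rightarrow> complex"
    assume "summable (\<lambda>n. (cmod (f n))\<^sup>2)" and "summable (\<lambda>n. (cmod (g n))\<^sup>2)"
      and "summable (\<lambda>n. (cmod (h n))\<^sup>2)"
    then have "summable (\<lambda>n. f n * cnj (h n))" and "summable (\<lambda>n. g n * cnj (h n))"
      by (auto intro: ell2_summable_prod)
    then show "Re (\<Sum>n. (f n + g n) * cnj (h n)) =
        Re (\<Sum>n. f n * cnj (h n)) + Re (\<Sum>n. g n * cnj (h n))"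
      by (simp add: distrib_right suminf_add[symmetric])
  qed
  show "inner (r *\<^sub>R x) y = r * inner x y"
  proof transfer
    fix f g :: "nat \<Rightarrow> complex" and r :: real
    assume "summable (\<lambda>n. (cmod (f n))\<^sup>2)" and "summable (\<lambda>n. (cmod (g n))\<^sup>2)"
    then have "summable (\<lambda>n. f n * cnj (g n))"
      by (rule ell2_summable_prod)
    then show "Re (\<Sum>n. complex_of_real r * f n * cnj (g n)) = r * Re (\<Sum>n. f n * cnj (g n))"
      by (simp add: mult.assoc suminf_mult)
  qed
  show "0 \<le> inner x x"
    unfolding inner_ell2_self using ell2_coord[of x] by (intro suminf_nonneg) simp_all
  show "inner x x = 0 \<longleftrightarrow> x = 0"
    unfolding inner_ell2_self using ell2_coord[of x]
    by (subst suminf_eq_zero_iff) (simp_all add: ell2_coord_inject[symmetric] zero_ell2.rep_eq fun_eq_iff)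
  show "(uniformity :: (ell2 \<times> ell2) filter) =
      (INF e\<in>{0<..}. principal {(x, y). dist x y < e})"
    by (rule uniformity_ell2_def)
  fix U :: "ell2 set"
  show "open U = (\<forall>x\<in>U. \<forall>\<^sub>F (x', y) in uniformity. x' = x \<longrightarrow> y \<in> U)"
    by (rule open_ell2_def)
qed

end

lemma ell2_norm_square: "(norm x)\<^sup>2 = (\<Sum>n. (cmod (ell2_coord x n))\<^sup>2)" for x :: ell2
  by (simp add: power2_norm_eq_inner inner_ell2_self)

lemma ell2_partial_sum_le: "(\<Sum>n<p. (cmod (ell2_coord x n))\<^sup>2) \<le> (norm x)\<^sup>2" for x :: ell2
  unfolding ell2_norm_square using ell2_coord[of x] by (intro sum_le_suminf) simp_all

instantiation ell2 :: chilbert_space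
begin

lift_definition cinner_ell2 :: "ell2 \<Rightarrow> ell2 \<Rightarrow> complex" is "\<lambda>f g. \<Sum>n. f n * cnj (g n)" .

instance
proof
  fix x y z :: ell2 and c d :: complex and r :: real
  show "c *\<^sub>C (x + y) = c *\<^sub>C x + c *\<^sub>C y" by transfer (simp add: algebra_simps)
  show "(c + d) *\<^sub>C x = c *\<^sub>C x + d *\<^sub>C x" by transfer (simp add: algebra_simps)
  show "c *\<^sub>C d *\<^sub>C x = (c * d) *\<^sub>C x" by transfer (simp add: algebra_simps)
  show "r *\<^sub>R x = complex_of_real r *\<^sub>C x" by transfer simp
  show "inner x y = Re (cinner x y)" by transfer simp
  show "cinner (x + y) z = cinner x z + cinner y z"
  proof transfer
    fix f g h :: "nat \<Rightarrow> complex"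
    assume "summable (\<lambda>n. (cmod (f n))\<^sup>2)" and "summable (\<lambda>n. (cmod (g n))\<^sup>2)"
      and "summable (\<lambda>n. (cmod (h n))\<^sup>2)"
    then have "summable (\<lambda>n. f n * cnj (h n))" and "summable (\<lambda>n. g n * cnj (h n))"
      by (auto intro: ell2_summable_prod)
    then show "(\<Sum>n. (f n + g n) * cnj (h n)) = (\<Sum>n. f n * cnj (h n)) + (\<Sum>n. g n * cnj (h n))"
      by (simp add: distrib_right suminf_add[symmetric])
  qed
  show "cinner (c *\<^sub>C x) y = c * cinner x y"
  proof transfer
    fix f g :: "nat \<Rightarrow> complex" and c :: complex
    assume "summable (\<lambda>n. (cmod (f n))\<^sup>2)" and "summable (\<lambda>n. (cmod (g n))\<^sup>2)"
    then have "summable (\<lambda>n. f n * cnj (g n))"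
      by (rule ell2_summable_prod)
    then show "(\<Sum>n. c * f n * cnj (g n)) = c * (\<Sum>n. f n * cnj (g n))"
      by (simp add: mult.assoc suminf_mult)
  qed
  show "cinner x y = cnj (cinner y x)"
  proof transfer
    fix f g :: "nat \<Rightarrow> complex"
    assume "summable (\<lambda>n. (cmod (f n))\<^sup>2)" and "summable (\<lambda>n. (cmod (g n))\<^sup>2)"
    then have "summable (\<lambda>n. g n * cnj (f n))"
      by (intro ell2_summable_prod)
    then have "(\<lambda>n. cnj (g n * cnj (f n))) sums cnj (\<Sum>n. g n * cnj (f n))"
      by (subst sums_cnj) (rule summable_sums)
    then show "(\<Sum>n. f n * cnj (g n)) = cnj (\<Sum>n. g n * cnj (f n))"
      by (simp add: mult.commute sums_iff)
  qed
next
  fix X :: "nat \<Rightarrow> ell2"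
  assume X: "Cauchy X"
  have "Cauchy (\<lambda>k. ell2_coord (X k) n)" for n
  proof (rule metric_CauchyI)
    fix e :: real assume "0 < e"
    then obtain N where N: "\<And>k l. N \<le> k \<Longrightarrow> N \<le> l \<Longrightarrow> dist (X k) (X l) < e"
      using X by (meson Cauchy_def)
    have "dist (ell2_coord (X k) n) (ell2_coord (X l) n) \<le> dist (X k) (X l)" for k l
    proof -
      have "(cmod (ell2_coord (X k - X l) n))\<^sup>2 \<le> (\<Sum>i<Suc n. (cmod (ell2_coord (X k - X l) i))\<^sup>2)"
        by (rule member_le_sum) simp_all
      also have "\<dots> \<le> (norm (X k - X l))\<^sup>2"
        by (rule ell2_partial_sum_le)
      finally show ?thesis
        by (simp add: dist_norm minus_ell2.rep_eq power2_le_iff_abs_le)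
    qed
    with N show "\<exists>N. \<forall>k\<ge>N. \<forall>l\<ge>N. dist (ell2_coord (X k) n) (ell2_coord (X l) n) < e"
      by (meson le_less_trans)
  qed
  then have "\<forall>n. \<exists>l. (\<lambda>k. ell2_coord (X k) n) \<longlonglongrightarrow> l"
    using Cauchy_convergent convergent_def by blast
  then have "\<exists>f. \<forall>n. (\<lambda>k. ell2_coord (X k) n) \<longlonglongrightarrow> f n"
    by (rule choice)
  then obtain f where f: "\<And>n. (\<lambda>k. ell2_coord (X k) n) \<longlonglongrightarrow> f n"
    by blast
  have bound: "\<exists>N. \<forall>k\<ge>N. \<forall>p. (\<Sum>n<p. (cmod (f n - ell2_coord (X k) n))\<^sup>2) \<le> e\<^sup>2" if "0 < e" for e
  proof -
    from that obtain N where N: "\<And>k l. N \<le> k \<Longrightarrow> N \<le> l \<Longrightarrow> dist (X k) (X l) < e"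
      using X by (meson Cauchy_def)
    have "(\<Sum>n<p. (cmod (f n - ell2_coord (X k) n))\<^sup>2) \<le> e\<^sup>2" if k: "N \<le> k" for k p
    proof (rule LIMSEQ_le_const2)
      show "(\<lambda>l. \<Sum>n<p. (cmod (ell2_coord (X l) n - ell2_coord (X k) n))\<^sup>2)
          \<longlonglongrightarrow> (\<Sum>n<p. (cmod (f n - ell2_coord (X k) n))\<^sup>2)"
        by (intro tendsto_intros f)
      have "(\<Sum>n<p. (cmod (ell2_coord (X l) n - ell2_coord (X k) n))\<^sup>2) \<le> e\<^sup>2" if "N \<le> l" for l
      proof -
        have "(\<Sum>n<p. (cmod (ell2_coord (X l - X k) n))\<^sup>2) \<le> (norm (X l - X k))\<^sup>2"
          by (rule ell2_partial_sum_le)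
        also have "\<dots> \<le> e\<^sup>2"
          using N[OF that k] by (intro power_mono) (simp_all add: dist_norm)
        finally show ?thesis by (simp add: minus_ell2.rep_eq)
      qed
      then show "\<exists>M. \<forall>l\<ge>M. (\<Sum>n<p. (cmod (ell2_coord (X l) n - ell2_coord (X k) n))\<^sup>2) \<le> e\<^sup>2"
        by blast
    qed
    then show ?thesis by blast
  qed
  have diff: "summable (\<lambda>n. (cmod (f n - ell2_coord (X k) n))\<^sup>2)"
    if "\<And>p. (\<Sum>n<p. (cmod (f n - ell2_coord (X k) n))\<^sup>2) \<le> e\<^sup>2" for k e
    using that by (intro summableI_nonneg_bounded) simp_all
  obtain N where "\<And>p. (\<Sum>n<p. (cmod (f n - ell2_coord (X N) n))\<^sup>2) \<le> 1\<^sup>2"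
    using bound[of 1] by auto
  from ell2_summable_add[OF diff[OF this], of "ell2_coord (X N)"]
  have fs: "summable (\<lambda>n. (cmod (f n))\<^sup>2)"
    using ell2_coord[of "X N"] by simp
  define L where "L = Ell2 f"
  have L: "ell2_coord L = f"
    unfolding L_def using fs by (simp add: Ell2_inverse)
  have "X \<longlonglongrightarrow> L"
  proof (rule metric_LIMSEQ_I)
    fix e :: real assume e: "0 < e"
    then obtain N where N: "\<And>k p. N \<le> k \<Longrightarrow> (\<Sum>n<p. (cmod (f n - ell2_coord (X k) n))\<^sup>2) \<le> (e/2)\<^sup>2"
      using bound[of "e/2"] by auto
    have "dist (X k) L < e" if "N \<le> k" for k
    proof -
      have "(norm (L - X k))\<^sup>2 = (\<Sum>n. (cmod (f n - ell2_coord (X k) n))\<^sup>2)"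
        by (simp add: ell2_norm_square minus_ell2.rep_eq L)
      also have "\<dots> \<le> (e/2)\<^sup>2"
        using N[OF that] diff[OF N[OF that]] by (intro suminf_le_const) simp_all
      finally have "norm (L - X k) \<le> e/2"
        by (rule power2_le_imp_le) (use e in simp)
      with e show ?thesis
        by (simp add: dist_norm norm_minus_commute)
    qed
    then show "\<exists>N. \<forall>k\<ge>N. dist (X k) L < e" by blast
  qed
  then show "convergent X"
    by (rule convergentI)
qed

end

section \<open>C*-algebras, operator systems and completely positive maps\<close>

text \<open>C*-algebras are taken concretely, as norm-closed unital *-subalgebras of the bounded
  operators on an arbitrary Hilbert space.\<close>

definition cstar_subalgebra :: "'h::chilbert_space bop set \<Rightarrow> bool" where
  "cstar_subalgebra A \<longleftrightarrow>
     1 \<in> A \<and> (\<forall>S\<in>A. \<forall>T\<in>A. S + T \<in> A \<and> S * T \<in> A) \<and>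
     (\<forall>c. \<forall>T\<in>A. c *\<^sub>C T \<in> A) \<and> (\<forall>T\<in>A. adj T \<in> A) \<and> closed A"

definition cstar_gen :: "'h::chilbert_space bop set \<Rightarrow> 'h bop set" where
  "cstar_gen S = \<Inter>{A. cstar_subalgebra A \<and> S \<subseteq> A}"

definition unital_star_hom ::
    "'h::chilbert_space bop set \<Rightarrow> ('h bop \<Rightarrow> 'k::chilbert_space bop) \<Rightarrow> bool" where
  "unital_star_hom A \<pi> \<longleftrightarrow>
     \<pi> 1 = 1 \<and>
     (\<forall>S\<in>A. \<forall>T\<in>A. \<pi> (S + T) = \<pi> S + \<pi> T \<and> \<pi> (S * T) = \<pi> S * \<pi> T) \<and>
     (\<forall>c. \<forall>T\<in>A. \<pi> (c *\<^sub>C T) = c *\<^sub>C \<pi> T) \<and>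
     (\<forall>T\<in>A. \<pi> (adj T) = adj (\<pi> T))"

text \<open>Positivity of the \<open>n \<times> n\<close> operator matrix \<open>(X i j)\<close>, \<open>i, j < n\<close>, as an operator on the
  \<open>n\<close>-fold direct sum of the Hilbert space.\<close>

definition mat_pos :: "nat \<Rightarrow> (nat \<Rightarrow> nat \<Rightarrow> 'h::chilbert_space bop) \<Rightarrow> bool" where
  "mat_pos n X \<longleftrightarrow>
     (\<forall>\<xi> :: nat \<Rightarrow> 'h. (\<Sum>i<n. \<Sum>j<n. cinner (bapp (X i j) (\<xi> j)) (\<xi> i)) \<in> \<real> \<and>
        0 \<le> Re (\<Sum>i<n. \<Sum>j<n. cinner (bapp (X i j) (\<xi> j)) (\<xi> i)))"

definition unital_clinear_on ::
    "'h::chilbert_space bop set \<Rightarrow> ('h bop \<Rightarrow> 'k::chilbert_space bop) \<Rightarrow> bool" where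
  "unital_clinear_on R \<phi> \<longleftrightarrow>
     \<phi> 1 = 1 \<and> (\<forall>S\<in>R. \<forall>T\<in>R. \<phi> (S + T) = \<phi> S + \<phi> T) \<and> (\<forall>c. \<forall>T\<in>R. \<phi> (c *\<^sub>C T) = c *\<^sub>C \<phi> T)"

text \<open>Maps are total functions in HOL; only their values on the operator system \<open>R\<close> matter.\<close>

definition ucp_on ::
    "'h::chilbert_space bop set \<Rightarrow> ('h bop \<Rightarrow> 'k::chilbert_space bop) \<Rightarrow> bool" where
  "ucp_on R \<phi> \<longleftrightarrow>
     unital_clinear_on R \<phi> \<and>
     (\<forall>n X. (\<forall>i<n. \<forall>j<n. X i j \<in> R) \<longrightarrow> mat_pos n X \<longrightarrow> mat_pos n (\<lambda>i j. \<phi> (X i j)))"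

definition unital_complete_order_embedding ::
    "'h::chilbert_space bop set \<Rightarrow> ('h bop \<Rightarrow> 'k::chilbert_space bop) \<Rightarrow> bool" where
  "unital_complete_order_embedding R \<kappa> \<longleftrightarrow>
     unital_clinear_on R \<kappa> \<and> inj_on \<kappa> R \<and>
     (\<forall>n X. (\<forall>i<n. \<forall>j<n. X i j \<in> R) \<longrightarrow> (mat_pos n (\<lambda>i j. \<kappa> (X i j)) \<longleftrightarrow> mat_pos n X))"

text \<open>The C*-envelope of \<open>R\<close> is \<open>cstar_gen (\<iota> ` R)\<close>. HOL cannot quantify over the type of the
  Hilbert space on which the competing C*-covers \<open>cstar_gen (\<kappa> ` R)\<close> act. For a separable \<open>R\<close>
  every C*-cover is separable and hence has a faithful unital representation on the sequence
  space \<^typ>\<open>ell2\<close>, so that nothing is lost by letting \<open>\<kappa>\<close> range over maps into its operators.\<close>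

definition is_cstar_envelope ::
    "'h::chilbert_space bop set \<Rightarrow> ('h bop \<Rightarrow> 'e::chilbert_space bop) \<Rightarrow> bool" where
  "is_cstar_envelope R \<iota> \<longleftrightarrow>
     unital_complete_order_embedding R \<iota> \<and>
     (\<forall>\<kappa> :: 'h bop \<Rightarrow> ell2 bop. unital_complete_order_embedding R \<kappa> \<longrightarrow>
        (\<exists>\<pi>. unital_star_hom (cstar_gen (\<kappa> ` R)) \<pi> \<and>
             \<pi> ` cstar_gen (\<kappa> ` R) \<subseteq> cstar_gen (\<iota> ` R) \<and>
             (\<forall>x\<in>R. \<iota> x = \<pi> (\<kappa> x))))"

definition commutant :: "'h::chilbert_space bop set \<Rightarrow> 'h bop set" where
  "commutant S = {T. \<forall>A\<in>S. T * A = A * T}"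


section \<open>Full group C*-algebras\<close>

definition group_algebra :: "('g, 'm) monoid_scheme \<Rightarrow> ('g \<Rightarrow> complex) set" where
  "group_algebra G = {f. finite {x. f x \<noteq> 0} \<and> {x. f x \<noteq> 0} \<subseteq> carrier G}"

definition convolution ::
    "('g, 'm) monoid_scheme \<Rightarrow> ('g \<Rightarrow> complex) \<Rightarrow> ('g \<Rightarrow> complex) \<Rightarrow> 'g \<Rightarrow> complex" where
  "convolution G f g = (\<lambda>z. \<Sum>(x, y) | f x \<noteq> 0 \<and> g y \<noteq> 0 \<and> x \<otimes>\<^bsub>G\<^esub> y = z. f x * g y)"

definition involution :: "('g, 'm) monoid_scheme \<Rightarrow> ('g \<Rightarrow> complex) \<Rightarrow> 'g \<Rightarrow> complex" where
  "involution G f = (\<lambda>x. if x \<in> carrier G then cnj (f (inv\<^bsub>G\<^esub> x)) else 0)"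

definition cstar_seminorm ::
    "('g, 'm) monoid_scheme \<Rightarrow> (('g \<Rightarrow> complex) \<Rightarrow> real) \<Rightarrow> bool" where
  "cstar_seminorm G p \<longleftrightarrow>
     (\<forall>f\<in>group_algebra G. \<forall>g\<in>group_algebra G.
        p (\<lambda>x. f x + g x) \<le> p f + p g \<and> p (convolution G f g) \<le> p f * p g) \<and>
     (\<forall>c. \<forall>f\<in>group_algebra G. p (\<lambda>x. c * f x) = cmod c * p f) \<and>
     (\<forall>f\<in>group_algebra G. 0 \<le> p f \<and> p (convolution G (involution G f) f) = (p f)\<^sup>2)"

text \<open>The norm of the full group C*-algebra. C*-seminorms are the same as pullbacks of norms along
  *-homomorphisms into C*-algebras, so this is the supremum over all unitary representations. It is
  finite, because a C*-seminorm is at most 1 on group elements.\<close>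

definition full_norm :: "('g, 'm) monoid_scheme \<Rightarrow> ('g \<Rightarrow> complex) \<Rightarrow> real" where
  "full_norm G f = (SUP p\<in>Collect (cstar_seminorm G). p f)"

text \<open>\<open>u\<close> is the canonical unitary representation of \<open>G\<close> in its full group C*-algebra: the group
  algebra with its largest C*-seminorm is embedded isometrically, and its completion is
  \<open>cstar_gen (u ` carrier G)\<close>.\<close>

definition is_full_group_rep ::
    "('g, 'm) monoid_scheme \<Rightarrow> ('g \<Rightarrow> 'h::chilbert_space bop) \<Rightarrow> bool" where
  "is_full_group_rep G u \<longleftrightarrow>
     u \<one>\<^bsub>G\<^esub> = 1 \<and>
     (\<forall>x\<in>carrier G. \<forall>y\<in>carrier G. u (x \<otimes>\<^bsub>G\<^esub> y) = u x * u y) \<and>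
     (\<forall>x\<in>carrier G. u (inv\<^bsub>G\<^esub> x) = adj (u x)) \<and>
     (\<forall>f\<in>group_algebra G. norm (\<Sum>x | f x \<noteq> 0. f x *\<^sub>C u x) = full_norm G f)"


section \<open>Free products of groups\<close>

text \<open>Elements are the reduced words \<open>[(i\<^sub>1, g\<^sub>1), \<dots>, (i\<^sub>n, g\<^sub>n)]\<close> with \<open>g\<^sub>j\<close> a nontrivial element of
  \<open>G i\<^sub>j\<close> and \<open>i\<^sub>j \<noteq> i\<^sub>j\<^sub>+\<^sub>1\<close>.\<close>

definition reduced_words :: "'i set \<Rightarrow> ('i \<Rightarrow> 'g monoid) \<Rightarrow> ('i \<times> 'g) list set" where
  "reduced_words I G =
     {w. (\<forall>(i, g)\<in>set w. i \<in> I \<and> g \<in> carrier (G i) \<and> g \<noteq> \<one>\<^bsub>G i\<^esub>) \<and> distinct_adj (map fst w)}"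

text \<open>Left multiplication of a reduced word by an element of a free factor.\<close>

fun word_cons :: "('i \<Rightarrow> 'g monoid) \<Rightarrow> 'i \<times> 'g \<Rightarrow> ('i \<times> 'g) list \<Rightarrow> ('i \<times> 'g) list" where
  "word_cons G (i, g) [] = (if g = \<one>\<^bsub>G i\<^esub> then [] else [(i, g)])"
| "word_cons G (i, g) ((j, h) # w) =
     (if g = \<one>\<^bsub>G i\<^esub> then (j, h) # w
      else if i = j then (if g \<otimes>\<^bsub>G i\<^esub> h = \<one>\<^bsub>G i\<^esub> then w else (i, g \<otimes>\<^bsub>G i\<^esub> h) # w)
      else (i, g) # (j, h) # w)"

definition free_product :: "'i set \<Rightarrow> ('i \<Rightarrow> 'g monoid) \<Rightarrow> ('i \<times> 'g) list monoid" where
  "free_product I G =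
     \<lparr>carrier = reduced_words I G, monoid.mult = (\<lambda>v w. foldr (word_cons G) v w), one = []\<rparr>"

definition factor_elem :: "('i \<Rightarrow> 'g monoid) \<Rightarrow> 'i \<Rightarrow> 'g \<Rightarrow> ('i \<times> 'g) list" where
  "factor_elem G i g = word_cons G (i, g) []"


section \<open>The operator systems \<open>NC(d)\<close> and \<open>NCP(k)\<close>\<close>

definition NC_factors :: "nat \<Rightarrow> int monoid" where
  "NC_factors = (\<lambda>_. integer_mod_group 2)"

definition is_NC :: "nat \<Rightarrow> 'h::chilbert_space bop set \<Rightarrow> bool" where
  "is_NC d R \<longleftrightarrow>
     (\<exists>u. is_full_group_rep (free_product {1..d} NC_factors) u \<and>
          R = module.span (*\<^sub>C) (insert 1 {u (factor_elem NC_factors i 1) | i. i \<in> {1..d}}))"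

definition NCP_factors :: "nat \<Rightarrow> nat \<Rightarrow> int monoid" where
  "NCP_factors k = (\<lambda>i. integer_mod_group (if i = 1 then k else 2))"

text \<open>The generator of the cyclic group of order \<open>k\<close> is \<open>1 mod k\<close>, which is \<open>0\<close> if \<open>k = 1\<close>.\<close>

definition is_NCP :: "nat \<Rightarrow> 'h::chilbert_space bop set \<Rightarrow> bool" where
  "is_NCP k R \<longleftrightarrow>
     (\<exists>u w v. is_full_group_rep (free_product {1, 2} (NCP_factors k)) u \<and>
          w = u (factor_elem (NCP_factors k) 1 (1 mod int k)) \<and>
          v = u (factor_elem (NCP_factors k) 2 1) \<and>
          R = module.span (*\<^sub>C) (insert v {w ^ j | j. j < k}))"

end

theory Submission
  imports Defs "HOL-Library.Poly_Mapping"
begin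

text \<open>Both families are instances of one situation: \<open>R\<close> is spanned by the canonical unitaries of the
  free factors in the full C*-algebra of a free product \<open>FP\<close> of groups. On each factor \<open>\<phi>\<close> is a
  positive definite function, and by Boca's theorem the product of these functions along reduced
  words is positive definite on \<open>FP\<close>; its values are products of elements of \<open>\<phi> ` R\<close>. Since the
  C*-algebra is full, a positive definite function induces a completely positive map on it.

  It remains to replace the given copy of the full C*-algebra by \<open>cstar_gen (\<iota> ` R)\<close>. Comparing \<open>\<iota>\<close>
  with a faithful representation on \<^typ>\<open>ell2\<close> shows that the images of the letters extend to a
  unitary representation \<open>U\<close> of \<open>FP\<close>. As \<open>R\<close> contains the generating unitaries, the order structure
  of \<open>R\<close> determines that of the group algebra, so every positive combination of the \<open>U w\<close> is also
  positive in the full C*-algebra.\<close>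

section \<open>Hilbert spaces and bounded operators\<close>

text \<open>The full group C*-algebra is given through a norm only, whereas the conclusion is about
  order on matrices. The bridge is an isometric action on a degenerate inner product space that is
  never completed: its operator seminorm is a C*-seminorm, hence lies below the full norm, and
  expanding the square of the norm of \<open>1 - s T\<close> for small \<open>s\<close> turns this
  inequality into positivity of a single element. Matrices are reduced to single elements by
  splitting finitely many vectors into almost orthogonal cyclic pieces.

  The envelope property yields a homomorphism towards the envelope only, possibly with a kernel,
  while the extension needs a map in the opposite direction. This is where unitarity of the
  generators counts: it forces the order of their span to determine the order of all their products.
  Since the operators involved live on different Hilbert spaces, they are compared through quadratic
  forms with coefficients in the group algebra.\<close>

lemma cnj_phase: obtains c where "cmod c = 1" "cnj c * z = complex_of_real (cmod z)"
proof (cases "z = 0")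
  case True
  then show ?thesis by (intro that[of 1]) auto
next
  case False
  have "cnj (sgn z) * z = complex_of_real (cmod z)"
    using False complex_norm_square[of z]
    by (simp add: sgn_eq field_simps power2_eq_square)
  then show ?thesis
    using False by (intro that[of "sgn z"]) (auto simp: norm_sgn)
qed

section \<open>Hermitian forms and the Cauchy-Schwarz inequality\<close>

locale hermitian_form =
  fixes sc :: "complex \<Rightarrow> 'v::ab_group_add \<Rightarrow> 'v" and B :: "'v \<Rightarrow> 'v \<Rightarrow> complex"
  assumes sc_module: "module sc"
    and B_add: "B (a + b) c = B a c + B b c"
    and B_sc: "B (sc k a) c = k * B a c"
    and B_cnj: "B a b = cnj (B b a)"
begin

sublocale module sc by (rule sc_module)

lemma B_zero_left [simp]: "B 0 a = 0"
  using B_add[of 0 0 a] by simp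
lemma B_zero_right [simp]: "B a 0 = 0"
  by (subst B_cnj) simp
lemma B_minus: "B (- a) c = - B a c"
  using B_add[of a "- a" c] by (simp add: eq_neg_iff_add_eq_0 add.commute)
lemma B_diff: "B (a - b) c = B a c - B b c"
  using B_add[of a "- b" c] by (simp add: B_minus)
lemma B_add_right: "B c (a + b) = B c a + B c b"
  by (metis B_add B_cnj complex_cnj_add)
lemma B_diff_right: "B c (a - b) = B c a - B c b"
  by (metis B_diff B_cnj complex_cnj_diff)
lemma B_minus_right: "B c (- a) = - B c a"
  using B_diff_right[of c 0 a] by simp
lemma B_sc_right: "B c (sc k a) = cnj k * B c a"
  by (metis B_sc B_cnj complex_cnj_mult)
lemma B_sum: "B (sum f S) c = (\<Sum>x\<in>S. B (f x) c)"
  by (induction S rule: infinite_finite_induct) (auto simp: B_add)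
lemma B_sum_right: "B c (sum f S) = (\<Sum>x\<in>S. B c (f x))"
  by (induction S rule: infinite_finite_induct) (auto simp: B_add_right)
lemma Im_B_self [simp]: "Im (B a a) = 0"
  using B_cnj[of a a] by (simp add: complex_eq_iff)

end

text \<open>Positivity is a separate layer because the induction for Boca's theorem computes with
  the Hermitian form of a kernel before that form is known to be positive. The form may be
  degenerate, as those built from positive definite functions generally are.\<close>

locale prehilbert = hermitian_form sc B
  for sc :: "complex \<Rightarrow> 'v::ab_group_add \<Rightarrow> 'v" and B :: "'v \<Rightarrow> 'v \<Rightarrow> complex" +
  assumes B_pos: "0 \<le> Re (B a a)"
begin

definition nn :: "'v \<Rightarrow> real" where "nn a = sqrt (Re (B a a))"

lemma nn_nonneg [simp]: "0 \<le> nn a"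
  unfolding nn_def using B_pos by simp
lemma nn_square: "(nn a)\<^sup>2 = Re (B a a)"
  unfolding nn_def using B_pos by simp
lemma B_self: "B a a = complex_of_real ((nn a)\<^sup>2)"
  unfolding nn_square by (simp add: complex_eq_iff)
lemma nn_zero [simp]: "nn 0 = 0" by (simp add: nn_def)

lemma nn_sc: "nn (sc k a) = cmod k * nn a"
proof -
  have "B (sc k a) (sc k a) = complex_of_real ((cmod k)\<^sup>2) * B a a"
    by (simp only: B_sc B_sc_right complex_norm_square mult_ac)
  then have "(nn (sc k a))\<^sup>2 = (cmod k * nn a)\<^sup>2"
    by (simp add: nn_square power_mult_distrib)
  then show ?thesis
    by (simp add: power2_eq_iff_nonneg)
qed

lemma nn_add_square: "(nn (a + b))\<^sup>2 = (nn a)\<^sup>2 + 2 * Re (B a b) + (nn b)\<^sup>2"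
  using arg_cong[OF B_cnj[of b a], of Re] by (simp add: nn_square B_add B_add_right)

lemma nn_diff_square: "(nn (a - b))\<^sup>2 = (nn a)\<^sup>2 - 2 * Re (B a b) + (nn b)\<^sup>2"
  using arg_cong[OF B_cnj[of b a], of Re] by (simp add: nn_square B_diff B_diff_right)

lemma Cauchy_Schwarz: "cmod (B a b) \<le> nn a * nn b"
proof -
  obtain c where c: "cmod c = 1" "cnj c * B a b = complex_of_real (cmod (B a b))"
    by (rule cnj_phase)
  let ?m = "cmod (B a b)"
  have pos: "0 \<le> (nn a)\<^sup>2 - 2 * t * ?m + t\<^sup>2 * (nn b)\<^sup>2" for t
  proof -
    have "0 \<le> (nn (a - sc (of_real t * c) b))\<^sup>2" by simp
    also have "\<dots> = (nn a)\<^sup>2 - 2 * Re (of_real t * (cnj c * B a b)) + (nn (sc (of_real t * c) b))\<^sup>2"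
      by (simp add: nn_diff_square B_sc_right mult.assoc)
    also have "\<dots> = (nn a)\<^sup>2 - 2 * t * ?m + t\<^sup>2 * (nn b)\<^sup>2"
      unfolding c(2) by (simp add: nn_sc norm_mult c(1) power_mult_distrib)
    finally show ?thesis .
  qed
  have "?m\<^sup>2 \<le> (nn a)\<^sup>2 * (nn b)\<^sup>2"
  proof (cases "nn b = 0")
    \<comment> \<open>For a null vector \<open>b\<close> the bound \<open>pos\<close> is affine in
      \<open>t\<close>; at the value chosen below it would equal \<open>-1\<close>.\<close>
    case True
    have "?m = 0"
    proof (rule ccontr)
      assume m: "?m \<noteq> 0"
      then show False
        using pos[of "((nn a)\<^sup>2 + 1) / (2 * ?m)"] True by (simp add: field_simps)
    qed
    then show ?thesis by simp
  next
    case False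
    then have b: "(nn b)\<^sup>2 > 0" by simp
    have "0 \<le> (nn a)\<^sup>2 - 2 * (?m / (nn b)\<^sup>2) * ?m + (?m / (nn b)\<^sup>2)\<^sup>2 * (nn b)\<^sup>2"
      by (rule pos)
    also have "\<dots> = (nn a)\<^sup>2 - ?m\<^sup>2 / (nn b)\<^sup>2"
      using b by (simp add: field_simps power2_eq_square)
    finally show ?thesis
      using b by (simp add: field_simps)
  qed
  then have "?m\<^sup>2 \<le> (nn a * nn b)\<^sup>2"
    by (simp only: power_mult_distrib)
  then show ?thesis
    by (rule power2_le_imp_le) simp
qed

lemma nn_triangle: "nn (a + b) \<le> nn a + nn b"
proof (rule power2_le_imp_le)
  have "Re (B a b) \<le> nn a * nn b"
    using Cauchy_Schwarz[of a b] complex_Re_le_cmod[of "B a b"] by linarith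
  then show "(nn (a + b))\<^sup>2 \<le> (nn a + nn b)\<^sup>2"
    by (simp add: nn_add_square power2_sum)
qed simp

lemma nn_sum: "nn (sum f S) \<le> (\<Sum>x\<in>S. nn (f x))"
proof (induction S rule: infinite_finite_induct)
  case (insert x S)
  then show ?case using nn_triangle[of "f x" "sum f S"] by simp
qed auto

end

lemma scaleC_one [simp]: "1 *\<^sub>C x = x" for x :: "'h::chilbert_space"
  using scaleR_scaleC[of 1 x] by simp

lemma module_scaleC: "module ((*\<^sub>C) :: complex \<Rightarrow> 'h::chilbert_space \<Rightarrow> 'h)"
  by standard (simp_all add: scaleC_add_right scaleC_add_left scaleC_scaleC)

interpretation hilb: prehilbert "(*\<^sub>C) :: complex \<Rightarrow> 'h::chilbert_space \<Rightarrow> 'h" cinner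
  rewrites "prehilbert.nn (cinner :: 'h \<Rightarrow> 'h \<Rightarrow> complex) = norm"
proof -
  show *: "prehilbert ((*\<^sub>C) :: complex \<Rightarrow> 'h \<Rightarrow> 'h) cinner"
  proof (intro prehilbert.intro hermitian_form.intro prehilbert_axioms.intro)
    show "module ((*\<^sub>C) :: complex \<Rightarrow> 'h \<Rightarrow> 'h)" by (rule module_scaleC)
    fix x y z :: 'h and k
    show "cinner (x + y) z = cinner x z + cinner y z" by (rule cinner_add_left)
    show "cinner (k *\<^sub>C x) y = k * cinner x y" by (rule cinner_scaleC_left)
    show "cinner x y = cnj (cinner y x)" by (rule cinner_commute)
    show "0 \<le> Re (cinner x x)"
      by (simp add: inner_eq_Re_cinner[symmetric])
  qed
  show "prehilbert.nn (cinner :: 'h \<Rightarrow> 'h \<Rightarrow> complex) = norm"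
    by (simp add: fun_eq_iff prehilbert.nn_def[OF *] norm_eq_sqrt_inner inner_eq_Re_cinner)
qed

interpretation bopm: module "(*\<^sub>C) :: complex \<Rightarrow> 'h::chilbert_space bop \<Rightarrow> 'h bop"
  by (rule module_scaleC_bop)

section \<open>Bounded operators and their adjoints\<close>

lemma bapp_sum: "bapp (sum f S) x = (\<Sum>i\<in>S. bapp (f i) x)"
  by (induction S rule: infinite_finite_induct) (auto simp: bapp_simps)

lemma bapp_add: "bapp T (x + y) = bapp T x + bapp T y"
  and bapp_diff: "bapp T (x - y) = bapp T x - bapp T y"
  and bapp_zero [simp]: "bapp T 0 = 0"
proof -
  interpret bounded_linear "bapp T" by (rule bounded_linear_bapp)
  show "bapp T (x + y) = bapp T x + bapp T y" "bapp T (x - y) = bapp T x - bapp T y"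
    "bapp T 0 = 0"
    by (rule add diff zero)+
qed

lemma norm_bapp: "norm (bapp T x) \<le> norm T * norm x"
  by transfer (rule norm_blinfun)

lemma norm_bop_bound: "0 \<le> c \<Longrightarrow> (\<And>x. norm (bapp T x) \<le> c * norm x) \<Longrightarrow> norm T \<le> c"
  by transfer (rule norm_blinfun_bound)

lemma cinner_adj_left: "cinner x (bapp T y) = cinner (bapp (adj T) x) y"
  by (metis cinner_adj cinner_commute)

lemma adj_eqI: "(\<And>x y. cinner (bapp T x) y = cinner x (bapp S y)) \<Longrightarrow> adj T = S"
  by (intro bop_eqI cinner_extI) (metis cinner_adj)

lemma adj_adj [simp]: "adj (adj T) = T"
  by (rule adj_eqI) (simp add: cinner_adj_left)

lemma adj_one [simp]: "adj 1 = 1"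
  by (rule adj_eqI) (simp add: bapp_simps)

lemma adj_mult: "adj (S * T) = adj T * adj S"
  by (rule adj_eqI) (simp add: bapp_simps cinner_adj)

lemma adj_add: "adj (S + T) = adj S + adj T"
  by (rule adj_eqI) (simp add: bapp_simps cinner_adj cinner_add_left cinner_add_right)

lemma adj_scaleC: "adj (c *\<^sub>C T) = cnj c *\<^sub>C adj T"
  by (rule adj_eqI) (simp add: bapp_simps cinner_adj cinner_scaleC_left cinner_scaleC_right)

lemma adj_zero [simp]: "adj 0 = 0"
  by (rule adj_eqI) (simp add: bapp_simps)

lemma adj_sum: "adj (sum f S) = (\<Sum>x\<in>S. adj (f x))"
  by (induction S rule: infinite_finite_induct) (auto simp: adj_add)

lemma norm_adj_le: "norm (adj T) \<le> norm T"
proof (rule norm_bop_bound)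
  fix x
  have "(norm (bapp (adj T) x))\<^sup>2 = Re (cinner (bapp T (bapp (adj T) x)) x)"
    by (simp add: cinner_adj hilb.nn_square)
  also have "\<dots> \<le> norm (bapp T (bapp (adj T) x)) * norm x"
    using hilb.Cauchy_Schwarz complex_Re_le_cmod order_trans by blast
  also have "\<dots> \<le> norm T * norm (bapp (adj T) x) * norm x"
    by (intro mult_right_mono norm_bapp) simp
  finally have "norm (bapp (adj T) x) * norm (bapp (adj T) x) \<le> norm (bapp (adj T) x) * (norm T * norm x)"
    by (simp add: power2_eq_square mult_ac)
  then show "norm (bapp (adj T) x) \<le> norm T * norm x"
    by (cases "norm (bapp (adj T) x) = 0") (auto simp: mult_le_cancel_left)
qed simp

lemma continuous_on_adj: "continuous_on A adj"
proof -
  have "bounded_linear (adj :: 'a::chilbert_space bop \<Rightarrow> _)"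
  proof (rule bounded_linear_intro[where K = 1])
    show "adj (r *\<^sub>R T) = r *\<^sub>R adj T" for r and T :: "'a bop"
    proof -
      have sc: "r *\<^sub>R T = of_real r *\<^sub>C T" for T :: "'a bop"
        by (rule bop_eqI) (simp add: bapp_simps scaleR_scaleC)
      show ?thesis by (simp add: sc adj_scaleC)
    qed
  qed (simp_all add: adj_add norm_adj_le)
  then show ?thesis by (rule linear_continuous_on)
qed

lemma norm_scaleC_bop: "norm (c *\<^sub>C T) = cmod c * norm T" for T :: "'h::chilbert_space bop"
proof -
  have le: "norm (c *\<^sub>C T) \<le> cmod c * norm T" for c and T :: "'h bop"
  proof (rule norm_bop_bound)
    show "norm (bapp (c *\<^sub>C T) x) \<le> cmod c * norm T * norm x" for x
      using mult_left_mono[OF norm_bapp[of T x], of "cmod c"]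
      by (simp add: bapp_simps norm_scaleC mult.assoc)
  qed simp
  show ?thesis
  proof (cases "c = 0")
    case False
    have "cmod c * norm T \<le> norm (c *\<^sub>C T)"
      using mult_left_mono[OF le[of "inverse c" "c *\<^sub>C T"], of "cmod c"] False
      by (simp add: norm_inverse norm_divide field_simps)
    with le[of c T] show ?thesis by simp
  qed simp
qed

lemma bounded_linear_scaleC_bop: "bounded_linear (\<lambda>T :: 'h::chilbert_space bop. c *\<^sub>C T)"
proof (rule bounded_linear_intro[where K = "cmod c"])
  show "c *\<^sub>C r *\<^sub>R T = r *\<^sub>R c *\<^sub>C T" for r and T :: "'h bop"
    by (rule bop_eqI) (simp add: bapp_simps scaleC_scaleR)
qed (simp_all add: bopm.scale_right_distrib norm_scaleC_bop mult.commute)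

lemma scaleC_bop_mult: "(c *\<^sub>C S) * T = c *\<^sub>C (S * T)" "S * (c *\<^sub>C T) = c *\<^sub>C (S * T)"
  for S T :: "'h::chilbert_space bop"
  by (rule bop_eqI, simp add: bapp_simps bapp_scaleC)+

section \<open>The group algebra\<close>

lemma group_algebra_finite: "f \<in> group_algebra G \<Longrightarrow> finite {x. f x \<noteq> 0}"
  and group_algebra_carrier: "f \<in> group_algebra G \<Longrightarrow> f x \<noteq> 0 \<Longrightarrow> x \<in> carrier G"
  by (auto simp: group_algebra_def)

lemma group_algebra_zero: "(\<lambda>_. 0) \<in> group_algebra G"
  by (simp add: group_algebra_def)

lemma group_algebra_add:
  assumes "f \<in> group_algebra G" "g \<in> group_algebra G"
  shows "(\<lambda>x. f x + g x) \<in> group_algebra G"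
proof -
  have "{x. f x + g x \<noteq> 0} \<subseteq> {x. f x \<noteq> 0} \<union> {x. g x \<noteq> 0}" by auto
  then show ?thesis
    using assms by (auto simp: group_algebra_def intro: finite_subset)
qed

lemma group_algebra_scale: "f \<in> group_algebra G \<Longrightarrow> (\<lambda>x. c * f x) \<in> group_algebra G"
  by (auto simp: group_algebra_def intro: rev_finite_subset)

lemma group_algebra_sum:
  "finite S \<Longrightarrow> (\<And>i. i \<in> S \<Longrightarrow> f i \<in> group_algebra G) \<Longrightarrow> (\<lambda>x. \<Sum>i\<in>S. f i x) \<in> group_algebra G"
  by (induction S rule: finite_induct) (simp_all add: group_algebra_zero group_algebra_add)

definition point_mass :: "'g \<Rightarrow> complex \<Rightarrow> 'g \<Rightarrow> complex" where
  "point_mass x c = (\<lambda>y. if y = x then c else 0)"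

lemma group_algebra_point_mass: "x \<in> carrier G \<Longrightarrow> point_mass x c \<in> group_algebra G"
  by (auto simp: group_algebra_def point_mass_def)

lemma convolution_support:
  "{z. convolution G f g z \<noteq> 0} \<subseteq> (\<lambda>(x, y). x \<otimes>\<^bsub>G\<^esub> y) ` ({x. f x \<noteq> 0} \<times> {y. g y \<noteq> 0})"
proof
  fix z assume "z \<in> {z. convolution G f g z \<noteq> 0}"
  then have "convolution G f g z \<noteq> 0" by simp
  then obtain p where "p \<in> {(x, y). f x \<noteq> 0 \<and> g y \<noteq> 0 \<and> x \<otimes>\<^bsub>G\<^esub> y = z}"
    unfolding convolution_def by (meson sum.not_neutral_contains_not_neutral)
  then show "z \<in> (\<lambda>(x, y). x \<otimes>\<^bsub>G\<^esub> y) ` ({x. f x \<noteq> 0} \<times> {y. g y \<noteq> 0})" by auto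
qed

lemma (in monoid) group_algebra_convolution:
  assumes f: "f \<in> group_algebra G" and g: "g \<in> group_algebra G"
  shows "convolution G f g \<in> group_algebra G"
proof -
  let ?Z = "(\<lambda>(x, y). x \<otimes> y) ` ({x. f x \<noteq> 0} \<times> {y. g y \<noteq> 0})"
  have "finite ?Z"
    using group_algebra_finite[OF f] group_algebra_finite[OF g] by simp
  moreover have "?Z \<subseteq> carrier G"
    using group_algebra_carrier[OF f] group_algebra_carrier[OF g] by auto
  ultimately show ?thesis
    using convolution_support[of G f g] unfolding group_algebra_def
    by (auto intro: finite_subset)
qed

lemma (in group) involution_support:
  assumes "f \<in> group_algebra G"
  shows "{x. involution G f x \<noteq> 0} = m_inv G ` {x. f x \<noteq> 0}"
proof (intro equalityI subsetI)
  fix x assume "x \<in> {x. involution G f x \<noteq> 0}"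
  then have "x \<in> carrier G" "f (inv x) \<noteq> 0"
    by (auto simp: involution_def split: if_splits)
  then show "x \<in> m_inv G ` {x. f x \<noteq> 0}"
    by (intro image_eqI[where x = "inv x"]) auto
next
  fix x assume "x \<in> m_inv G ` {x. f x \<noteq> 0}"
  then show "x \<in> {x. involution G f x \<noteq> 0}"
    using group_algebra_carrier[OF assms] by (auto simp: involution_def)
qed

lemma (in group) group_algebra_involution:
  assumes "f \<in> group_algebra G"
  shows "involution G f \<in> group_algebra G"
  using assms group_algebra_carrier[OF assms]
  by (auto simp: group_algebra_def involution_support[OF assms, simplified])

lemma (in group) involution_involution:
  assumes "f \<in> group_algebra G"
  shows "involution G (involution G f) = f"
  using group_algebra_carrier[OF assms] by (auto simp: involution_def fun_eq_iff)

text \<open>Linear extension of \<open>T\<close> from the group to the group algebra. The scalar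
  multiplication is a parameter so that the same rules serve operators (\<open>ev\<close>) and
  vectors of an abstract module (\<open>act\<close>).\<close>

definition fsum :: "(complex \<Rightarrow> 'b \<Rightarrow> 'b::ab_group_add) \<Rightarrow> ('g \<Rightarrow> 'b) \<Rightarrow> ('g \<Rightarrow> complex) \<Rightarrow> 'b" where
  "fsum s T f = (\<Sum>x | f x \<noteq> 0. s (f x) (T x))"

lemma fsum_superset:
  assumes "module s" "finite S" "\<And>x. f x \<noteq> 0 \<Longrightarrow> x \<in> S"
  shows "fsum s T f = (\<Sum>x\<in>S. s (f x) (T x))"
proof -
  interpret module s by fact
  show ?thesis
    unfolding fsum_def using assms(2,3) by (intro sum.mono_neutral_left) auto
qed

lemma fsum_add:
  assumes m: "module s" and f: "f \<in> group_algebra G" and g: "g \<in> group_algebra G"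
  shows "fsum s T (\<lambda>x. f x + g x) = fsum s T f + fsum s T g"
proof -
  interpret module s by fact
  let ?S = "{x. f x \<noteq> 0} \<union> {x. g x \<noteq> 0}"
  have S: "finite ?S" using f g by (simp add: group_algebra_finite)
  have "fsum s T f = (\<Sum>x\<in>?S. s (f x) (T x))" "fsum s T g = (\<Sum>x\<in>?S. s (g x) (T x))"
    "fsum s T (\<lambda>x. f x + g x) = (\<Sum>x\<in>?S. s (f x + g x) (T x))"
    by (intro fsum_superset[OF m S]; auto)+
  then show ?thesis
    by (simp add: scale_left_distrib sum.distrib)
qed

lemma fsum_scale:
  assumes m: "module s" and f: "f \<in> group_algebra G"
  shows "fsum s T (\<lambda>x. c * f x) = s c (fsum s T f)"
proof -
  interpret module s by fact
  have "fsum s T (\<lambda>x. c * f x) = (\<Sum>x | f x \<noteq> 0. s (c * f x) (T x))"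
    by (intro fsum_superset[OF m]) (use f in \<open>auto simp: group_algebra_finite\<close>)
  then show ?thesis
    by (simp add: fsum_def scale_sum_right)
qed

lemma fsum_point_mass:
  assumes m: "module s"
  shows "fsum s T (point_mass x c) = s c (T x)"
proof -
  have "fsum s T (point_mass x c) = (\<Sum>y\<in>{x}. s (point_mass x c y) (T y))"
    by (rule fsum_superset[OF m]) (auto simp: point_mass_def split: if_splits)
  then show ?thesis by (simp add: point_mass_def)
qed

lemma fsum_zero [simp]: "fsum s T (\<lambda>_. 0) = 0"
  by (simp add: fsum_def)

lemma fsum_sum:
  assumes m: "module s" and "finite S" "\<And>i. i \<in> S \<Longrightarrow> f i \<in> group_algebra G"
  shows "fsum s T (\<lambda>x. \<Sum>i\<in>S. f i x) = (\<Sum>i\<in>S. fsum s T (f i))"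
  using assms(2,3)
proof (induction S rule: finite_induct)
  case (insert i S)
  then have "f i \<in> group_algebra G" "(\<lambda>x. \<Sum>i\<in>S. f i x) \<in> group_algebra G"
    by (auto intro: group_algebra_sum)
  from fsum_add[OF m this] insert show ?case by simp
qed simp

lemma fsum_convolution:
  assumes m: "module s" and f: "f \<in> group_algebra G" and g: "g \<in> group_algebra G"
  shows "fsum s T (convolution G f g) =
    (\<Sum>x | f x \<noteq> 0. \<Sum>y | g y \<noteq> 0. s (f x * g y) (T (x \<otimes>\<^bsub>G\<^esub> y)))"
proof -
  interpret module s by fact
  let ?P = "{x. f x \<noteq> 0} \<times> {y. g y \<noteq> 0}"
  let ?m = "\<lambda>(x, y). x \<otimes>\<^bsub>G\<^esub> y"
  have P: "finite ?P" using f g by (simp add: group_algebra_finite)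
  have "fsum s T (convolution G f g) = (\<Sum>z\<in>?m ` ?P. s (convolution G f g z) (T z))"
    by (rule fsum_superset[OF m]) (use P convolution_support[of G f g] in auto)
  also have "\<dots> = (\<Sum>z\<in>?m ` ?P. \<Sum>(x, y)\<in>{p\<in>?P. ?m p = z}. s (f x * g y) (T (x \<otimes>\<^bsub>G\<^esub> y)))"
  proof (rule sum.cong[OF refl])
    fix z
    have eq: "{(x, y). f x \<noteq> 0 \<and> g y \<noteq> 0 \<and> x \<otimes>\<^bsub>G\<^esub> y = z} = {p\<in>?P. ?m p = z}" by auto
    show "s (convolution G f g z) (T z) =
        (\<Sum>(x, y)\<in>{p\<in>?P. ?m p = z}. s (f x * g y) (T (x \<otimes>\<^bsub>G\<^esub> y)))"
      unfolding convolution_def eq scale_sum_left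
      by (rule sum.cong[OF refl]) auto
  qed
  also have "\<dots> = (\<Sum>(x, y)\<in>?P. s (f x * g y) (T (x \<otimes>\<^bsub>G\<^esub> y)))"
    by (rule sum.image_gen[OF P, symmetric])
  also have "\<dots> = (\<Sum>x | f x \<noteq> 0. \<Sum>y | g y \<noteq> 0. s (f x * g y) (T (x \<otimes>\<^bsub>G\<^esub> y)))"
    by (rule sum.cartesian_product[symmetric])
  finally show ?thesis .
qed

lemma (in group) fsum_involution:
  assumes m: "module s" and f: "f \<in> group_algebra G"
  shows "fsum s T (involution G f) = (\<Sum>x | f x \<noteq> 0. s (cnj (f x)) (T (inv x)))"
proof -
  have sub: "{x. f x \<noteq> 0} \<subseteq> carrier G" using group_algebra_carrier[OF f] by auto
  have "inj_on (m_inv G) {x. f x \<noteq> 0}"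
    using sub unfolding inj_on_def by (metis inv_inv subsetD)
  then show ?thesis
    unfolding fsum_def involution_support[OF f]
    using sub by (subst sum.reindex) (auto intro!: sum.cong simp: involution_def)
qed

abbreviation ev :: "('g \<Rightarrow> 'h::chilbert_space bop) \<Rightarrow> ('g \<Rightarrow> complex) \<Rightarrow> 'h bop" where
  "ev \<equiv> fsum (*\<^sub>C)"

lemmas ev_add = fsum_add[OF module_scaleC_bop]
  and ev_scale = fsum_scale[OF module_scaleC_bop]
  and ev_sum = fsum_sum[OF module_scaleC_bop]
  and ev_point_mass = fsum_point_mass[OF module_scaleC_bop]

text \<open>\<open>is_full_group_rep\<close> without the norm condition, so that it also covers the
  representation on \<open>ell2\<close> and the unitaries found inside the envelope.\<close>

definition unitary_rep :: "('g, 'm) monoid_scheme \<Rightarrow> ('g \<Rightarrow> 'h::chilbert_space bop) \<Rightarrow> bool" where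
  "unitary_rep G u \<longleftrightarrow> u \<one>\<^bsub>G\<^esub> = 1 \<and>
     (\<forall>x\<in>carrier G. \<forall>y\<in>carrier G. u (x \<otimes>\<^bsub>G\<^esub> y) = u x * u y) \<and>
     (\<forall>x\<in>carrier G. u (inv\<^bsub>G\<^esub> x) = adj (u x))"

lemma unitary_rep_one: "unitary_rep G u \<Longrightarrow> u \<one>\<^bsub>G\<^esub> = 1"
  and unitary_rep_mult: "unitary_rep G u \<Longrightarrow> x \<in> carrier G \<Longrightarrow> y \<in> carrier G \<Longrightarrow>
    u (x \<otimes>\<^bsub>G\<^esub> y) = u x * u y"
  and unitary_rep_inv: "unitary_rep G u \<Longrightarrow> x \<in> carrier G \<Longrightarrow> u (inv\<^bsub>G\<^esub> x) = adj (u x)"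
  by (auto simp: unitary_rep_def)

lemma ev_convolution:
  assumes u: "unitary_rep G u" and f: "f \<in> group_algebra G" and g: "g \<in> group_algebra G"
  shows "ev u (convolution G f g) = ev u f * ev u g"
proof -
  have "ev u (convolution G f g) =
      (\<Sum>x | f x \<noteq> 0. \<Sum>y | g y \<noteq> 0. (f x *\<^sub>C u x) * (g y *\<^sub>C u y))"
    unfolding fsum_convolution[OF module_scaleC_bop f g]
    using group_algebra_carrier[OF f] group_algebra_carrier[OF g]
    by (intro sum.cong refl) (simp add: unitary_rep_mult[OF u] scaleC_bop_mult mult.commute)
  then show ?thesis
    by (simp add: fsum_def sum_product)
qed

lemma (in group) ev_involution:
  assumes u: "unitary_rep G u" and f: "f \<in> group_algebra G"
  shows "ev u (involution G f) = adj (ev u f)"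
  unfolding fsum_involution[OF module_scaleC_bop f]
  using group_algebra_carrier[OF f]
  by (auto simp: fsum_def adj_sum adj_scaleC unitary_rep_inv[OF u] intro!: sum.cong)

lemma (in group) norm_unitary_rep:
  assumes u: "unitary_rep G u" and x: "x \<in> carrier G"
  shows "adj (u x) * u x = 1" and "u x * adj (u x) = 1"
    and "cinner (bapp (u x) a) (bapp (u x) b) = cinner a b" and "norm (bapp (u x) a) = norm a"
proof -
  show *: "adj (u x) * u x = 1" and "u x * adj (u x) = 1"
    using x unitary_rep_mult[OF u, of "inv x" x] unitary_rep_mult[OF u, of x "inv x"]
    by (simp_all add: unitary_rep_inv[OF u] unitary_rep_one[OF u])
  have **: "cinner (bapp (u x) a) (bapp (u x) b) = cinner a b" for a b
    using arg_cong[OF *, of "\<lambda>T. bapp T b"] by (simp add: cinner_adj bapp_simps)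
  then show "cinner (bapp (u x) a) (bapp (u x) b) = cinner a b" .
  have "(norm (bapp (u x) a))\<^sup>2 = (norm a)\<^sup>2"
    by (simp add: hilb.nn_square **)
  then show "norm (bapp (u x) a) = norm a"
    by (simp add: power2_eq_iff_nonneg)
qed

section \<open>Quadratic forms of operator matrices\<close>

definition form :: "nat \<Rightarrow> (nat \<Rightarrow> nat \<Rightarrow> 'h::chilbert_space bop) \<Rightarrow> (nat \<Rightarrow> 'h) \<Rightarrow> complex" where
  "form n X \<xi> = (\<Sum>i<n. \<Sum>j<n. cinner (bapp (X i j) (\<xi> j)) (\<xi> i))"

definition rpos :: "nat \<Rightarrow> (nat \<Rightarrow> nat \<Rightarrow> 'h::chilbert_space bop) \<Rightarrow> bool" where
  "rpos n X \<longleftrightarrow> (\<forall>\<xi>. 0 \<le> Re (form n X \<xi>))"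

lemma form_scaleC: "form n (\<lambda>i j. c *\<^sub>C X i j) \<xi> = c * form n X \<xi>"
  by (simp add: form_def bapp_simps cinner_scaleC_left sum_distrib_left)

lemma form_add: "form n (\<lambda>i j. X i j + Y i j) \<xi> = form n X \<xi> + form n Y \<xi>"
  by (simp add: form_def bapp_simps cinner_add_left sum.distrib)

lemma form_cong: "(\<And>i j. i < n \<Longrightarrow> j < n \<Longrightarrow> X i j = Y i j) \<Longrightarrow> form n X = form n Y"
  by (simp add: form_def fun_eq_iff)

lemma form_diag: "form n (\<lambda>i j. if i = j then c *\<^sub>C 1 else 0) \<xi> = c * (\<Sum>i<n. of_real ((norm (\<xi> i))\<^sup>2))"
proof -
  have "cinner (bapp (if i = j then c *\<^sub>C 1 else 0) (\<xi> j)) (\<xi> i) =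
      (if i = j then c * of_real ((norm (\<xi> i))\<^sup>2) else 0)" for i j
    by (simp add: bapp_simps cinner_scaleC_left hilb.B_self)
  then show ?thesis
    by (simp only: form_def) (simp add: sum_distrib_left)
qed

lemma norm_form_le: "cmod (form n X \<xi>) \<le> (\<Sum>i<n. \<Sum>j<n. norm (X i j)) * (\<Sum>i<n. (norm (\<xi> i))\<^sup>2)"
proof -
  let ?S = "\<Sum>i<n. (norm (\<xi> i))\<^sup>2"
  have le: "(norm (\<xi> i))\<^sup>2 \<le> ?S" if "i < n" for i
    using that by (intro member_le_sum) auto
  have "cmod (cinner (bapp (X i j) (\<xi> j)) (\<xi> i)) \<le> norm (X i j) * ?S" if "i < n" "j < n" for i j
  proof -
    have "cmod (cinner (bapp (X i j) (\<xi> j)) (\<xi> i)) \<le> norm (bapp (X i j) (\<xi> j)) * norm (\<xi> i)"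
      by (rule hilb.Cauchy_Schwarz)
    also have "\<dots> \<le> norm (X i j) * norm (\<xi> j) * norm (\<xi> i)"
      by (intro mult_right_mono norm_bapp) simp
    also have "norm (\<xi> j) * norm (\<xi> i) \<le> ?S"
    proof -
      have "2 * (norm (\<xi> j) * norm (\<xi> i)) \<le> (norm (\<xi> j))\<^sup>2 + (norm (\<xi> i))\<^sup>2"
        using sum_squares_bound[of "norm (\<xi> j)" "norm (\<xi> i)"] by simp
      with le[OF that(1)] le[OF that(2)] show ?thesis by linarith
    qed
    then have "norm (X i j) * norm (\<xi> j) * norm (\<xi> i) \<le> norm (X i j) * ?S"
      by (simp add: mult.assoc mult_left_mono)
    finally show ?thesis .
  qed
  then have "cmod (form n X \<xi>) \<le> (\<Sum>i<n. \<Sum>j<n. norm (X i j) * ?S)"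
    unfolding form_def by (intro order_trans[OF norm_sum] sum_mono) auto
  then show ?thesis
    by (simp add: sum_distrib_right)
qed

lemma mat_pos_alt: "mat_pos n X \<longleftrightarrow> (\<forall>\<xi>. Im (form n X \<xi>) = 0 \<and> 0 \<le> Re (form n X \<xi>))"
  by (simp add: mat_pos_def form_def complex_is_Real_iff)

text \<open>A complex number is real iff its multiples by \<open>\<i>\<close> and
  \<open>-\<i>\<close> both have nonnegative real part, so positivity amounts to three real-part
  conditions on scalar multiples of the matrix.\<close>

lemma mat_pos_iff_rpos:
  "mat_pos n X \<longleftrightarrow> rpos n X \<and> rpos n (\<lambda>i j. \<i> *\<^sub>C X i j) \<and> rpos n (\<lambda>i j. - \<i> *\<^sub>C X i j)"
  unfolding mat_pos_alt rpos_def form_scaleC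
  by (simp add: le_less) (metis less_le_not_le neg_0_less_iff_less not_less_iff_gr_or_eq)

lemma mat_pos_cong: "(\<And>i j. i < n \<Longrightarrow> j < n \<Longrightarrow> X i j = Y i j) \<Longrightarrow> mat_pos n X = mat_pos n Y"
  using form_cong[of n X Y] by (simp add: mat_pos_alt)

text \<open>Working with real parts only makes the condition stable under small perturbations and does
  not require the matrix to be Hermitian.\<close>

definition dominates ::
  "('g, 'm) monoid_scheme \<Rightarrow> ('g \<Rightarrow> 'h::chilbert_space bop) \<Rightarrow> ('g \<Rightarrow> 'k::chilbert_space bop) \<Rightarrow> bool"
  where "dominates G \<alpha> \<beta> \<longleftrightarrow>
    (\<forall>n F. (\<forall>i j. F i j \<in> group_algebra G) \<longrightarrow>
       rpos n (\<lambda>i j. ev \<alpha> (F i j)) \<longrightarrow> rpos n (\<lambda>i j. ev \<beta> (F i j)))"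

lemma dominatesD: "dominates G \<alpha> \<beta> \<Longrightarrow> (\<And>i j. F i j \<in> group_algebra G) \<Longrightarrow>
    rpos n (\<lambda>i j. ev \<alpha> (F i j)) \<Longrightarrow> rpos n (\<lambda>i j. ev \<beta> (F i j))"
  by (simp add: dominates_def)

lemma dominates_trans: "dominates G \<alpha> \<beta> \<Longrightarrow> dominates G \<beta> \<gamma> \<Longrightarrow> dominates G \<alpha> \<gamma>"
  by (simp add: dominates_def)

lemma dominates_mat_pos:
  assumes d: "dominates G \<alpha> \<beta>" and F: "\<And>i j. F i j \<in> group_algebra G"
    and pos: "mat_pos n (\<lambda>i j. ev \<alpha> (F i j))"
  shows "mat_pos n (\<lambda>i j. ev \<beta> (F i j))"
proof -
  have "rpos n (\<lambda>i j. c *\<^sub>C ev \<beta> (F i j))" if "rpos n (\<lambda>i j. c *\<^sub>C ev \<alpha> (F i j))" for c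
    using dominatesD[OF d, of "\<lambda>i j x. c * F i j x" n] that
    by (simp add: F group_algebra_scale ev_scale[OF F])
  from this[of 1] this[of \<i>] this[of "-\<i>"] pos show ?thesis
    by (simp add: mat_pos_iff_rpos)
qed

text \<open>The norm is encoded in the order of 2 x 2 matrices: \<open>T\<close> has norm at most
  \<open>c\<close> iff the matrix with diagonal \<open>c\<close> and off-diagonal entries
  \<open>T\<close> and \<open>adj T\<close> is positive. Domination transports this condition from
  \<open>\<alpha>\<close> to \<open>\<beta>\<close>.\<close>

lemma dominates_norm:
  assumes d: "dominates G \<alpha> \<beta>" and e: "e \<in> carrier G" "\<alpha> e = 1" "\<beta> e = 1"
    and f: "f \<in> group_algebra G"
  shows "norm (ev \<beta> f) \<le> norm (ev \<alpha> f)"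
proof (rule norm_bop_bound)
  let ?c = "norm (ev \<alpha> f)"
  \<comment> \<open>Only real parts matter, so the two off-diagonal entries may be merged into one;
    this is the origin of the factor 2.\<close>
  define F :: "nat \<Rightarrow> nat \<Rightarrow> 'a \<Rightarrow> complex" where
    "F i j = (if i = j then point_mass e ?c else if i = 0 then (\<lambda>x. 2 * f x) else (\<lambda>_. 0))" for i j
  have F: "F i j \<in> group_algebra G" for i j
    using e f by (simp add: F_def group_algebra_point_mass group_algebra_scale group_algebra_zero)
  have form: "form 2 (\<lambda>i j. ev \<gamma> (F i j)) \<xi> =
      of_real (?c * ((norm (\<xi> 0))\<^sup>2 + (norm (\<xi> 1))\<^sup>2)) + 2 * cinner (bapp (ev \<gamma> f) (\<xi> 1)) (\<xi> 0)"
    if "\<gamma> e = 1" for \<gamma> :: "'a \<Rightarrow> 'x::chilbert_space bop" and \<xi>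
  proof -
    have "{..<2::nat} = {0, 1}" by auto
    then show ?thesis
      using that by (simp add: form_def F_def ev_point_mass ev_scale[OF f] bapp_simps
          cinner_scaleC_left hilb.B_self) (simp add: algebra_simps)
  qed
  have "0 \<le> Re (form 2 (\<lambda>i j. ev \<alpha> (F i j)) \<xi>)" for \<xi>
  proof -
    have "\<bar>Re (cinner (bapp (ev \<alpha> f) (\<xi> 1)) (\<xi> 0))\<bar> \<le> norm (bapp (ev \<alpha> f) (\<xi> 1)) * norm (\<xi> 0)"
      using hilb.Cauchy_Schwarz abs_Re_le_cmod order_trans by blast
    also have "\<dots> \<le> ?c * norm (\<xi> 1) * norm (\<xi> 0)"
      by (intro mult_right_mono norm_bapp) simp
    finally have 1: "\<bar>Re (cinner (bapp (ev \<alpha> f) (\<xi> 1)) (\<xi> 0))\<bar> \<le> ?c * (norm (\<xi> 1) * norm (\<xi> 0))"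
      by (simp add: mult.assoc)
    have "2 * (norm (\<xi> 1) * norm (\<xi> 0)) \<le> (norm (\<xi> 0))\<^sup>2 + (norm (\<xi> 1))\<^sup>2"
      using sum_squares_bound[of "norm (\<xi> 1)" "norm (\<xi> 0)"] by simp
    then have "?c * (2 * (norm (\<xi> 1) * norm (\<xi> 0))) \<le> ?c * ((norm (\<xi> 0))\<^sup>2 + (norm (\<xi> 1))\<^sup>2)"
      by (rule mult_left_mono) simp
    with 1 have "0 \<le> ?c * ((norm (\<xi> 0))\<^sup>2 + (norm (\<xi> 1))\<^sup>2) + 2 * Re (cinner (bapp (ev \<alpha> f) (\<xi> 1)) (\<xi> 0))"
      by linarith
    then show ?thesis
      unfolding form[of \<alpha>, OF e(2)] by simp
  qed
  then have "rpos 2 (\<lambda>i j. ev \<beta> (F i j))"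
    by (intro dominatesD[OF d F]) (simp add: rpos_def)
  then have pos: "0 \<le> ?c * ((norm y)\<^sup>2 + (norm x)\<^sup>2) + 2 * Re (cinner (bapp (ev \<beta> f) x) y)" for x y
    unfolding rpos_def form[of \<beta>, OF e(3)]
    by (auto dest: spec[where x = "\<lambda>i. if i = 0 then y else x"])
  show "norm (bapp (ev \<beta> f) x) \<le> ?c * norm x" for x
  proof (cases "bapp (ev \<beta> f) x = 0 \<or> x = 0")
    case False
    define z where "z = bapp (ev \<beta> f) x"
    define s where "s = norm x / norm z"
    have z: "norm z > 0" "norm x > 0" using False by (auto simp: z_def)
    \<comment> \<open>The test vector is \<open>z\<close> turned around and rescaled to the length
      of \<open>x\<close>, which makes the cross term as negative as possible.\<close>
    have "cinner z (- of_real s *\<^sub>C z) = - of_real (s * (norm z)\<^sup>2)"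
      by (simp add: cinner_scaleC_right hilb.B_minus_right hilb.B_self)
    with pos[of "- of_real s *\<^sub>C z" x] have "2 * (s * (norm z)\<^sup>2) \<le> ?c * ((s * norm z)\<^sup>2 + (norm x)\<^sup>2)"
      by (simp add: z_def[symmetric] norm_scaleC power_mult_distrib)
    moreover have sz: "s * norm z = norm x" "s * (norm z)\<^sup>2 = norm x * norm z"
      using z by (simp_all add: s_def power2_eq_square)
    ultimately have "2 * (norm x * norm z) \<le> ?c * ((norm x)\<^sup>2 + (norm x)\<^sup>2)"
      by (simp only: sz)
    then have "norm x * norm z \<le> norm x * (?c * norm x)"
      by (simp add: power2_eq_square algebra_simps)
    then show ?thesis
      using z by (simp add: z_def[symmetric])
  qed auto
qed simp

lemma tendsto_form:
  assumes "\<And>i j. i < n \<Longrightarrow> j < n \<Longrightarrow> (\<lambda>k. X k i j) \<longlonglongrightarrow> Y i j"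
  shows "(\<lambda>k. form n (X k) \<xi>) \<longlonglongrightarrow> form n Y \<xi>"
proof -
  have "(\<lambda>k. form n (X k) \<xi> - form n Y \<xi>) \<longlonglongrightarrow> 0"
  proof (rule tendsto_norm_zero_cancel, rule tendsto_sandwich[OF _ _ tendsto_const])
    let ?S = "\<Sum>i<n. (norm (\<xi> i))\<^sup>2"
    have "form n (X k) \<xi> - form n Y \<xi> = form n (\<lambda>i j. X k i j - Y i j) \<xi>" for k
      using form_add[of n "\<lambda>i j. X k i j - Y i j" Y \<xi>] by simp
    then show "\<forall>\<^sub>F k in sequentially.
        norm (form n (X k) \<xi> - form n Y \<xi>) \<le> (\<Sum>i<n. \<Sum>j<n. norm (X k i j - Y i j)) * ?S"
      using norm_form_le by (intro always_eventually allI) simp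
    have "(\<lambda>k. (\<Sum>i<n. \<Sum>j<n. norm (X k i j - Y i j)) * ?S) \<longlonglongrightarrow> (\<Sum>i<n. \<Sum>j<n. norm (Y i j - Y i j)) * ?S"
      by (intro tendsto_intros assms) auto
    then show "(\<lambda>k. (\<Sum>i<n. \<Sum>j<n. norm (X k i j - Y i j)) * ?S) \<longlonglongrightarrow> 0" by simp
  qed simp
  then show ?thesis
    by (rule LIM_zero_cancel)
qed

lemma closure_subspaceI:
  assumes "\<And>x y. x \<in> A \<Longrightarrow> y \<in> A \<Longrightarrow> x + y \<in> A" "\<And>c x. x \<in> A \<Longrightarrow> c *\<^sub>C x \<in> A"
  shows "x \<in> closure A \<Longrightarrow> y \<in> closure A \<Longrightarrow> x + y \<in> closure A"
    and "x \<in> closure A \<Longrightarrow> c *\<^sub>C x \<in> closure (A :: 'h::chilbert_space bop set)"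
proof -
  assume "x \<in> closure A"
  then obtain f where f: "\<And>n. f n \<in> A" "f \<longlonglongrightarrow> x"
    unfolding closure_sequential by blast
  have "(\<lambda>n. c *\<^sub>C f n) \<longlonglongrightarrow> c *\<^sub>C x"
    by (intro bounded_linear.tendsto[OF bounded_linear_scaleC_bop] f)
  then show "c *\<^sub>C x \<in> closure A"
    unfolding closure_sequential by (intro exI[of _ "\<lambda>n. c *\<^sub>C f n"] conjI allI assms f)
  assume "y \<in> closure A"
  then obtain g where g: "\<And>n. g n \<in> A" "g \<longlonglongrightarrow> y"
    unfolding closure_sequential by blast
  have "(\<lambda>n. f n + g n) \<longlonglongrightarrow> x + y" by (intro tendsto_intros f g)
  then show "x + y \<in> closure A"
    unfolding closure_sequential by (intro exI[of _ "\<lambda>n. f n + g n"] conjI allI assms f g)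
qed

text \<open>By \<open>dominates_norm\<close> the assignment
  \<open>ev \<alpha> f \<mapsto> ev \<beta> f\<close> is well defined and contractive, hence extends
  to the closure. Positivity survives the limit because approximants of a positive matrix become
  positive after adding a small multiple of the identity.\<close>

lemma dominates_imp_ucp:
  fixes \<alpha> :: "'g \<Rightarrow> 'k::chilbert_space bop" and \<beta> :: "'g \<Rightarrow> 'h::chilbert_space bop"
  assumes d: "dominates G \<alpha> \<beta>" and e: "e \<in> carrier G" "\<alpha> e = 1" "\<beta> e = 1"
  obtains \<Phi> where "ucp_on (closure (ev \<alpha> ` group_algebra G)) \<Phi>"
    and "\<And>f. f \<in> group_algebra G \<Longrightarrow> \<Phi> (ev \<alpha> f) = ev \<beta> f"
    and "\<And>x. x \<in> closure (ev \<alpha> ` group_algebra G) \<Longrightarrow> \<Phi> x \<in> closure (ev \<beta> ` group_algebra G)"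
proof -
  let ?C = "group_algebra G"
  define g where "g x = ev \<beta> (SOME f. f \<in> ?C \<and> ev \<alpha> f = x)" for x
  have diff: "norm (ev \<beta> f - ev \<beta> f') \<le> norm (ev \<alpha> f - ev \<alpha> f')" if f: "f \<in> ?C" "f' \<in> ?C" for f f'
  proof -
    have h: "(\<lambda>x. f x + (-1) * f' x) \<in> ?C"
      by (intro group_algebra_add group_algebra_scale f)
    have *: "ev \<gamma> (\<lambda>x. f x + (-1) * f' x) = ev \<gamma> f - ev \<gamma> f'" for \<gamma> :: "'g \<Rightarrow> 'y::chilbert_space bop"
      unfolding ev_add[OF f(1) group_algebra_scale[OF f(2)]] ev_scale[OF f(2)]
      by (simp add: bopm.scale_minus_left)
    then show ?thesis
      using dominates_norm[OF d e h] by (simp only: *)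
  qed
  have g: "g (ev \<alpha> f) = ev \<beta> f" if f: "f \<in> ?C" for f
  proof -
    let ?f = "SOME f'. f' \<in> ?C \<and> ev \<alpha> f' = ev \<alpha> f"
    have "?f \<in> ?C \<and> ev \<alpha> ?f = ev \<alpha> f" by (rule someI[of _ f]) (use f in simp)
    with diff[of ?f f] f show ?thesis by (simp add: g_def)
  qed
  have "uniformly_continuous_on (ev \<alpha> ` ?C) g"
    unfolding uniformly_continuous_on_def dist_norm using diff
    by (force simp: g)
  then obtain \<Phi> where \<Phi>: "uniformly_continuous_on (closure (ev \<alpha> ` ?C)) \<Phi>"
    "\<And>x. x \<in> ev \<alpha> ` ?C \<Longrightarrow> g x = \<Phi> x"
    by (rule uniformly_continuous_on_extension_on_closure) blast
  have ev: "\<Phi> (ev \<alpha> f) = ev \<beta> f" if "f \<in> ?C" for f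
    using \<Phi>(2)[of "ev \<alpha> f"] g[OF that] that by simp
  have lim: "\<exists>f. (\<forall>k. f k \<in> ?C) \<and> (\<lambda>k. ev \<alpha> (f k)) \<longlonglongrightarrow> x \<and> (\<lambda>k. ev \<beta> (f k)) \<longlonglongrightarrow> \<Phi> x"
    if x: "x \<in> closure (ev \<alpha> ` ?C)" for x
  proof -
    obtain y where y: "\<And>k. y k \<in> ev \<alpha> ` ?C" "y \<longlonglongrightarrow> x"
      using x unfolding closure_sequential by blast
    then have "\<forall>k. \<exists>f. f \<in> ?C \<and> y k = ev \<alpha> f" by blast
    then obtain f where f: "\<And>k. f k \<in> ?C" "\<And>k. y k = ev \<alpha> (f k)" by metis
    have "(\<lambda>k. \<Phi> (y k)) \<longlonglongrightarrow> \<Phi> x"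
      using continuous_on_tendsto_compose[OF uniformly_continuous_imp_continuous[OF \<Phi>(1)] y(2) x] y(1)
      by (auto simp: closure_subset[THEN subsetD])
    then show ?thesis
      using y(2) f(1) ext[of y, OF f(2)] by (intro exI[of _ f]) (simp add: ev)
  qed
  have lin: "\<Phi> (x + y) = \<Phi> x + \<Phi> y" "\<Phi> (c *\<^sub>C x) = c *\<^sub>C \<Phi> x"
    if x: "x \<in> closure (ev \<alpha> ` ?C)" and y: "y \<in> closure (ev \<alpha> ` ?C)" for x y c
  proof -
    obtain f where f: "\<And>k. f k \<in> ?C" "(\<lambda>k. ev \<alpha> (f k)) \<longlonglongrightarrow> x" "(\<lambda>k. ev \<beta> (f k)) \<longlonglongrightarrow> \<Phi> x"
      using lim[OF x] by blast
    obtain f' where f': "\<And>k. f' k \<in> ?C" "(\<lambda>k. ev \<alpha> (f' k)) \<longlonglongrightarrow> y" "(\<lambda>k. ev \<beta> (f' k)) \<longlonglongrightarrow> \<Phi> y"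
      using lim[OF y] by blast
    have cont: "(\<lambda>k. \<Phi> (z k)) \<longlonglongrightarrow> \<Phi> z0"
      if "\<And>k. z k \<in> ev \<alpha> ` ?C" "z \<longlonglongrightarrow> z0" for z z0
    proof -
      have "z0 \<in> closure (ev \<alpha> ` ?C)" unfolding closure_sequential using that by blast
      then show ?thesis
        using continuous_on_tendsto_compose[OF uniformly_continuous_imp_continuous[OF \<Phi>(1)] that(2)] that(1)
        by (auto simp: closure_subset[THEN subsetD])
    qed
    have "(\<lambda>k. \<Phi> (ev \<alpha> (\<lambda>x. f k x + f' k x))) \<longlonglongrightarrow> \<Phi> (x + y)"
    proof (rule cont)
      show "ev \<alpha> (\<lambda>x. f k x + f' k x) \<in> ev \<alpha> ` ?C" for k by (intro imageI group_algebra_add f f')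
      show "(\<lambda>k. ev \<alpha> (\<lambda>x. f k x + f' k x)) \<longlonglongrightarrow> x + y"
        unfolding ev_add[OF f(1) f'(1)] by (intro tendsto_add f f')
    qed
    moreover have "(\<lambda>k. \<Phi> (ev \<alpha> (\<lambda>x. f k x + f' k x))) \<longlonglongrightarrow> \<Phi> x + \<Phi> y"
      unfolding ev[OF group_algebra_add[OF f(1) f'(1)]] unfolding ev_add[OF f(1) f'(1)]
      by (rule tendsto_add[OF f(3) f'(3)])
    ultimately show "\<Phi> (x + y) = \<Phi> x + \<Phi> y"
      by (rule LIMSEQ_unique)
    have "(\<lambda>k. \<Phi> (ev \<alpha> (\<lambda>x. c * f k x))) \<longlonglongrightarrow> \<Phi> (c *\<^sub>C x)"
    proof (rule cont)
      show "ev \<alpha> (\<lambda>x. c * f k x) \<in> ev \<alpha> ` ?C" for k by (intro imageI group_algebra_scale f)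
      show "(\<lambda>k. ev \<alpha> (\<lambda>x. c * f k x)) \<longlonglongrightarrow> c *\<^sub>C x"
        unfolding ev_scale[OF f(1)] by (intro bounded_linear.tendsto[OF bounded_linear_scaleC_bop] f)
    qed
    moreover have "(\<lambda>k. \<Phi> (ev \<alpha> (\<lambda>x. c * f k x))) \<longlonglongrightarrow> c *\<^sub>C \<Phi> x"
      unfolding ev[OF group_algebra_scale[OF f(1)]] unfolding ev_scale[OF f(1)]
      by (rule bounded_linear.tendsto[OF bounded_linear_scaleC_bop f(3)])
    ultimately show "\<Phi> (c *\<^sub>C x) = c *\<^sub>C \<Phi> x"
      by (rule LIMSEQ_unique)
  qed
  have pos: "rpos n (\<lambda>i j. \<Phi> (X i j))"
    if X: "\<And>i j. i < n \<Longrightarrow> j < n \<Longrightarrow> X i j \<in> closure (ev \<alpha> ` ?C)" and Xpos: "rpos n X" for n X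
    unfolding rpos_def
  proof
    fix \<eta> :: "nat \<Rightarrow> 'h"
    \<comment> \<open>Approximating sequences are chosen for all index pairs at once, so entries
      outside the \<open>n\<close> by \<open>n\<close> block receive a harmless value in the
      closure.\<close>
    define Y where "Y i j = (if i < n \<and> j < n then X i j else ev \<alpha> (\<lambda>_. 0))" for i j
    have "Y i j \<in> closure (ev \<alpha> ` ?C)" for i j
      using X closure_subset[of "ev \<alpha> ` ?C"] group_algebra_zero[of G] by (auto simp: Y_def)
    then have "\<exists>f. \<forall>i j. (\<forall>k. f i j k \<in> ?C) \<and> (\<lambda>k. ev \<alpha> (f i j k)) \<longlonglongrightarrow> Y i j \<and> (\<lambda>k. ev \<beta> (f i j k)) \<longlonglongrightarrow> \<Phi> (Y i j)"
      by (intro choice allI lim)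
    then obtain f where f: "\<And>i j k. f i j k \<in> ?C" "\<And>i j. (\<lambda>k. ev \<alpha> (f i j k)) \<longlonglongrightarrow> Y i j"
      "\<And>i j. (\<lambda>k. ev \<beta> (f i j k)) \<longlonglongrightarrow> \<Phi> (Y i j)"
      by blast
    \<comment> \<open>By \<open>norm_form_le\<close>, \<open>\<delta> k\<close> bounds the form of
      the approximation error per unit of squared length; \<open>\<delta> k\<close> times the
      identity therefore compensates for the error.\<close>
    define \<delta> where "\<delta> k = (\<Sum>i<n. \<Sum>j<n. norm (ev \<alpha> (f i j k) - Y i j))" for k
    define D :: "nat \<Rightarrow> nat \<Rightarrow> nat \<Rightarrow> 'g \<Rightarrow> complex" where
      "D k i j = (if i = j then point_mass e (of_real (\<delta> k)) else (\<lambda>_. 0))" for k i j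
    have D: "D k i j \<in> ?C" for k i j
      by (simp add: D_def group_algebra_point_mass e group_algebra_zero)
    have evD: "ev \<gamma> (D k i j) = (if i = j then of_real (\<delta> k) *\<^sub>C 1 else 0)" if "\<gamma> e = 1"
      for \<gamma> :: "'g \<Rightarrow> 'y::chilbert_space bop" and k i j
      by (simp add: D_def ev_point_mass that)
    have "\<delta> \<longlonglongrightarrow> (\<Sum>i<n. \<Sum>j<n. norm (Y i j - Y i j))"
      unfolding \<delta>_def by (intro tendsto_intros f)
    then have \<delta>: "\<delta> \<longlonglongrightarrow> 0" by simp
    have "rpos n (\<lambda>i j. ev \<alpha> (\<lambda>x. f i j k x + D k i j x))" for k
      unfolding rpos_def
    proof
      fix \<xi> :: "nat \<Rightarrow> 'k"
      let ?S = "\<Sum>i<n. (norm (\<xi> i))\<^sup>2"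
      have "form n (\<lambda>i j. ev \<alpha> (f i j k)) \<xi> =
          form n Y \<xi> + form n (\<lambda>i j. ev \<alpha> (f i j k) - Y i j) \<xi>"
        unfolding form_add[symmetric] by simp
      moreover have "\<bar>Re (form n (\<lambda>i j. ev \<alpha> (f i j k) - Y i j) \<xi>)\<bar> \<le> \<delta> k * ?S"
        unfolding \<delta>_def using norm_form_le abs_Re_le_cmod order_trans by blast
      moreover have "form n Y \<xi> = form n X \<xi>"
        by (intro fun_cong[OF form_cong]) (simp add: Y_def)
      moreover have "0 \<le> Re (form n X \<xi>)"
        using Xpos by (simp add: rpos_def)
      moreover have "form n (\<lambda>i j. ev \<alpha> (D k i j)) \<xi> = of_real (\<delta> k * ?S)"
        by (simp add: evD e form_diag)
      ultimately show "0 \<le> Re (form n (\<lambda>i j. ev \<alpha> (\<lambda>x. f i j k x + D k i j x)) \<xi>)"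
        unfolding ev_add[OF f(1) D] form_add by simp
    qed
    then have "rpos n (\<lambda>i j. ev \<beta> (\<lambda>x. f i j k x + D k i j x))" for k
      by (intro dominatesD[OF d] group_algebra_add f D)
    then have ge: "0 \<le> Re (form n (\<lambda>i j. ev \<beta> (f i j k) + ev \<beta> (D k i j)) \<eta>)" for k
      unfolding rpos_def ev_add[OF f(1) D] by blast
    have *: "(\<lambda>k. form n (\<lambda>i j. ev \<beta> (f i j k) + ev \<beta> (D k i j)) \<eta>) \<longlonglongrightarrow> form n (\<lambda>i j. \<Phi> (Y i j) + 0) \<eta>"
    proof (rule tendsto_form, rule tendsto_add)
      show "(\<lambda>k. ev \<beta> (f i j k)) \<longlonglongrightarrow> \<Phi> (Y i j)" for i j by (rule f)
      show "(\<lambda>k. ev \<beta> (D k i j)) \<longlonglongrightarrow> 0" for i j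
      proof (rule tendsto_norm_zero_cancel, rule tendsto_sandwich[OF _ _ tendsto_const])
        show "\<forall>\<^sub>F k in sequentially. norm (ev \<beta> (D k i j)) \<le> \<bar>\<delta> k\<bar> * norm (1 :: 'h bop)"
          by (simp add: evD e norm_scaleC_bop)
        show "(\<lambda>k. \<bar>\<delta> k\<bar> * norm (1 :: 'h bop)) \<longlonglongrightarrow> 0"
          using \<delta> by (intro tendsto_mult_left_zero tendsto_rabs_zero)
      qed simp
    qed
    have "0 \<le> Re (form n (\<lambda>i j. \<Phi> (Y i j) + 0) \<eta>)"
      by (rule tendsto_lowerbound[OF tendsto_Re[OF *]]) (simp_all add: ge)
    also have "form n (\<lambda>i j. \<Phi> (Y i j) + 0) \<eta> = form n (\<lambda>i j. \<Phi> (X i j)) \<eta>"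
      by (intro fun_cong[OF form_cong]) (simp add: Y_def)
    finally show "0 \<le> Re (form n (\<lambda>i j. \<Phi> (X i j)) \<eta>)" .
  qed
  have sub: "x + y \<in> ev \<alpha> ` ?C" "c *\<^sub>C x \<in> ev \<alpha> ` ?C" if "x \<in> ev \<alpha> ` ?C" "y \<in> ev \<alpha> ` ?C" for x y c
    using that by (auto simp: ev_add[where G = G, symmetric] ev_scale[where G = G, symmetric]
        intro!: imageI group_algebra_add group_algebra_scale)
  have scC: "c *\<^sub>C x \<in> closure (ev \<alpha> ` ?C)" if "x \<in> closure (ev \<alpha> ` ?C)" for c x
    using that sub by (intro closure_subspaceI(2)) auto
  show ?thesis
  proof
    show "ucp_on (closure (ev \<alpha> ` ?C)) \<Phi>"
      unfolding ucp_on_def unital_clinear_on_def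
    proof (intro conjI ballI allI impI)
      show "\<Phi> 1 = 1"
        using ev[OF group_algebra_point_mass[OF e(1), of 1]] by (simp add: ev_point_mass e)
      fix n X assume "\<forall>i<n. \<forall>j<n. X i j \<in> closure (ev \<alpha> ` ?C)" "mat_pos n X"
      \<comment> \<open>Reality of the form is obtained by applying \<open>pos\<close> to the
        multiples of the matrix by \<open>1\<close>, \<open>\<i>\<close> and
        \<open>-\<i>\<close>.\<close>
      then have "rpos n (\<lambda>i j. \<Phi> (c *\<^sub>C X i j))" if "rpos n (\<lambda>i j. c *\<^sub>C X i j)" for c
        using that by (intro pos scC) auto
      moreover have "form n (\<lambda>i j. \<Phi> (c *\<^sub>C X i j)) = form n (\<lambda>i j. c *\<^sub>C \<Phi> (X i j))" for c
        using \<open>\<forall>i<n. \<forall>j<n. X i j \<in> _\<close> by (intro form_cong lin(2)) auto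
      ultimately have "rpos n (\<lambda>i j. c *\<^sub>C \<Phi> (X i j))" if "rpos n (\<lambda>i j. c *\<^sub>C X i j)" for c
        using that by (simp add: rpos_def)
      from this[of 1] this[of \<i>] this[of "-\<i>"] \<open>mat_pos n X\<close>
      show "mat_pos n (\<lambda>i j. \<Phi> (X i j))"
        by (simp add: mat_pos_iff_rpos)
    qed (use lin in auto)
    show "\<Phi> (ev \<alpha> f) = ev \<beta> f" if "f \<in> ?C" for f by (rule ev[OF that])
    show "\<Phi> x \<in> closure (ev \<beta> ` ?C)" if x: "x \<in> closure (ev \<alpha> ` ?C)" for x
    proof -
      obtain f where "\<And>k. f k \<in> ?C" "(\<lambda>k. ev \<beta> (f k)) \<longlonglongrightarrow> \<Phi> x"
        using lim[OF x] by blast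
      then show ?thesis
        unfolding closure_sequential by (intro exI[of _ "\<lambda>k. ev \<beta> (f k)"]) simp
    qed
  qed
qed

section \<open>Representations of the full group C*-algebra\<close>

definition L1 :: "('g \<Rightarrow> complex) \<Rightarrow> real" where
  "L1 f = (\<Sum>x | f x \<noteq> 0. cmod (f x))"

lemma L1_nonneg [simp]: "0 \<le> L1 f"
  by (simp add: L1_def sum_nonneg)

lemma group_algebra_decompose:
  assumes "f \<in> group_algebra G"
  shows "f = (\<lambda>y. \<Sum>x | f x \<noteq> 0. f x * point_mass x 1 y)"
proof
  fix y
  have "(\<Sum>x | f x \<noteq> 0. f x * point_mass x 1 y) = (\<Sum>x | f x \<noteq> 0. if x = y then f x else 0)"
    by (intro sum.cong) (auto simp: point_mass_def)
  also have "\<dots> = f y"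
    using group_algebra_finite[OF assms] by simp
  finally show "f y = (\<Sum>x | f x \<noteq> 0. f x * point_mass x 1 y)" by simp
qed

context group
begin

lemma convolution_point_mass:
  assumes "x \<in> carrier G" "y \<in> carrier G"
  shows "convolution G (point_mass x 1) (point_mass y 1) = point_mass (x \<otimes> y) 1"
proof
  fix z
  have "{(a, b). point_mass x 1 a \<noteq> 0 \<and> point_mass y 1 b \<noteq> 0 \<and> a \<otimes> b = z} =
      (if x \<otimes> y = z then {(x, y)} else {})"
    by (auto simp: point_mass_def)
  then show "convolution G (point_mass x 1) (point_mass y 1) z = point_mass (x \<otimes> y) 1 z"
    unfolding convolution_def by (auto simp: point_mass_def)
qed

lemma involution_point_mass:
  assumes "x \<in> carrier G"
  shows "involution G (point_mass x 1) = point_mass (inv x) 1"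
  using assms by (auto simp: involution_def point_mass_def fun_eq_iff)

text \<open>The bound gives the supremum in \<open>full_norm\<close> its meaning. The C*-identity
  makes the value at the unit equal to its own square and the squared value at any group element
  equal to the value at the unit; both are thus at most 1, and subadditivity does the rest.\<close>

lemma cstar_seminorm_le_L1:
  assumes p: "cstar_seminorm G p" and f: "f \<in> group_algebra G"
  shows "p f \<le> L1 f"
proof -
  have sub: "p (\<lambda>x. f x + g x) \<le> p f + p g" if "f \<in> group_algebra G" "g \<in> group_algebra G" for f g
    using p that by (auto simp: cstar_seminorm_def)
  have sc: "p (\<lambda>x. c * f x) = cmod c * p f" if "f \<in> group_algebra G" for f c
    using p that by (auto simp: cstar_seminorm_def)
  have cs: "0 \<le> p f" "p (convolution G (involution G f) f) = (p f)\<^sup>2" if "f \<in> group_algebra G" for f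
    using p that by (auto simp: cstar_seminorm_def)
  have p1: "p (point_mass \<one> 1) = (p (point_mass \<one> 1))\<^sup>2"
    using cs(2)[OF group_algebra_point_mass[OF one_closed], of 1]
    by (simp add: involution_point_mass convolution_point_mass)
  have "p (point_mass \<one> 1) \<le> 1"
  proof (rule ccontr)
    assume gt: "\<not> p (point_mass \<one> 1) \<le> 1"
    then have "p (point_mass \<one> 1) * 1 < p (point_mass \<one> 1) * p (point_mass \<one> 1)"
      by (intro mult_strict_left_mono) auto
    with p1 show False by (auto simp: power2_eq_square)
  qed
  have px: "p (point_mass x 1) \<le> 1" if "x \<in> carrier G" for x
  proof -
    have "(p (point_mass x 1))\<^sup>2 = p (point_mass \<one> 1)"
      using cs(2)[OF group_algebra_point_mass[OF that], of 1] that
      by (simp add: involution_point_mass convolution_point_mass)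
    with \<open>p (point_mass \<one> 1) \<le> 1\<close> have "(p (point_mass x 1))\<^sup>2 \<le> 1\<^sup>2" by simp
    then show ?thesis by (rule power2_le_imp_le) simp
  qed
  have "p (\<lambda>y. \<Sum>x\<in>S. f x * point_mass x 1 y) \<le> (\<Sum>x\<in>S. cmod (f x))"
    if "finite S" "S \<subseteq> carrier G" for S
    using that
  proof (induction S rule: finite_induct)
    case empty
    then show ?case using sc[OF group_algebra_zero, of 0] by simp
  next
    case (insert a S)
    have 1: "(\<lambda>y. f a * point_mass a 1 y) \<in> group_algebra G"
      "(\<lambda>y. \<Sum>x\<in>S. f x * point_mass x 1 y) \<in> group_algebra G"
      using insert by (auto intro!: group_algebra_scale group_algebra_sum group_algebra_point_mass)
    have "cmod (f a) * p (point_mass a 1) \<le> cmod (f a) * 1"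
      using px insert by (intro mult_left_mono) auto
    then have "p (\<lambda>y. f a * point_mass a 1 y) \<le> cmod (f a)"
      using insert by (simp add: sc group_algebra_point_mass)
    with sub[OF 1] insert show ?case by simp
  qed
  from this[OF group_algebra_finite[OF f]] show ?thesis
    using group_algebra_decompose[OF f] group_algebra_carrier[OF f] by (auto simp: L1_def)
qed

lemma cstar_seminorm_le_full_norm:
  assumes "cstar_seminorm G p" "f \<in> group_algebra G"
  shows "p f \<le> full_norm G f"
  unfolding full_norm_def using assms cstar_seminorm_le_L1
  by (intro cSUP_upper) (auto intro!: bdd_aboveI[where M = "L1 f"])

end

section \<open>Isometric group actions on degenerate inner product spaces\<close>

locale prehilbert_rep = prehilbert sc B + group G
  for sc :: "complex \<Rightarrow> 'v::ab_group_add \<Rightarrow> 'v" and B :: "'v \<Rightarrow> 'v \<Rightarrow> complex" and G (structure) +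
  fixes lam :: "'a \<Rightarrow> 'v \<Rightarrow> 'v"
  assumes lam_add: "x \<in> carrier G \<Longrightarrow> lam x (a + b) = lam x a + lam x b"
    and lam_sc: "x \<in> carrier G \<Longrightarrow> lam x (sc k a) = sc k (lam x a)"
    and lam_mult: "x \<in> carrier G \<Longrightarrow> y \<in> carrier G \<Longrightarrow> lam (x \<otimes> y) a = lam x (lam y a)"
    and lam_one: "lam \<one> a = a"
    and lam_B: "x \<in> carrier G \<Longrightarrow> B (lam x a) (lam x b) = B a b"
begin

definition act :: "('a \<Rightarrow> complex) \<Rightarrow> 'v \<Rightarrow> 'v" where
  "act f a = fsum sc (\<lambda>x. lam x a) f"

lemma lam_sum: "x \<in> carrier G \<Longrightarrow> lam x (sum f S) = (\<Sum>i\<in>S. lam x (f i))"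
  using lam_add[of x 0 0]
  by (induction S rule: infinite_finite_induct) (auto simp: lam_add)

lemma lam_B_adj: "x \<in> carrier G \<Longrightarrow> B (lam x a) b = B a (lam (inv x) b)"
  by (metis lam_B inv_closed l_inv lam_mult lam_one)

lemma nn_lam: "x \<in> carrier G \<Longrightarrow> nn (lam x a) = nn a"
  by (simp add: nn_def lam_B)

lemma act_add_left: "f \<in> group_algebra G \<Longrightarrow> g \<in> group_algebra G \<Longrightarrow>
    act (\<lambda>x. f x + g x) a = act f a + act g a"
  unfolding act_def by (rule fsum_add[OF sc_module])

lemma act_scale_left: "f \<in> group_algebra G \<Longrightarrow> act (\<lambda>x. c * f x) a = sc c (act f a)"
  unfolding act_def by (rule fsum_scale[OF sc_module])

lemma act_sum_left: "finite S \<Longrightarrow> (\<And>i. i \<in> S \<Longrightarrow> f i \<in> group_algebra G) \<Longrightarrow>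
    act (\<lambda>x. \<Sum>i\<in>S. f i x) a = (\<Sum>i\<in>S. act (f i) a)"
  unfolding act_def by (rule fsum_sum[OF sc_module])

lemma act_point_mass: "act (point_mass x c) a = sc c (lam x a)"
  unfolding act_def by (rule fsum_point_mass[OF sc_module])

lemma act_zero_left [simp]: "act (\<lambda>_. 0) a = 0"
  by (simp add: act_def)

lemma act_add: "f \<in> group_algebra G \<Longrightarrow> act f (a + b) = act f a + act f b"
  using group_algebra_carrier[of f G]
  by (simp add: act_def fsum_def lam_add scale_right_distrib sum.distrib)

lemma act_sc: "f \<in> group_algebra G \<Longrightarrow> act f (sc k a) = sc k (act f a)"
  using group_algebra_carrier[of f G]
  by (simp add: act_def fsum_def lam_sc scale_sum_right mult.commute)

lemma act_convolution:
  assumes f: "f \<in> group_algebra G" and g: "g \<in> group_algebra G"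
  shows "act (convolution G f g) a = act f (act g a)"
  unfolding act_def fsum_convolution[OF sc_module f g] unfolding fsum_def
  using group_algebra_carrier[OF f] group_algebra_carrier[OF g]
  by (auto intro!: sum.cong simp: lam_sum lam_sc lam_mult scale_sum_right)

lemma act_involution:
  assumes f: "f \<in> group_algebra G"
  shows "B (act f a) b = B a (act (involution G f) b)"
  unfolding act_def fsum_involution[OF sc_module f]
  using group_algebra_carrier[OF f]
  by (simp add: fsum_def B_sum B_sum_right B_sc B_sc_right lam_B_adj)

lemma nn_act_le_L1:
  assumes f: "f \<in> group_algebra G"
  shows "nn (act f a) \<le> L1 f * nn a"
proof -
  have "nn (act f a) \<le> (\<Sum>x | f x \<noteq> 0. nn (sc (f x) (lam x a)))"
    unfolding act_def fsum_def by (rule nn_sum)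
  also have "\<dots> = L1 f * nn a"
    using group_algebra_carrier[OF f] by (simp add: L1_def nn_sc nn_lam sum_distrib_right)
  finally show ?thesis .
qed

text \<open>The operator norm that \<open>f\<close> would have on the completion of the quotient by
  null vectors; \<open>nn_act_le_L1\<close> keeps the supremum finite.\<close>

definition opnorm :: "('a \<Rightarrow> complex) \<Rightarrow> real" where
  "opnorm f = (SUP a\<in>{a. nn a \<le> 1}. nn (act f a))"

lemma nn_act_le_opnorm:
  assumes f: "f \<in> group_algebra G"
  shows "nn (act f a) \<le> opnorm f * nn a"
proof (cases "nn a = 0")
  case True
  with nn_act_le_L1[OF f, of a] show ?thesis by simp
next
  case False
  let ?k = "complex_of_real (1 / nn a)"
  have 1: "cmod ?k = 1 / nn a" by (simp only: norm_of_real) simp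
  have "nn (act f (sc ?k a)) \<le> opnorm f"
    unfolding opnorm_def
  proof (rule cSUP_upper)
    show "sc ?k a \<in> {a. nn a \<le> 1}" using False by (simp only: mem_Collect_eq nn_sc 1) simp
    show "bdd_above ((\<lambda>a. nn (act f a)) ` {a. nn a \<le> 1})"
      using nn_act_le_L1[OF f] L1_nonneg[of f]
      by (intro bdd_aboveI2[where M = "L1 f"]) (metis mem_Collect_eq mult_left_le order_trans)
  qed
  then have "1 / nn a * nn (act f a) \<le> opnorm f"
    unfolding act_sc[OF f] nn_sc 1 .
  moreover have "nn a > 0" using False nn_nonneg[of a] by linarith
  ultimately show ?thesis
    by (simp add: field_simps)
qed

lemma opnorm_le:
  assumes "0 \<le> c" "\<And>a. nn (act f a) \<le> c * nn a"
  shows "opnorm f \<le> c"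
  unfolding opnorm_def
proof (rule cSUP_least)
  have "0 \<in> {a. nn a \<le> 1}" by simp
  then show "{a. nn a \<le> 1} \<noteq> {}" by blast
  show "nn (act f a) \<le> c" if "a \<in> {a. nn a \<le> 1}" for a
    using assms(2)[of a] mult_left_mono[of "nn a" 1 c] assms(1) that by simp
qed

lemma act_zero_right [simp]: "f \<in> group_algebra G \<Longrightarrow> act f 0 = 0"
  using act_add[of f 0 0] by simp

lemma opnorm_nonneg: "f \<in> group_algebra G \<Longrightarrow> 0 \<le> opnorm f"
  unfolding opnorm_def
proof (rule cSUP_upper2[where x = 0])
  assume f: "f \<in> group_algebra G"
  show "bdd_above ((\<lambda>a. nn (act f a)) ` {a. nn a \<le> 1})"
    using nn_act_le_L1[OF f] L1_nonneg[of f]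
    by (intro bdd_aboveI2[where M = "L1 f"]) (metis mem_Collect_eq mult_left_le order_trans)
qed auto

text \<open>The C*-identity is the usual one for operators: \<open>nn (act f a)\<close> squared is
  the real part of the form of \<open>f^* f\<close> at \<open>a\<close>, which bounds
  \<open>opnorm f\<close> squared by the seminorm of \<open>f^* f\<close>. Combined with
  submultiplicativity this gives invariance under the involution and then equality.\<close>

lemma opnorm_cstar_seminorm: "cstar_seminorm G opnorm"
proof -
  have add: "opnorm (\<lambda>x. f x + g x) \<le> opnorm f + opnorm g"
    if f: "f \<in> group_algebra G" and g: "g \<in> group_algebra G" for f g
  proof (rule opnorm_le)
    fix a
    show "nn (act (\<lambda>x. f x + g x) a) \<le> (opnorm f + opnorm g) * nn a"
      using nn_triangle[of "act f a" "act g a"] nn_act_le_opnorm[OF f, of a] nn_act_le_opnorm[OF g, of a]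
      by (simp add: act_add_left[OF f g] distrib_right)
  qed (simp add: f g opnorm_nonneg)
  have mult: "opnorm (convolution G f g) \<le> opnorm f * opnorm g"
    if f: "f \<in> group_algebra G" and g: "g \<in> group_algebra G" for f g
  proof (rule opnorm_le)
    fix a
    have "nn (act f (act g a)) \<le> opnorm f * (opnorm g * nn a)"
      by (rule order_trans[OF nn_act_le_opnorm[OF f]])
        (intro mult_left_mono nn_act_le_opnorm opnorm_nonneg f g)
    then show "nn (act (convolution G f g) a) \<le> opnorm f * opnorm g * nn a"
      by (simp add: act_convolution[OF f g])
  qed (simp add: f g opnorm_nonneg)
  have scale_le: "opnorm (\<lambda>x. c * f x) \<le> cmod c * opnorm f" if f: "f \<in> group_algebra G" for c f
  proof (rule opnorm_le)
    show "nn (act (\<lambda>x. c * f x) a) \<le> cmod c * opnorm f * nn a" for a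
      using mult_left_mono[OF nn_act_le_opnorm[OF f], of "cmod c"]
      by (simp add: act_scale_left[OF f] nn_sc mult.assoc)
  qed (simp add: f opnorm_nonneg)
  have scale: "opnorm (\<lambda>x. c * f x) = cmod c * opnorm f" if f: "f \<in> group_algebra G" for c f
  proof (cases "c = 0")
    case True
    have "opnorm (\<lambda>_. 0) \<le> 0" by (rule opnorm_le) auto
    with True opnorm_nonneg[OF group_algebra_zero] show ?thesis by simp
  next
    case False
    have "opnorm (\<lambda>x. inverse c * (c * f x)) \<le> cmod (inverse c) * opnorm (\<lambda>x. c * f x)"
      by (rule scale_le[OF group_algebra_scale[OF f]])
    then have "opnorm f \<le> inverse (cmod c) * opnorm (\<lambda>x. c * f x)"
      using False by (simp add: mult.assoc[symmetric] norm_inverse)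
    from mult_left_mono[OF this, of "cmod c"] have "cmod c * opnorm f \<le> opnorm (\<lambda>x. c * f x)"
      using False by (simp add: mult.assoc[symmetric])
    with scale_le[OF f, of c] show ?thesis by simp
  qed
  have sq: "(opnorm f)\<^sup>2 \<le> opnorm (convolution G (involution G f) f)" if f: "f \<in> group_algebra G" for f
  proof -
    let ?h = "convolution G (involution G f) f"
    have h: "?h \<in> group_algebra G" "involution G f \<in> group_algebra G"
      by (intro group_algebra_convolution group_algebra_involution f)+
    have "opnorm f \<le> sqrt (opnorm ?h)"
    proof (rule opnorm_le)
      fix a
      have "(nn (act f a))\<^sup>2 = Re (B (act ?h a) a)"
        by (simp add: nn_square act_convolution[OF h(2) f] act_involution[OF h(2)] involution_involution[OF f])
      also have "\<dots> \<le> nn (act ?h a) * nn a"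
        using Cauchy_Schwarz complex_Re_le_cmod order_trans by blast
      also have "\<dots> \<le> opnorm ?h * nn a * nn a"
        by (intro mult_right_mono nn_act_le_opnorm h) simp
      also have "\<dots> = (sqrt (opnorm ?h) * nn a)\<^sup>2"
        by (simp add: power_mult_distrib opnorm_nonneg h) (simp add: power2_eq_square)
      finally show "nn (act f a) \<le> sqrt (opnorm ?h) * nn a"
        by (rule power2_le_imp_le) (simp add: opnorm_nonneg h)
    qed (simp add: opnorm_nonneg h)
    then have "(opnorm f)\<^sup>2 \<le> (sqrt (opnorm ?h))\<^sup>2"
      by (rule power_mono) (simp add: opnorm_nonneg f)
    then show ?thesis by (simp add: opnorm_nonneg h)
  qed
  have inv_le: "opnorm f \<le> opnorm (involution G f)" if f: "f \<in> group_algebra G" for f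
  proof (cases "opnorm f = 0")
    case True
    then show ?thesis by (simp add: opnorm_nonneg group_algebra_involution f)
  next
    case False
    have "opnorm f * opnorm f \<le> opnorm (involution G f) * opnorm f"
      using order_trans[OF sq[OF f] mult[OF group_algebra_involution[OF f] f]]
      by (simp add: power2_eq_square)
    with False opnorm_nonneg[OF f] show ?thesis
      by (simp add: mult_le_cancel_right)
  qed
  have "opnorm (convolution G (involution G f) f) = (opnorm f)\<^sup>2" if f: "f \<in> group_algebra G" for f
  proof (rule antisym[OF _ sq[OF f]])
    have "opnorm (involution G f) = opnorm f"
      using inv_le[OF f] inv_le[OF group_algebra_involution[OF f]] by (simp add: involution_involution[OF f])
    then show "opnorm (convolution G (involution G f) f) \<le> (opnorm f)\<^sup>2"
      using mult[OF group_algebra_involution[OF f] f] by (simp add: power2_eq_square)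
  qed
  then show ?thesis
    by (simp add: cstar_seminorm_def add mult scale opnorm_nonneg)
qed

text \<open>Maximality of the full norm enters the development here: \<open>opnorm\<close> is one of
  the seminorms over which \<open>full_norm\<close> is the supremum.\<close>

lemma nn_act_le_full:
  assumes u: "is_full_group_rep G u" and f: "f \<in> group_algebra G"
  shows "nn (act f a) \<le> norm (ev u f) * nn a"
proof -
  have "norm (ev u f) = full_norm G f"
    using u f by (simp add: is_full_group_rep_def fsum_def)
  then have "opnorm f \<le> norm (ev u f)"
    using cstar_seminorm_le_full_norm[OF opnorm_cstar_seminorm f] by simp
  then show ?thesis
    by (rule order_trans[OF nn_act_le_opnorm[OF f] mult_right_mono]) simp
qed

end

lemma is_full_group_rep_unitary: "is_full_group_rep G u \<Longrightarrow> unitary_rep G u"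
  by (simp add: is_full_group_rep_def unitary_rep_def)

section \<open>Positivity of matrices in an isometric action\<close>

context prehilbert_rep
begin

definition vform :: "nat \<Rightarrow> (nat \<Rightarrow> nat \<Rightarrow> 'a \<Rightarrow> complex) \<Rightarrow> (nat \<Rightarrow> 'v) \<Rightarrow> complex" where
  "vform n F a = (\<Sum>i<n. \<Sum>j<n. B (act (F i j) (a j)) (a i))"

text \<open>Nonnegative real part is visible in the norm to first order: for \<open>s > 0\<close>
  the squared norm of \<open>1 - s T\<close> is at most 1 plus a multiple of the square of
  \<open>s\<close>. The norm comparison carries this over to \<open>act\<close>, where a negative
  real part would contribute a positive linear term in \<open>s\<close>.\<close>

lemma Re_act_nonneg:
  assumes u: "is_full_group_rep G u" and f: "f \<in> group_algebra G"
    and pos: "\<And>\<xi>. 0 \<le> Re (cinner (bapp (ev u f) \<xi>) \<xi>)"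
  shows "0 \<le> Re (B (act f a) a)"
proof (rule ccontr)
  let ?T = "ev u f"
  define r where "r = - Re (B (act f a) a)"
  define K where "K = (norm ?T)\<^sup>2 * (nn a)\<^sup>2"
  assume "\<not> 0 \<le> Re (B (act f a) a)"
  then have r: "r > 0" by (simp add: r_def)
  have K: "K \<ge> 0" by (simp add: K_def)
  have key: "2 * s * r \<le> s\<^sup>2 * K" if s: "s > 0" for s
  proof -
    define k where "k = - complex_of_real s"
    define h where "h = (\<lambda>x. point_mass \<one> 1 x + k * f x)"
    have pm: "point_mass \<one> 1 \<in> group_algebra G" by (simp add: group_algebra_point_mass)
    have h: "h \<in> group_algebra G"
      unfolding h_def by (intro group_algebra_add group_algebra_scale f pm)
    have evh: "ev u h = 1 - of_real s *\<^sub>C ?T"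
      unfolding h_def ev_add[OF pm group_algebra_scale[OF f]] ev_scale[OF f]
      by (simp add: ev_point_mass unitary_rep_one[OF is_full_group_rep_unitary[OF u]]
          bopm.scale_minus_left k_def)
    have acth: "act h a = a - sc (of_real s) (act f a)"
      unfolding h_def act_add_left[OF pm group_algebra_scale[OF f]] act_scale_left[OF f]
      by (simp add: act_point_mass lam_one scale_minus_left k_def)
    have "norm (ev u h) \<le> sqrt (1 + s\<^sup>2 * (norm ?T)\<^sup>2)"
    proof (rule norm_bop_bound)
      fix \<xi>
      have "(norm (bapp (ev u h) \<xi>))\<^sup>2 =
          (norm \<xi>)\<^sup>2 - 2 * Re (cinner \<xi> (of_real s *\<^sub>C bapp ?T \<xi>)) + (s * norm (bapp ?T \<xi>))\<^sup>2"
        unfolding evh bapp_simps hilb.nn_diff_square using s by (simp add: norm_scaleC)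
      also have "Re (cinner \<xi> (of_real s *\<^sub>C bapp ?T \<xi>)) = s * Re (cinner (bapp ?T \<xi>) \<xi>)"
        using arg_cong[OF cinner_commute[of \<xi> "bapp ?T \<xi>"], of Re] by (simp add: cinner_scaleC_right)
      also have "(norm \<xi>)\<^sup>2 - 2 * (s * Re (cinner (bapp ?T \<xi>) \<xi>)) + (s * norm (bapp ?T \<xi>))\<^sup>2 \<le>
          (norm \<xi>)\<^sup>2 + (s * (norm ?T * norm \<xi>))\<^sup>2"
      proof -
        have "(s * norm (bapp ?T \<xi>))\<^sup>2 \<le> (s * (norm ?T * norm \<xi>))\<^sup>2"
          using s by (intro power_mono mult_left_mono norm_bapp) auto
        moreover have "0 \<le> s * Re (cinner (bapp ?T \<xi>) \<xi>)" using s pos by simp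
        ultimately show ?thesis by linarith
      qed
      also have "\<dots> = (1 + s\<^sup>2 * (norm ?T)\<^sup>2) * (norm \<xi>)\<^sup>2"
        by (simp add: power_mult_distrib distrib_right)
      also have "\<dots> = (sqrt (1 + s\<^sup>2 * (norm ?T)\<^sup>2) * norm \<xi>)\<^sup>2"
        by (simp add: power_mult_distrib)
      finally show "norm (bapp (ev u h) \<xi>) \<le> sqrt (1 + s\<^sup>2 * (norm ?T)\<^sup>2) * norm \<xi>"
        by (rule power2_le_imp_le) simp
    qed simp
    then have "nn (act h a) \<le> sqrt (1 + s\<^sup>2 * (norm ?T)\<^sup>2) * nn a"
      by (intro order_trans[OF nn_act_le_full[OF u h]] mult_right_mono) simp_all
    then have "(nn (act h a))\<^sup>2 \<le> (sqrt (1 + s\<^sup>2 * (norm ?T)\<^sup>2) * nn a)\<^sup>2"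
      by (rule power_mono) simp
    also have "\<dots> = (nn a)\<^sup>2 + s\<^sup>2 * K"
      by (simp add: power_mult_distrib K_def distrib_right)
    finally have "(nn a)\<^sup>2 - 2 * Re (B a (sc (of_real s) (act f a))) + (nn (sc (of_real s) (act f a)))\<^sup>2
        \<le> (nn a)\<^sup>2 + s\<^sup>2 * K"
      unfolding acth nn_diff_square .
    moreover have "Re (B a (sc (of_real s) (act f a))) = - s * r"
      using arg_cong[OF B_cnj[of a "act f a"], of Re] by (simp add: B_sc_right r_def)
    ultimately show ?thesis
      using zero_le_power2[of "nn (sc (of_real s) (act f a))"] by linarith
  qed
  \<comment> \<open>Small enough for the quadratic term \<open>s^2 K\<close> to fall below the
    linear term \<open>2 s r\<close>.\<close>
  define s where "s = r / (K + 1)"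
  have s: "s > 0" using r K by (simp add: s_def)
  have "s * (2 * r) \<le> s * (s * K)" using key[OF s] by (simp add: power2_eq_square mult_ac)
  then have "2 * r \<le> s * K" using s by simp
  also have "\<dots> \<le> s * (K + 1)" using s by simp
  also have "\<dots> = r" using K by (simp add: s_def)
  finally show False using r by simp
qed

definition submodule :: "'v set \<Rightarrow> bool" where
  "submodule V \<longleftrightarrow> 0 \<in> V \<and> (\<forall>a\<in>V. \<forall>b\<in>V. a + b \<in> V) \<and> (\<forall>k. \<forall>a\<in>V. sc k a \<in> V) \<and>
     (\<forall>x\<in>carrier G. \<forall>a\<in>V. lam x a \<in> V)"

lemma submodule_act:
  assumes V: "submodule V" and f: "f \<in> group_algebra G" and a: "a \<in> V"
  shows "act f a \<in> V"
proof -
  have "(\<Sum>x\<in>S. sc (f x) (lam x a)) \<in> V" if "finite S" "S \<subseteq> carrier G" for S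
    using that V a by (induction S rule: finite_induct) (auto simp: submodule_def)
  then show ?thesis
    unfolding act_def fsum_def using group_algebra_finite[OF f] group_algebra_carrier[OF f] by auto
qed

text \<open>If all entries lie in one cyclic submodule, the matrix collapses to a single element:
  the form equals that of \<open>h\<close>, the sum of \<open>f_i^* F_ij f_j\<close>, at the vector
  \<open>b\<close>. The same computation in the representation \<open>u\<close> shows that
  \<open>ev u h\<close> has nonnegative real part.\<close>

lemma vform_cyclic:
  assumes u: "is_full_group_rep G u" and F: "\<And>i j. F i j \<in> group_algebra G"
    and pos: "rpos n (\<lambda>i j. ev u (F i j))" and f: "\<And>i. f i \<in> group_algebra G"
  shows "0 \<le> Re (vform n F (\<lambda>i. act (f i) b))"
proof -
  note ur = is_full_group_rep_unitary[OF u]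
  define h where "h = (\<lambda>x. \<Sum>i<n. \<Sum>j<n. convolution G (involution G (f i)) (convolution G (F i j) (f j)) x)"
  have c: "convolution G (F i j) (f j) \<in> group_algebra G" "involution G (f i) \<in> group_algebra G" for i j
    by (intro group_algebra_convolution group_algebra_involution F f)+
  have c2: "convolution G (involution G (f i)) (convolution G (F i j) (f j)) \<in> group_algebra G" for i j
    by (intro group_algebra_convolution c)
  have h: "h \<in> group_algebra G"
    unfolding h_def by (intro group_algebra_sum c2) auto
  have acth: "act h b = (\<Sum>i<n. \<Sum>j<n. act (involution G (f i)) (act (F i j) (act (f j) b)))"
    unfolding h_def
    by (simp add: act_sum_left group_algebra_sum c2 act_convolution c F f)
  have evh: "ev u h = (\<Sum>i<n. \<Sum>j<n. adj (ev u (f i)) * (ev u (F i j) * ev u (f j)))"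
    unfolding h_def
    by (simp add: ev_sum[where G = G] group_algebra_sum c2 ev_convolution[OF ur] c F f ev_involution[OF ur])
  have "0 \<le> Re (B (act h b) b)"
  proof (rule Re_act_nonneg[OF u h])
    fix \<xi>
    have "cinner (bapp (ev u h) \<xi>) \<xi> = form n (\<lambda>i j. ev u (F i j)) (\<lambda>j. bapp (ev u (f j)) \<xi>)"
      by (simp add: evh form_def bapp_sum bapp_simps hilb.B_sum cinner_adj)
    then show "0 \<le> Re (cinner (bapp (ev u h) \<xi>) \<xi>)"
      using pos by (simp add: rpos_def)
  qed
  also have "B (act h b) b = vform n F (\<lambda>i. act (f i) b)"
    by (simp add: acth vform_def B_sum act_involution[OF c(2)] involution_involution[OF f])
  finally show ?thesis .
qed

text \<open>A vector of \<open>b + V\<close> of almost minimal length is almost orthogonal to \<open>V\<close>.\<close>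

lemma almost_orthogonal:
  assumes V: "submodule V" and \<delta>: "0 < \<delta>"
  obtains c where "c \<in> V" "\<And>x. x \<in> V \<Longrightarrow> cmod (B (b - c) x) \<le> \<delta> * nn x" "nn c \<le> 2 * nn b + \<delta>"
proof -
  let ?Q = "\<lambda>c. (nn (b - c))\<^sup>2"
  define d where "d = Inf (?Q ` V)"
  have V0: "0 \<in> V" using V by (simp add: submodule_def)
  have d: "d \<le> ?Q c" if "c \<in> V" for c
    unfolding d_def using that by (intro cINF_lower bdd_belowI2[where m = 0]) auto
  have "Inf (?Q ` V) < d + \<delta>\<^sup>2" using \<delta> by (simp add: d_def)
  from cInf_lessD[OF _ this] V0 obtain c where c: "c \<in> V" "?Q c < d + \<delta>\<^sup>2" by auto
  show ?thesis
  proof (rule that[of c])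
    show "c \<in> V" by fact
    have "?Q c \<le> (nn b)\<^sup>2 + \<delta>\<^sup>2" using c(2) d[OF V0] by simp
    also have "\<dots> \<le> (nn b + \<delta>)\<^sup>2" using \<delta> by (simp add: power2_sum)
    finally have "nn (b - c) \<le> nn b + \<delta>" by (rule power2_le_imp_le) (use \<delta> in simp)
    moreover have "nn c \<le> nn b + nn (b - c)"
      using nn_triangle[of b "- (b - c)"] nn_sc[of "-1" "b - c"] by (simp add: scale_minus_left)
    ultimately show "nn c \<le> 2 * nn b + \<delta>" by simp
    fix x assume x: "x \<in> V"
    let ?m = "cmod (B (b - c) x)"
    have le: "2 * t * ?m \<le> \<delta>\<^sup>2 + t\<^sup>2 * (nn x)\<^sup>2" for t
    proof -
      obtain k where k: "cmod k = 1" "cnj k * B (b - c) x = complex_of_real ?m"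
        by (rule cnj_phase)
      let ?y = "sc (of_real t * k) x"
      have "c + ?y \<in> V" using V c(1) x by (simp add: submodule_def)
      from d[OF this] have "d \<le> (nn (b - c - ?y))\<^sup>2" by (simp add: diff_diff_eq)
      also have "\<dots> = ?Q c - 2 * Re (of_real t * (cnj k * B (b - c) x)) + (nn ?y)\<^sup>2"
        by (simp add: nn_diff_square B_sc_right mult.assoc)
      also have "\<dots> = ?Q c - 2 * t * ?m + t\<^sup>2 * (nn x)\<^sup>2"
        unfolding k(2) by (simp add: nn_sc norm_mult k(1) power_mult_distrib)
      finally show ?thesis using c(2) by linarith
    qed
    show "?m \<le> \<delta> * nn x"
    proof (cases "nn x = 0")
      case True
      with Cauchy_Schwarz[of "b - c" x] show ?thesis by simp
    next
      case False
      then have nx: "nn x > 0" using nn_nonneg[of x] by linarith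
      \<comment> \<open>This value of \<open>t\<close> makes both terms on the right of
        \<open>le\<close> equal to the square of \<open>\<delta>\<close>.\<close>
      have "2 * (\<delta> / nn x) * ?m \<le> 2 * \<delta>\<^sup>2"
        using le[of "\<delta> / nn x"] False by (simp add: power_divide)
      then have "\<delta> * (?m / nn x) \<le> \<delta> * \<delta>" by (simp add: power2_eq_square)
      then have "?m / nn x \<le> \<delta>" using \<delta> by (simp only: mult_le_cancel_left_pos)
      then show ?thesis using nx by (simp add: field_simps)
    qed
  qed
qed

text \<open>A new cyclic vector \<open>b\<close> is replaced by \<open>b' = b - c\<close>, almost
  orthogonal to \<open>V\<close>. Moving \<open>c\<close> into \<open>V\<close> splits the entries
  into a part in \<open>V\<close> and a cyclic part generated by \<open>b'\<close>; each part
  contributes a nonnegative amount, and the mixed terms are of order \<open>\<delta>\<close>. This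
  replaces the orthogonal projection available in a complete space.\<close>

lemma vform_extend:
  assumes u: "is_full_group_rep G u" and F: "\<And>i j. F i j \<in> group_algebra G"
    and pos: "rpos n (\<lambda>i j. ev u (F i j))" and f: "\<And>i. f i \<in> group_algebra G"
    and V: "submodule V" and Vpos: "\<And>a. (\<And>i. a i \<in> V) \<Longrightarrow> 0 \<le> Re (vform n F a)"
    and v: "\<And>i. v i \<in> V"
  shows "0 \<le> Re (vform n F (\<lambda>i. v i + act (f i) b))"
proof (rule ccontr)
  let ?I = "involution G"
  note Fi = group_algebra_involution[OF F] and fi = group_algebra_involution[OF f]
  \<comment> \<open>\<open>M\<close> bounds \<open>nn c\<close> for \<open>\<delta> \<le> 1\<close>,
    \<open>N j\<close> bounds the part of the \<open>j\<close>-th entry in \<open>V\<close>, and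
    \<open>\<delta> * K\<close> bounds the mixed terms; none of these constants depends on
    \<open>\<delta>\<close>.\<close>
  define M where "M = 2 * nn b + 1"
  define N where "N j = nn (v j) + L1 (f j) * M" for j
  define K where "K = (\<Sum>i<n. \<Sum>j<n. L1 (?I (f i)) * (L1 (F i j) * N j) + L1 (?I (f j)) * (L1 (?I (F i j)) * N i))"
  let ?r = "Re (vform n F (\<lambda>i. v i + act (f i) b))"
  assume neg: "\<not> 0 \<le> ?r"
  have key: "- (\<delta> * K) \<le> ?r" if \<delta>: "0 < \<delta>" "\<delta> \<le> 1" for \<delta>
  proof -
    obtain c where c: "c \<in> V" "\<And>x. x \<in> V \<Longrightarrow> cmod (B (b - c) x) \<le> \<delta> * nn x" "nn c \<le> 2 * nn b + \<delta>"
      by (rule almost_orthogonal[OF V \<delta>(1), of b]) (rule that)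
    define b' where "b' = b - c"
    define w where "w j = v j + act (f j) c" for j
    have w: "w j \<in> V" for j
      using V v submodule_act[OF V f c(1)] by (simp add: w_def submodule_def)
    have nw: "nn (w j) \<le> N j" for j
    proof -
      have "nn (act (f j) c) \<le> L1 (f j) * M"
        using c(3) \<delta> by (intro order_trans[OF nn_act_le_L1[OF f]] mult_left_mono) (simp_all add: M_def)
      then show ?thesis using nn_triangle[of "v j" "act (f j) c"] by (simp add: w_def N_def)
    qed
    have split: "v j + act (f j) b = w j + act (f j) b'" for j
    proof -
      have "act (f j) b = act (f j) (c + b')" by (simp add: b'_def)
      also have "\<dots> = act (f j) c + act (f j) b'" by (rule act_add[OF f])
      finally show ?thesis by (simp add: w_def add.assoc)
    qed
    define c1 where "c1 i j = B (act (F i j) (w j)) (act (f i) b')" for i j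
    define c2 where "c2 i j = B (act (F i j) (act (f j) b')) (w i)" for i j
    have "vform n F (\<lambda>i. v i + act (f i) b) = vform n F w + vform n F (\<lambda>i. act (f i) b') + (\<Sum>i<n. \<Sum>j<n. c1 i j + c2 i j)"
      unfolding split vform_def c1_def c2_def
      by (simp add: act_add[OF F] B_add B_add_right sum.distrib algebra_simps)
    moreover have "0 \<le> Re (vform n F w)" by (rule Vpos[OF w])
    moreover have "0 \<le> Re (vform n F (\<lambda>i. act (f i) b'))" by (rule vform_cyclic[OF u F pos f])
    moreover have "cmod (\<Sum>i<n. \<Sum>j<n. c1 i j + c2 i j) \<le> \<delta> * K"
    proof -
      have c1: "cmod (c1 i j) \<le> \<delta> * (L1 (?I (f i)) * (L1 (F i j) * N j))" for i j
      proof -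
        have "c1 i j = B (act (?I (f i)) (act (F i j) (w j))) b'"
          by (simp add: c1_def act_involution[OF fi] involution_involution[OF f])
        then have "cmod (c1 i j) = cmod (B b' (act (?I (f i)) (act (F i j) (w j))))"
          by (subst (asm) B_cnj) simp
        also have "\<dots> \<le> \<delta> * nn (act (?I (f i)) (act (F i j) (w j)))"
          unfolding b'_def by (intro c(2) submodule_act[OF V] fi F w)
        also have "\<dots> \<le> \<delta> * (L1 (?I (f i)) * (L1 (F i j) * N j))"
          using \<delta> by (intro mult_left_mono order_trans[OF nn_act_le_L1[OF fi]]
              order_trans[OF nn_act_le_L1[OF F]] nw) auto
        finally show ?thesis .
      qed
      have c2: "cmod (c2 i j) \<le> \<delta> * (L1 (?I (f j)) * (L1 (?I (F i j)) * N i))" for i j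
      proof -
        have "c2 i j = B b' (act (?I (f j)) (act (?I (F i j)) (w i)))"
          by (simp add: c2_def act_involution[OF F] act_involution[OF f])
        then have "cmod (c2 i j) \<le> \<delta> * nn (act (?I (f j)) (act (?I (F i j)) (w i)))"
          unfolding b'_def by (simp add: c(2) submodule_act[OF V] fi Fi w)
        also have "\<dots> \<le> \<delta> * (L1 (?I (f j)) * (L1 (?I (F i j)) * N i))"
          using \<delta> by (intro mult_left_mono order_trans[OF nn_act_le_L1[OF fi]]
              order_trans[OF nn_act_le_L1[OF Fi]] nw) auto
        finally show ?thesis .
      qed
      have "cmod (\<Sum>i<n. \<Sum>j<n. c1 i j + c2 i j) \<le> (\<Sum>i<n. \<Sum>j<n. cmod (c1 i j) + cmod (c2 i j))"
        by (intro order_trans[OF norm_sum] sum_mono norm_triangle_ineq)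
      also have "\<dots> \<le> (\<Sum>i<n. \<Sum>j<n. \<delta> * (L1 (?I (f i)) * (L1 (F i j) * N j)) + \<delta> * (L1 (?I (f j)) * (L1 (?I (F i j)) * N i)))"
        by (intro sum_mono add_mono c1 c2)
      also have "\<dots> = \<delta> * K"
        by (simp add: K_def sum_distrib_left distrib_left)
      finally show ?thesis .
    qed
    then have "\<bar>Re (\<Sum>i<n. \<Sum>j<n. c1 i j + c2 i j)\<bar> \<le> \<delta> * K"
      using abs_Re_le_cmod order_trans by blast
    ultimately show ?thesis by simp
  qed
  have "0 \<le> N j" for j by (simp add: N_def M_def)
  then have K: "0 \<le> K" unfolding K_def by (intro sum_nonneg add_nonneg_nonneg mult_nonneg_nonneg) auto
  \<comment> \<open>Chosen so that the mixed terms amount to at most half of the supposed negative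
    value.\<close>
  define \<delta> where "\<delta> = min 1 (- ?r / (2 * (K + 1)))"
  have \<delta>: "0 < \<delta>" "\<delta> \<le> 1" using neg K by (auto simp: \<delta>_def divide_pos_pos divide_neg_pos)
  have "\<delta> * K \<le> \<delta> * (K + 1)" using \<delta> by simp
  also have "\<dots> \<le> - ?r / (2 * (K + 1)) * (K + 1)" using K by (intro mult_right_mono) (simp_all add: \<delta>_def)
  also have "\<dots> = - ?r / 2" using K by (simp add: field_simps)
  finally show False using key[OF \<delta>] neg by simp
qed

text \<open>The full norm controls single elements of the group algebra only. Matrix positivity
  follows by adjoining the entries of \<open>a\<close> one after another, each as a generator of a
  further cyclic piece.\<close>

lemma vform_nonneg:
  assumes u: "is_full_group_rep G u" and F: "\<And>i j. F i j \<in> group_algebra G"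
    and pos: "rpos n (\<lambda>i j. ev u (F i j))"
  shows "0 \<le> Re (vform n F a)"
proof -
  have "\<exists>V. submodule V \<and> (\<forall>i<m. a i \<in> V) \<and> (\<forall>a'. (\<forall>i. a' i \<in> V) \<longrightarrow> 0 \<le> Re (vform n F a'))" for m
  proof (induction m)
    case 0
    have "lam x 0 = 0" if "x \<in> carrier G" for x using lam_add[OF that, of 0 0] by simp
    then have "submodule {0}" by (simp add: submodule_def)
    moreover have "vform n F a' = 0" if "\<forall>i. a' i \<in> {0}" for a'
      using that by (simp add: vform_def)
    ultimately show ?case by (intro exI[of _ "{0}"]) auto
  next
    case (Suc m)
    then obtain V where V: "submodule V" "\<And>i. i < m \<Longrightarrow> a i \<in> V"
      "\<And>a'. (\<And>i. a' i \<in> V) \<Longrightarrow> 0 \<le> Re (vform n F a')" by blast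
    define W where "W = {v + act f (a m) | v f. v \<in> V \<and> f \<in> group_algebra G}"
    have WI: "v + act f (a m) \<in> W" if "v \<in> V" "f \<in> group_algebra G" for v f
      using that by (auto simp: W_def)
    have V0: "0 \<in> V" using V(1) by (simp add: submodule_def)
    have VW: "v \<in> W" if "v \<in> V" for v
      using WI[OF that group_algebra_zero] by simp
    have amW: "a m \<in> W"
      using WI[OF V0 group_algebra_point_mass[OF one_closed, of 1]] by (simp add: act_point_mass lam_one)
    have "submodule W"
      unfolding submodule_def
    proof (intro conjI ballI allI)
      show "0 \<in> W" using V0 by (rule VW)
      fix x y assume "x \<in> W" "y \<in> W"
      then obtain v f v' f' where *: "x = v + act f (a m)" "v \<in> V" "f \<in> group_algebra G"
        "y = v' + act f' (a m)" "v' \<in> V" "f' \<in> group_algebra G" by (auto simp: W_def)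
      have xy: "x + y = (v + v') + act (\<lambda>x. f x + f' x) (a m)"
        by (simp add: * act_add_left algebra_simps)
      show "x + y \<in> W"
        unfolding xy by (intro WI group_algebra_add) (use * V(1) in \<open>auto simp: submodule_def\<close>)
    next
      fix k x assume "x \<in> W"
      then obtain v f where *: "x = v + act f (a m)" "v \<in> V" "f \<in> group_algebra G" by (auto simp: W_def)
      have kx: "sc k x = sc k v + act (\<lambda>x. k * f x) (a m)"
        by (simp add: * act_scale_left scale_right_distrib)
      show "sc k x \<in> W"
        unfolding kx by (intro WI group_algebra_scale) (use * V(1) in \<open>auto simp: submodule_def\<close>)
    next
      fix g x assume g: "g \<in> carrier G" and "x \<in> W"
      then obtain v f where *: "x = v + act f (a m)" "v \<in> V" "f \<in> group_algebra G" by (auto simp: W_def)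
      have gx: "lam g x = lam g v + act (convolution G (point_mass g 1) f) (a m)"
        by (simp add: * act_convolution group_algebra_point_mass g lam_add act_point_mass)
      show "lam g x \<in> W"
        unfolding gx by (intro WI group_algebra_convolution group_algebra_point_mass g)
          (use * V(1) g in \<open>auto simp: submodule_def\<close>)
    qed
    moreover have "\<forall>i<Suc m. a i \<in> W"
      using V(2) VW amW by (auto simp: less_Suc_eq)
    moreover have "0 \<le> Re (vform n F a')" if "\<forall>i. a' i \<in> W" for a'
    proof -
      have "\<forall>i. \<exists>v f. a' i = v + act f (a m) \<and> v \<in> V \<and> f \<in> group_algebra G"
        using that by (auto simp: W_def)
      then obtain v f where *: "\<And>i. a' i = v i + act (f i) (a m)" "\<And>i. v i \<in> V" "\<And>i. f i \<in> group_algebra G"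
        by metis
      have "a' = (\<lambda>i. v i + act (f i) (a m))" using *(1) by blast
      then show ?thesis
        using vform_extend[OF u F pos *(3) V(1) V(3) *(2)] by simp
    qed
    ultimately show ?case by blast
  qed
  from this[of n] obtain V where V: "submodule V" "\<And>i. i < n \<Longrightarrow> a i \<in> V"
      "\<And>a'. (\<And>i. a' i \<in> V) \<Longrightarrow> 0 \<le> Re (vform n F a')" by blast
  \<comment> \<open>The hypothesis on \<open>V\<close> concerns families indexed by all naturals;
    beyond \<open>n\<close> they are filled with zeros.\<close>
  have "0 \<le> Re (vform n F (\<lambda>i. if i < n then a i else 0))"
    using V by (intro V(3)) (auto simp: submodule_def)
  also have "vform n F (\<lambda>i. if i < n then a i else 0) = vform n F a"
    by (simp add: vform_def)
  finally show ?thesis .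
qed

end

section \<open>Positive definite functions\<close>

definition pscale :: "complex \<Rightarrow> ('g \<Rightarrow>\<^sub>0 'h::chilbert_space) \<Rightarrow> ('g \<Rightarrow>\<^sub>0 'h)" where
  "pscale c = Poly_Mapping.map (\<lambda>v. c *\<^sub>C v)"

lemma lookup_pscale: "Poly_Mapping.lookup (pscale c p) x = c *\<^sub>C Poly_Mapping.lookup p x"
  by (simp add: pscale_def Poly_Mapping.map.rep_eq when_def scaleC_zero_right)

lemma module_pscale: "module (pscale :: complex \<Rightarrow> ('g \<Rightarrow>\<^sub>0 'h::chilbert_space) \<Rightarrow> _)"
proof
  fix a b :: complex and x y :: "'g \<Rightarrow>\<^sub>0 'h"
  show "pscale a (x + y) = pscale a x + pscale a y" "pscale (a + b) x = pscale a x + pscale b x"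
    "pscale a (pscale b x) = pscale (a * b) x" "pscale 1 x = x"
    by (rule poly_mapping_eqI, simp add: lookup_pscale lookup_add scaleC_add_right scaleC_add_left scaleC_scaleC)+
qed

text \<open>The sesquilinear form of an operator kernel on finitely supported vector-valued
  functions. The first index of \<open>k\<close> belongs to the conjugate-linear argument, in
  accordance with kernels of the form \<open>\<Psi> (inv h \<otimes> g)\<close>.\<close>

definition kform :: "('g \<Rightarrow> 'g \<Rightarrow> 'h::chilbert_space bop) \<Rightarrow> ('g \<Rightarrow>\<^sub>0 'h) \<Rightarrow> ('g \<Rightarrow>\<^sub>0 'h) \<Rightarrow> complex" where
  "kform k p q = (\<Sum>g\<in>Poly_Mapping.keys p. \<Sum>h\<in>Poly_Mapping.keys q.
     cinner (bapp (k h g) (Poly_Mapping.lookup p g)) (Poly_Mapping.lookup q h))"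

lemma kform_superset:
  assumes "finite S" "finite T" "Poly_Mapping.keys p \<subseteq> S" "Poly_Mapping.keys q \<subseteq> T"
  shows "kform k p q = (\<Sum>g\<in>S. \<Sum>h\<in>T.
     cinner (bapp (k h g) (Poly_Mapping.lookup p g)) (Poly_Mapping.lookup q h))"
proof -
  have "kform k p q = (\<Sum>g\<in>Poly_Mapping.keys p. \<Sum>h\<in>T.
     cinner (bapp (k h g) (Poly_Mapping.lookup p g)) (Poly_Mapping.lookup q h))"
    unfolding kform_def by (intro sum.cong sum.mono_neutral_left assms refl) (simp add: in_keys_iff)
  also have "\<dots> = (\<Sum>g\<in>S. \<Sum>h\<in>T.
     cinner (bapp (k h g) (Poly_Mapping.lookup p g)) (Poly_Mapping.lookup q h))"
    by (intro sum.mono_neutral_left assms) (simp add: in_keys_iff)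
  finally show ?thesis .
qed

lemma kform_add: "kform k (p + q) r = kform k p r + kform k q r"
proof -
  let ?S = "Poly_Mapping.keys p \<union> Poly_Mapping.keys q"
  have "Poly_Mapping.keys (p + q) \<subseteq> ?S" by (rule Poly_Mapping.keys_add)
  then show ?thesis
    using kform_superset[of ?S "Poly_Mapping.keys r" _ r k]
    by (simp add: lookup_add bapp_add cinner_add_left sum.distrib)
qed

lemma kform_pscale: "kform k (pscale c p) r = c * kform k p r"
proof -
  have "Poly_Mapping.keys (pscale c p) \<subseteq> Poly_Mapping.keys p"
    by (auto simp: in_keys_iff lookup_pscale scaleC_zero_right)
  then show ?thesis
    using kform_superset[of "Poly_Mapping.keys p" "Poly_Mapping.keys r" "pscale c p" r k]
    by (simp add: kform_def lookup_pscale bapp_scaleC cinner_scaleC_left sum_distrib_left)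
qed

lemma kform_commute:
  assumes "\<And>g h. k h g = adj (k g h)"
  shows "kform k p q = cnj (kform k q p)"
proof -
  have "cinner (bapp (adj T) x) y = cnj (cinner (bapp T y) x)" for T :: "'b bop" and x y
    unfolding cinner_adj_left[symmetric] by (rule cinner_commute)
  then have *: "cnj (cinner (bapp (k g h) y) x) = cinner (bapp (k h g) x) y" for g h x y
    by (simp add: assms[of h g])
  show ?thesis
    unfolding kform_def cnj_sum * by (rule sum.swap)
qed

lemma hermitian_form_kform:
  assumes "\<And>g h. k h g = adj (k g h)"
  shows "hermitian_form pscale (kform k)"
  by (intro hermitian_form.intro module_pscale kform_add kform_pscale kform_commute assms)

lemma kform_single: "kform k (Poly_Mapping.single g x) (Poly_Mapping.single h y) = cinner (bapp (k h g) x) y"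
  using kform_superset[of "{g}" "{h}" "Poly_Mapping.single g x" "Poly_Mapping.single h y" k] by simp

text \<open>The first conjunct makes the kernel Hermitian, so the sums in the second are real and a
  condition on their real parts is full positive definiteness.\<close>

definition posdef :: "('g, 'm) monoid_scheme \<Rightarrow> ('g \<Rightarrow> 'h::chilbert_space bop) \<Rightarrow> bool" where
  "posdef G \<Psi> \<longleftrightarrow> (\<forall>x\<in>carrier G. \<Psi> (inv\<^bsub>G\<^esub> x) = adj (\<Psi> x)) \<and>
     (\<forall>S \<xi>. finite S \<longrightarrow> S \<subseteq> carrier G \<longrightarrow>
        0 \<le> Re (\<Sum>g\<in>S. \<Sum>h\<in>S. cinner (bapp (\<Psi> (inv\<^bsub>G\<^esub> h \<otimes>\<^bsub>G\<^esub> g)) (\<xi> g)) (\<xi> h)))"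

lemma (in group) unitary_rep_posdef:
  assumes u: "unitary_rep G u"
  shows "posdef G u"
  unfolding posdef_def
proof (intro conjI ballI allI impI)
  fix S \<xi> assume S: "finite S" "S \<subseteq> carrier G"
  have "cinner (bapp (u (inv h \<otimes> g)) (\<xi> g)) (\<xi> h) = cinner (bapp (u g) (\<xi> g)) (bapp (u h) (\<xi> h))"
    if "g \<in> S" "h \<in> S" for g h
    using that S by (simp add: subset_iff unitary_rep_mult[OF u] unitary_rep_inv[OF u] bapp_simps cinner_adj)
  then have "(\<Sum>g\<in>S. \<Sum>h\<in>S. cinner (bapp (u (inv h \<otimes> g)) (\<xi> g)) (\<xi> h)) =
      cinner (\<Sum>g\<in>S. bapp (u g) (\<xi> g)) (\<Sum>h\<in>S. bapp (u h) (\<xi> h))"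
    by (simp add: hilb.B_sum hilb.B_sum_right cong: sum.cong) (rule sum.swap)
  then show "0 \<le> Re (\<Sum>g\<in>S. \<Sum>h\<in>S. cinner (bapp (u (inv h \<otimes> g)) (\<xi> g)) (\<xi> h))"
    by (simp add: hilb.B_self)
qed (use u in \<open>simp add: unitary_rep_inv\<close>)

text \<open>The Naimark dilation of a positive definite function, left as a degenerate inner product
  space: there is no type for its completion.\<close>

lemma (in group) posdef_dilation:
  fixes \<Psi> :: "'a \<Rightarrow> 'h::chilbert_space bop"
  assumes \<Psi>: "posdef G \<Psi>"
  defines "k \<equiv> \<lambda>h g. if g \<in> carrier G \<and> h \<in> carrier G then \<Psi> (inv h \<otimes> g) else 0"
  defines "s \<equiv> \<lambda>x y. if y \<in> carrier G then x \<otimes> y else y"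
  defines "lam \<equiv> \<lambda>x. Poly_Mapping.map_key (s (inv x))"
  shows "prehilbert_rep pscale (kform k) G lam"
    and "x \<in> carrier G \<Longrightarrow> lam x (Poly_Mapping.single \<one> \<xi>) = Poly_Mapping.single x \<xi>"
proof -
  \<comment> \<open>Outside the carrier \<open>s x\<close> is the identity, so that for
    \<open>x\<close> in the group it is a bijection of the whole type; \<open>map_key\<close> asks
    for an injective map.\<close>
  have s_s: "s (x \<otimes> y) z = s x (s y z)" if "x \<in> carrier G" "y \<in> carrier G" for x y z
    using that by (auto simp: s_def m_assoc)
  have s_one: "s \<one> z = z" for z by (simp add: s_def)
  have s_inv: "s (inv x) (s x z) = z" "s x (s (inv x) z) = z" if "x \<in> carrier G" for x z
    using that by (simp_all add: s_s[symmetric] s_one)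
  have inj: "inj (s x)" if "x \<in> carrier G" for x
    by (rule inj_on_inverseI[of _ "s (inv x)"]) (simp add: s_inv that)
  have lookup: "Poly_Mapping.lookup (lam x p) z = Poly_Mapping.lookup p (s (inv x) z)"
    if "x \<in> carrier G" for x p z
    using that by (simp add: lam_def map_key.rep_eq inj)
  have k_s: "k (s x h) (s x g) = k h g" if "x \<in> carrier G" for x g h
  proof -
    have "inv (x \<otimes> h) \<otimes> (x \<otimes> g) = inv h \<otimes> g" if "g \<in> carrier G" "h \<in> carrier G"
    proof -
      have "inv (x \<otimes> h) \<otimes> (x \<otimes> g) = inv h \<otimes> ((inv x \<otimes> x) \<otimes> g)"
        using that \<open>x \<in> carrier G\<close> by (simp only: inv_mult_group m_assoc inv_closed m_closed)
      then show ?thesis using that \<open>x \<in> carrier G\<close> by simp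
    qed
    then show ?thesis using that by (auto simp: k_def s_def)
  qed
  have k_adj: "k h g = adj (k g h)" for g h
  proof (cases "g \<in> carrier G \<and> h \<in> carrier G")
    case True
    then have "\<Psi> (inv (inv g \<otimes> h)) = adj (\<Psi> (inv g \<otimes> h))"
      using \<Psi> by (simp add: posdef_def)
    with True show ?thesis by (simp add: k_def inv_mult_group)
  qed (auto simp: k_def)
  have keys_lam: "Poly_Mapping.keys (lam x p) = s x ` Poly_Mapping.keys p" if "x \<in> carrier G" for x p
  proof -
    have "Poly_Mapping.keys (lam x p) = s (inv x) -` Poly_Mapping.keys p"
      using that by (simp add: lam_def keys_map_key inj)
    also have "\<dots> = s x ` Poly_Mapping.keys p"
      using s_inv[OF that] by (auto simp: image_iff) metis
    finally show ?thesis .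
  qed
  show "prehilbert_rep pscale (kform k) G lam"
  proof (intro prehilbert_rep.intro prehilbert.intro prehilbert_axioms.intro prehilbert_rep_axioms.intro)
    show "hermitian_form (pscale :: complex \<Rightarrow> ('a \<Rightarrow>\<^sub>0 'h) \<Rightarrow> _) (kform k)"
      by (rule hermitian_form_kform) (rule k_adj)
    show "group G" by (rule is_group)
    fix p q r :: "'a \<Rightarrow>\<^sub>0 'h" and c
    show "0 \<le> Re (kform k p p)"
    proof -
      let ?S = "Poly_Mapping.keys p \<inter> carrier G"
      have "kform k p p = (\<Sum>g\<in>?S. \<Sum>h\<in>?S. cinner (bapp (k h g) (Poly_Mapping.lookup p g)) (Poly_Mapping.lookup p h))"
        unfolding kform_def
        by (rule sum.mono_neutral_cong_right; (intro sum.mono_neutral_right)?) (auto simp: k_def bapp_simps)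
      also have "\<dots> = (\<Sum>g\<in>?S. \<Sum>h\<in>?S. cinner (bapp (\<Psi> (inv h \<otimes> g)) (Poly_Mapping.lookup p g)) (Poly_Mapping.lookup p h))"
        by (intro sum.cong) (auto simp: k_def)
      also have "0 \<le> Re \<dots>" using \<Psi> by (simp add: posdef_def)
      finally show ?thesis .
    qed
    show "lam \<one> p = p"
      by (rule poly_mapping_eqI) (simp add: lookup s_one)
    fix x assume x: "x \<in> carrier G"
    show "lam x (p + q) = lam x p + lam x q" "lam x (pscale c p) = pscale c (lam x p)"
      by (rule poly_mapping_eqI, simp add: lookup x lookup_add lookup_pscale)+
    show "kform k (lam x p) (lam x q) = kform k p q"
      unfolding kform_def keys_lam[OF x]
      by (simp add: sum.reindex inj_on_subset[OF inj[OF x]] k_s x lookup s_inv)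
    fix y assume y: "y \<in> carrier G"
    show "lam (x \<otimes> y) p = lam x (lam y p)"
      by (rule poly_mapping_eqI) (simp add: lookup x y inv_mult_group s_s)
  qed
  show "lam x (Poly_Mapping.single \<one> \<xi>) = Poly_Mapping.single x \<xi>" if x: "x \<in> carrier G"
  proof -
    have "\<one> = s (inv x) z \<longleftrightarrow> x = z" for z
      using x by (auto simp: s_def inv_solve_left)
    then show ?thesis
      by (intro poly_mapping_eqI) (auto simp: lookup x lookup_single when_def)
  qed
qed

text \<open>In the dilation \<open>\<Psi> x\<close> is the compression of translation by
  \<open>x\<close> to the vectors supported at the unit. At such vectors \<open>vform\<close> is
  therefore the form of the matrix \<open>ev \<Psi> (F i j)\<close>, and \<open>vform_nonneg\<close>
  applies.\<close>

theorem (in group) full_group_rep_dominates: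
  fixes \<Psi> :: "'a \<Rightarrow> 'h::chilbert_space bop"
  assumes u: "is_full_group_rep G u" and \<Psi>: "posdef G \<Psi>"
  shows "dominates G u \<Psi>"
  unfolding dominates_def
proof (intro allI impI)
  fix n and F :: "nat \<Rightarrow> nat \<Rightarrow> 'a \<Rightarrow> complex"
  assume F: "\<forall>i j. F i j \<in> group_algebra G" and pos: "rpos n (\<lambda>i j. ev u (F i j))"
  define k where "k = (\<lambda>h g. if g \<in> carrier G \<and> h \<in> carrier G then \<Psi> (inv h \<otimes> g) else 0)"
  define lam :: "'a \<Rightarrow> ('a \<Rightarrow>\<^sub>0 'h) \<Rightarrow> ('a \<Rightarrow>\<^sub>0 'h)" where
    "lam = (\<lambda>x. Poly_Mapping.map_key ((\<lambda>x y. if y \<in> carrier G then x \<otimes> y else y) (inv x)))"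
  interpret prehilbert_rep pscale "kform k" G lam
    unfolding k_def lam_def by (rule posdef_dilation(1)[OF \<Psi>])
  have lam: "lam x (Poly_Mapping.single \<one> \<xi>) = Poly_Mapping.single x \<xi>" if "x \<in> carrier G" for x \<xi>
    unfolding lam_def using that by (rule posdef_dilation(2)[OF \<Psi>])
  show "rpos n (\<lambda>i j. ev \<Psi> (F i j))"
    unfolding rpos_def
  proof
    fix \<xi> :: "nat \<Rightarrow> 'h"
    let ?a = "\<lambda>i. Poly_Mapping.single \<one> (\<xi> i)"
    have k1: "k \<one> x = \<Psi> x" if "x \<in> carrier G" for x using that by (simp add: k_def)
    have "kform k (act f (?a j)) (?a i) = cinner (bapp (ev \<Psi> f) (\<xi> j)) (\<xi> i)"
      if f: "f \<in> group_algebra G" for f i j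
      using group_algebra_carrier[OF f]
      by (simp add: act_def fsum_def B_sum B_sc lam kform_single bapp_sum bapp_simps hilb.B_sum
          cinner_scaleC_left k1)
    then have "form n (\<lambda>i j. ev \<Psi> (F i j)) \<xi> = vform n F ?a"
      using F by (simp add: form_def vform_def)
    then show "0 \<le> Re (form n (\<lambda>i j. ev \<Psi> (F i j)) \<xi>)"
      using vform_nonneg[OF u _ pos, of ?a] F by simp
  qed
qed

section \<open>Free products of groups\<close>

locale free_product_of_groups =
  fixes I :: "'i set" and G :: "'i \<Rightarrow> 'g monoid"
  assumes factor_group: "i \<in> I \<Longrightarrow> group (G i)"
begin

abbreviation "W \<equiv> reduced_words I G"
abbreviation "FP \<equiv> free_product I G"

lemma carrier_FP: "carrier FP = W"
  and one_FP: "\<one>\<^bsub>FP\<^esub> = []"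
  and mult_FP: "v \<otimes>\<^bsub>FP\<^esub> w = foldr (word_cons G) v w"
  by (simp_all add: free_product_def)

lemma W_Nil: "[] \<in> W"
  by (simp add: reduced_words_def)

lemma W_Cons: "(i, g) # w \<in> W \<longleftrightarrow>
    i \<in> I \<and> g \<in> carrier (G i) \<and> g \<noteq> \<one>\<^bsub>G i\<^esub> \<and> w \<in> W \<and> (w = [] \<or> fst (hd w) \<noteq> i)"
  by (cases w) (auto simp: reduced_words_def)

lemma W_append: "v @ w \<in> W \<longleftrightarrow> v \<in> W \<and> w \<in> W \<and> (v = [] \<or> w = [] \<or> fst (last v) \<noteq> fst (hd w))"
  by (auto simp: reduced_words_def distinct_adj_append_iff last_map hd_map)

lemma word_cons_reduced: "(i, g) # w \<in> W \<Longrightarrow> word_cons G (i, g) w = (i, g) # w"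
  by (cases w) (auto simp: W_Cons)

lemma word_cons_closed:
  assumes "i \<in> I" "g \<in> carrier (G i)" "w \<in> W"
  shows "word_cons G (i, g) w \<in> W"
proof (cases w)
  case (Cons p w')
  obtain j h where p: "p = (j, h)" by force
  interpret group "G i" by (rule factor_group) fact
  show ?thesis
  proof (cases "i = j")
    case True
    show ?thesis
      using assms unfolding Cons p True[symmetric] by (auto simp: W_Cons)
  next
    case False
    then show ?thesis
      using assms unfolding Cons p by (auto simp: W_Cons)
  qed
qed (use assms in \<open>auto simp: W_Cons W_Nil\<close>)

text \<open>Each factor acts on the set of reduced words from the left. As in van der Waerden's
  construction, associativity of the free product is deduced from these actions instead of from an
  analysis of cancellation between two long words.\<close>

lemma word_cons_mult:
  assumes i: "i \<in> I" and g: "g \<in> carrier (G i)" and h: "h \<in> carrier (G i)" and w: "w \<in> W"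
  shows "word_cons G (i, g) (word_cons G (i, h) w) = word_cons G (i, g \<otimes>\<^bsub>G i\<^esub> h) w"
proof -
  interpret group "G i" by (rule factor_group) fact
  show ?thesis
  proof (cases w)
    case Nil
    show ?thesis unfolding Nil using g h by auto
  next
    case (Cons p w')
    obtain j c where p: "p = (j, c)" by force
    show ?thesis
    proof (cases "i = j")
      case False
      with g h show ?thesis unfolding Cons p by auto
    next
      case True
      with w have c: "c \<in> carrier (G i)" "c \<noteq> \<one>\<^bsub>G i\<^esub>" "w' = [] \<or> fst (hd w') \<noteq> i"
        unfolding Cons p by (auto simp: W_Cons)
      have w': "word_cons G (i, a) w' = (if a = \<one>\<^bsub>G i\<^esub> then w' else (i, a) # w')" for a
        using c(3) by (cases w') auto
      have assoc: "g \<otimes>\<^bsub>G i\<^esub> h \<otimes>\<^bsub>G i\<^esub> c = g \<otimes>\<^bsub>G i\<^esub> (h \<otimes>\<^bsub>G i\<^esub> c)"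
        using g h c by (simp add: m_assoc)
      have wi: "w = (i, c) # w'" by (simp add: Cons p True)
      show ?thesis
      proof (cases "h \<otimes>\<^bsub>G i\<^esub> c = \<one>\<^bsub>G i\<^esub>")
        case hc: True
        have "g \<otimes>\<^bsub>G i\<^esub> h = \<one>\<^bsub>G i\<^esub> \<longleftrightarrow> g = c"
          using assoc hc g h c(1) inv_comm[OF hc h c(1)] by auto
        with hc show ?thesis
          unfolding wi using g h c assoc by (auto simp: w')
      next
        case hc: False
        consider "h = \<one>\<^bsub>G i\<^esub>" | "h \<noteq> \<one>\<^bsub>G i\<^esub>" "g = \<one>\<^bsub>G i\<^esub>"
          | "h \<noteq> \<one>\<^bsub>G i\<^esub>" "g \<noteq> \<one>\<^bsub>G i\<^esub>" "g \<otimes>\<^bsub>G i\<^esub> h = \<one>\<^bsub>G i\<^esub>"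
          | "h \<noteq> \<one>\<^bsub>G i\<^esub>" "g \<noteq> \<one>\<^bsub>G i\<^esub>" "g \<otimes>\<^bsub>G i\<^esub> h \<noteq> \<one>\<^bsub>G i\<^esub>" by blast
        then show ?thesis
        proof cases
          case 3
          then have "g \<otimes>\<^bsub>G i\<^esub> (h \<otimes>\<^bsub>G i\<^esub> c) = c" using assoc c by simp
          with 3 hc c show ?thesis unfolding wi by simp
        qed (use g h c hc assoc in \<open>simp_all add: wi\<close>)
      qed
    qed
  qed
qed

lemma W_ConsD: "p # w \<in> W \<Longrightarrow> w \<in> W"
  by (cases p) (simp add: W_Cons)

lemma mult_closed: "v \<in> W \<Longrightarrow> w \<in> W \<Longrightarrow> foldr (word_cons G) v w \<in> W"
proof (induction v)
  case (Cons p v)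
  then show ?case by (cases p) (auto simp: W_Cons intro!: word_cons_closed)
qed simp

lemma mult_append: "v @ w \<in> W \<Longrightarrow> foldr (word_cons G) v w = v @ w"
proof (induction v)
  case (Cons p v)
  then show ?case
    using W_ConsD[of p "v @ w"] by (cases p) (simp add: word_cons_reduced del: word_cons.simps)
qed simp

lemma mult_word_cons:
  assumes "i \<in> I" "g \<in> carrier (G i)" "v \<in> W" "w \<in> W"
  shows "foldr (word_cons G) (word_cons G (i, g) v) w = word_cons G (i, g) (foldr (word_cons G) v w)"
proof -
  interpret group "G i" by (rule factor_group) fact
  have one: "word_cons G (k, \<one>\<^bsub>G k\<^esub>) u = u" for k u by (cases u) auto
  show ?thesis
  proof (cases v)
    case Nil
    then show ?thesis by (simp add: one)
  next
    case (Cons p v')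
    obtain j c where p: "p = (j, c)" by force
    have c: "j \<in> I" "c \<in> carrier (G j)" "v' \<in> W"
      using assms(3) unfolding Cons p by (auto simp: W_Cons)
    have "word_cons G (i, g) (word_cons G (j, c) (foldr (word_cons G) v' w)) =
        word_cons G (i, g \<otimes>\<^bsub>G i\<^esub> c) (foldr (word_cons G) v' w)" if "i = j"
      using that assms c by (simp add: word_cons_mult mult_closed del: word_cons.simps)
    then show ?thesis
      unfolding Cons p by (auto simp: one)
  qed
qed

lemma mult_assoc:
  assumes "u \<in> W" "v \<in> W" "w \<in> W"
  shows "foldr (word_cons G) (foldr (word_cons G) u v) w = foldr (word_cons G) u (foldr (word_cons G) v w)"
  using assms(1)
proof (induction u)
  case (Cons p u)
  obtain i g where p: "p = (i, g)" by force
  with Cons show ?case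
    using assms(2,3) by (simp add: mult_word_cons mult_closed W_Cons del: word_cons.simps)
qed simp

section \<open>Inverses and cancellation of reduced words\<close>

definition inv_word :: "('i \<times> 'g) list \<Rightarrow> ('i \<times> 'g) list" where
  "inv_word w = rev (map (\<lambda>(i, g). (i, inv\<^bsub>G i\<^esub> g)) w)"

lemma inv_word_simps [simp]: "inv_word [] = []" "inv_word ((i, g) # w) = inv_word w @ [(i, inv\<^bsub>G i\<^esub> g)]"
  by (simp_all add: inv_word_def)

lemma inv_word_eq_Nil [simp]: "inv_word w = [] \<longleftrightarrow> w = []"
  by (simp add: inv_word_def)

lemma inv_letter:
  assumes "i \<in> I" "g \<in> carrier (G i)" "g \<noteq> \<one>\<^bsub>G i\<^esub>"
  shows "inv\<^bsub>G i\<^esub> g \<in> carrier (G i)" "inv\<^bsub>G i\<^esub> g \<noteq> \<one>\<^bsub>G i\<^esub>"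
proof -
  interpret group "G i" by (rule factor_group) fact
  show "inv\<^bsub>G i\<^esub> g \<in> carrier (G i)" "inv\<^bsub>G i\<^esub> g \<noteq> \<one>\<^bsub>G i\<^esub>" using assms by auto
qed

lemma last_inv_word: "w \<noteq> [] \<Longrightarrow> fst (last (inv_word w)) = fst (hd w)"
  by (cases w) (auto simp: inv_word_def)

lemma inv_word_closed: "w \<in> W \<Longrightarrow> inv_word w \<in> W"
proof (induction w)
  case (Cons p w)
  obtain i g where p: "p = (i, g)" by force
  show ?case
    using Cons inv_letter[of i g] by (auto simp: p W_append W_Cons W_Nil last_inv_word)
qed (simp add: W_Nil)

lemma mult_inv_word: "w \<in> W \<Longrightarrow> foldr (word_cons G) (inv_word w) w = []"
proof (induction w)
  case (Cons p w)
  obtain i g where p: "p = (i, g)" by force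
  with Cons.prems have g: "i \<in> I" "g \<in> carrier (G i)" "g \<noteq> \<one>\<^bsub>G i\<^esub>" "w \<in> W" by (auto simp: W_Cons)
  interpret group "G i" by (rule factor_group) fact
  show ?case
    using Cons.IH g inv_letter[of i g] by (simp add: p)
qed simp

lemma group_FP: "group FP"
proof (rule groupI)
  fix x assume x: "x \<in> carrier FP"
  then show "\<exists>y\<in>carrier FP. y \<otimes>\<^bsub>FP\<^esub> x = \<one>\<^bsub>FP\<^esub>"
    by (intro bexI[of _ "inv_word x"]) (simp_all add: carrier_FP mult_FP one_FP mult_inv_word inv_word_closed)
qed (auto simp: carrier_FP mult_FP one_FP W_Nil mult_closed mult_assoc)

lemma inv_FP:
  assumes "w \<in> W"
  shows "inv\<^bsub>FP\<^esub> w = inv_word w"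
proof -
  interpret group FP by (rule group_FP)
  show ?thesis
    using assms by (intro inv_equality) (simp_all add: carrier_FP mult_FP one_FP mult_inv_word inv_word_closed)
qed

text \<open>The bound on the length of \<open>w\<close> and the last hypothesis prevent cancellation from exposing a
  letter of \<open>w\<close> in the factor \<open>i\<close>.\<close>

lemma last_letter_mult_inv_word:
  assumes "v @ [(i, b)] \<in> W" "w \<in> W" "length w \<le> Suc (length v)" "\<And>c. w \<noteq> v @ [(i, c)]"
  shows "foldr (word_cons G) (inv_word w) v = [] \<or> fst (last (foldr (word_cons G) (inv_word w) v)) \<noteq> i"
  using assms
proof (induction w arbitrary: v)
  case Nil
  then show ?case by (auto simp: W_append)
next
  case (Cons p w)
  obtain j c where p: "p = (j, c)" by force
  have c: "j \<in> I" "c \<in> carrier (G j)" "c \<noteq> \<one>\<^bsub>G j\<^esub>" "w \<in> W" "w = [] \<or> fst (hd w) \<noteq> j"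
    using Cons.prems(2) by (auto simp: p W_Cons)
  interpret group "G j" by (rule factor_group) fact
  have ci: "inv\<^bsub>G j\<^esub> c \<in> carrier (G j)" "inv\<^bsub>G j\<^esub> c \<noteq> \<one>\<^bsub>G j\<^esub>" using c by (auto intro: inv_letter)
  have wi: "inv_word w @ u \<in> W" if "u \<in> W" "u \<noteq> []" "fst (hd u) = j" for u
    using that c inv_word_closed[OF c(4)] by (auto simp: W_append last_inv_word)
  show ?case
  proof (cases v)
    case Nil
    \<comment> \<open>For empty \<open>v\<close> the length bound leaves a single letter of the
      word, and the last hypothesis excludes the factor \<open>i\<close> for it.\<close>
    then have "w = []" "j \<noteq> i" using Cons.prems by (auto simp: p)
    then show ?thesis using ci Nil by (simp add: p)
  next
    case (Cons q v')
    obtain l a where q: "q = (l, a)" by force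
    have vW: "v \<in> W" "fst (last v) \<noteq> i"
      using Cons.prems(1) list.distinct(2)[of q v', folded Cons] by (auto simp: W_append)
    have a: "l \<in> I" "a \<in> carrier (G l)" "a \<noteq> \<one>\<^bsub>G l\<^esub>" "v' \<in> W" "v' = [] \<or> fst (hd v') \<noteq> l"
      using vW unfolding Cons q by (auto simp: W_Cons)
    have red: "foldr (word_cons G) (inv_word w) u = inv_word w @ u"
      if "u \<in> W" "u \<noteq> []" "fst (hd u) = j" for u
      using wi[OF that] by (rule mult_append)
    show ?thesis
    proof (cases "j = l")
      case False
      have "(j, inv\<^bsub>G j\<^esub> c) # v \<in> W"
        using False ci c vW by (simp add: W_Cons Cons q)
      from red[OF this] show ?thesis
        using False ci vW by (simp add: p Cons q split: if_splits)
    next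
      case True
      show ?thesis
      proof (cases "inv\<^bsub>G j\<^esub> c \<otimes>\<^bsub>G j\<^esub> a = \<one>\<^bsub>G j\<^esub>")
        \<comment> \<open>Equal first letters cancel, and the two tails satisfy the hypotheses
          again.\<close>
        case e: True
        have aj: "a \<in> carrier (G j)" using a(2) True by simp
        have ca: "a = c"
          using inv_solve_left[of "\<one>\<^bsub>G j\<^esub>" c a] e aj c(2) by simp
        have "foldr (word_cons G) (inv_word w) v' = [] \<or> fst (last (foldr (word_cons G) (inv_word w) v')) \<noteq> i"
        proof (rule Cons.IH)
          show "v' @ [(i, b)] \<in> W" using Cons.prems(1) W_ConsD unfolding Cons by auto
          show "w \<noteq> v' @ [(i, c)]" for c
            using Cons.prems(4)[of c] ca True by (auto simp: p Cons q)
        qed (use Cons.prems(3) c Cons in auto)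
        then show ?thesis using e True ci by (simp add: p Cons q)
      next
        \<comment> \<open>Different letters of one factor merge into one nontrivial letter, which
          blocks any further cancellation.\<close>
        case e: False
        have "(j, inv\<^bsub>G j\<^esub> c \<otimes>\<^bsub>G j\<^esub> a) # v' \<in> W"
        proof -
          have "a \<in> carrier (G j)" using True a(2) by simp
          then have "inv\<^bsub>G j\<^esub> c \<otimes>\<^bsub>G j\<^esub> a \<in> carrier (G j)" using ci(1) by simp
          with True c(1) a(4,5) e show ?thesis unfolding W_Cons by metis
        qed
        from red[OF this] show ?thesis
          using e True ci vW(2) by (auto simp: p Cons q)
      qed
    qed
  qed
qed

end

section \<open>Boca's theorem for groups\<close>

lemma kform_keys_right:
  "kform k p q = (\<Sum>h\<in>Poly_Mapping.keys q. kform k p (Poly_Mapping.single h (Poly_Mapping.lookup q h)))"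
proof -
  have "kform k p (Poly_Mapping.single h y) =
      (\<Sum>g\<in>Poly_Mapping.keys p. cinner (bapp (k h g) (Poly_Mapping.lookup p g)) y)" for h y
    using kform_superset[of "Poly_Mapping.keys p" "{h}" p "Poly_Mapping.single h y" k] by simp
  then show ?thesis
    by (simp only: kform_def) (rule sum.swap)
qed

text \<open>This is positivity of a Schur complement: the kernel of \<open>\<phi>\<close> is
  evaluated on \<open>T\<close> together with the unit, and the coefficient at the unit is chosen to
  minimize the form.\<close>

lemma posdef_centered:
  assumes "group G" and \<phi>: "posdef G \<phi>" and one: "\<phi> \<one>\<^bsub>G\<^esub> = 1"
    and T: "finite T" "T \<subseteq> carrier G" "\<one>\<^bsub>G\<^esub> \<notin> T"
  shows "0 \<le> Re (\<Sum>c\<in>T. \<Sum>c'\<in>T. cinner (bapp (\<phi> (inv\<^bsub>G\<^esub> c' \<otimes>\<^bsub>G\<^esub> c) - adj (\<phi> c') * \<phi> c) (\<xi> c)) (\<xi> c'))"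
proof -
  interpret group G by fact
  define s where "s = (\<Sum>c\<in>T. bapp (\<phi> c) (\<xi> c))"
  \<comment> \<open>The minimizing coefficient at the unit is \<open>- s\<close>; the two mixed sums
    then each equal \<open>- cinner s s\<close>, and one copy of \<open>- cinner s s\<close> is left
    over.\<close>
  define \<eta> where "\<eta> c = (if c = \<one>\<^bsub>G\<^esub> then - s else \<xi> c)" for c
  let ?k = "\<lambda>c c'. cinner (bapp (\<phi> (inv\<^bsub>G\<^esub> c' \<otimes>\<^bsub>G\<^esub> c)) (\<eta> c)) (\<eta> c')"
  define Q where "Q = (\<Sum>c\<in>T. \<Sum>c'\<in>T. cinner (bapp (\<phi> (inv\<^bsub>G\<^esub> c' \<otimes>\<^bsub>G\<^esub> c)) (\<xi> c)) (\<xi> c'))"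
  have \<eta>: "\<eta> c = \<xi> c" if "c \<in> T" for c using that T(3) by (auto simp: \<eta>_def)
  have \<eta>1: "\<eta> \<one>\<^bsub>G\<^esub> = - s" by (simp add: \<eta>_def)
  have inv: "\<phi> (inv\<^bsub>G\<^esub> c) = adj (\<phi> c)" if "c \<in> T" for c
    using \<phi> that T by (auto simp: posdef_def)
  have r1: "(\<Sum>c\<in>T. ?k c \<one>\<^bsub>G\<^esub>) = - cinner s s"
  proof -
    have "(\<Sum>c\<in>T. ?k c \<one>\<^bsub>G\<^esub>) = (\<Sum>c\<in>T. cinner (bapp (\<phi> c) (\<xi> c)) (- s))"
      using T by (intro sum.cong refl) (auto simp: \<eta> \<eta>1 subset_iff)
    also have "\<dots> = cinner s (- s)" unfolding s_def by (rule hilb.B_sum[symmetric])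
    finally show ?thesis by (simp only: hilb.B_minus_right)
  qed
  have r2: "(\<Sum>c'\<in>T. ?k \<one>\<^bsub>G\<^esub> c') = - cinner s s"
  proof -
    have "(\<Sum>c'\<in>T. ?k \<one>\<^bsub>G\<^esub> c') = (\<Sum>c'\<in>T. cinner (- s) (bapp (\<phi> c') (\<xi> c')))"
      using T by (intro sum.cong refl) (auto simp: \<eta> \<eta>1 subset_iff inv cinner_adj_left)
    also have "\<dots> = cinner (- s) s" unfolding s_def by (rule hilb.B_sum_right[symmetric])
    finally show ?thesis by (simp only: hilb.B_minus)
  qed
  have "(\<Sum>c\<in>insert \<one>\<^bsub>G\<^esub> T. \<Sum>c'\<in>insert \<one>\<^bsub>G\<^esub> T. ?k c c') =
      ?k \<one>\<^bsub>G\<^esub> \<one>\<^bsub>G\<^esub> + (\<Sum>c'\<in>T. ?k \<one>\<^bsub>G\<^esub> c') + ((\<Sum>c\<in>T. ?k c \<one>\<^bsub>G\<^esub>) + (\<Sum>c\<in>T. \<Sum>c'\<in>T. ?k c c'))"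
    using T by (simp add: sum.distrib)
  also have "?k \<one>\<^bsub>G\<^esub> \<one>\<^bsub>G\<^esub> = cinner s s"
    by (simp add: \<eta>1 one bapp_simps hilb.B_minus hilb.B_minus_right)
  also have "(\<Sum>c\<in>T. \<Sum>c'\<in>T. ?k c c') = Q"
    unfolding Q_def by (intro sum.cong refl) (simp add: \<eta>)
  also have "cinner s s + (\<Sum>c'\<in>T. ?k \<one>\<^bsub>G\<^esub> c') + ((\<Sum>c\<in>T. ?k c \<one>\<^bsub>G\<^esub>) + Q) = Q - cinner s s"
    unfolding r1 r2 by simp
  also have "cinner s s = (\<Sum>c\<in>T. \<Sum>c'\<in>T. cinner (bapp (adj (\<phi> c') * \<phi> c) (\<xi> c)) (\<xi> c'))"
    unfolding s_def by (simp add: hilb.B_sum hilb.B_sum_right bapp_simps cinner_adj) (rule sum.swap)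
  also have "Q - \<dots> = (\<Sum>c\<in>T. \<Sum>c'\<in>T. cinner (bapp (\<phi> (inv\<^bsub>G\<^esub> c' \<otimes>\<^bsub>G\<^esub> c) - adj (\<phi> c') * \<phi> c) (\<xi> c)) (\<xi> c'))"
    by (simp add: Q_def bapp_simps hilb.B_diff sum_subtractf)
  finally have "(\<Sum>c\<in>insert \<one>\<^bsub>G\<^esub> T. \<Sum>c'\<in>insert \<one>\<^bsub>G\<^esub> T. ?k c c') = \<dots>" .
  moreover have "0 \<le> Re (\<Sum>c\<in>insert \<one>\<^bsub>G\<^esub> T. \<Sum>c'\<in>insert \<one>\<^bsub>G\<^esub> T. ?k c c')"
    using \<phi> T unfolding posdef_def by (elim conjE allE[of _ "insert \<one>\<^bsub>G\<^esub> T"] allE[of _ \<eta>]) auto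
  ultimately show ?thesis by simp
qed

definition word_map :: "('i \<Rightarrow> 'g \<Rightarrow> 'h::chilbert_space bop) \<Rightarrow> ('i \<times> 'g) list \<Rightarrow> 'h bop" where
  "word_map \<phi> v = foldr (\<lambda>(i, g) T. \<phi> i g * T) v 1"

lemma word_map_simps [simp]: "word_map \<phi> [] = 1" "word_map \<phi> ((i, g) # v) = \<phi> i g * word_map \<phi> v"
  by (simp_all add: word_map_def)

lemma word_map_append: "word_map \<phi> (v @ w) = word_map \<phi> v * word_map \<phi> w"
  by (induction v) (auto simp: mult.assoc)

locale free_product_maps = free_product_of_groups I G
  for I :: "'i set" and G :: "'i \<Rightarrow> 'g monoid" +
  fixes \<phi> :: "'i \<Rightarrow> 'g \<Rightarrow> 'h::chilbert_space bop"
  assumes \<phi>_one: "i \<in> I \<Longrightarrow> \<phi> i \<one>\<^bsub>G i\<^esub> = 1"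
    and \<phi>_posdef: "i \<in> I \<Longrightarrow> posdef (G i) (\<phi> i)"
begin

abbreviation "\<Psi> \<equiv> word_map \<phi>"

lemma \<phi>_inv: "i \<in> I \<Longrightarrow> g \<in> carrier (G i) \<Longrightarrow> \<phi> i (inv\<^bsub>G i\<^esub> g) = adj (\<phi> i g)"
  using \<phi>_posdef by (simp add: posdef_def)

lemma \<Psi>_inv_word: "w \<in> W \<Longrightarrow> \<Psi> (inv_word w) = adj (\<Psi> w)"
proof (induction w)
  case (Cons p w)
  obtain i g where p: "p = (i, g)" by force
  with Cons show ?case by (auto simp: word_map_append adj_mult \<phi>_inv W_Cons)
qed simp

text \<open>Boca's theorem for groups. Let \<open>v\<close> be a longest word in the support of \<open>p\<close> and let \<open>i\<close> be the
  factor of its last letter. Each word \<open>v' @ [(i, c)]\<close> of the support is split into its centered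
  part, which is orthogonal to all other words that occur, and a multiple of \<open>v'\<close>. The Gram matrix
  of the centered parts is a Schur complement of \<open>\<phi> i\<close>.\<close>

lemma kform_nonneg:
  defines "k \<equiv> \<lambda>h g. if g \<in> W \<and> h \<in> W then \<Psi> (foldr (word_cons G) (inv_word h) g) else 0"
  assumes "Poly_Mapping.keys p \<subseteq> W"
  shows "0 \<le> Re (kform k p p)"
  using assms(2)
\<comment> \<open>The total length of the support decreases, since all words
  \<open>v' @ [(i, c)]\<close> are traded for at most one new word, the shorter
  \<open>v'\<close>.\<close>
proof (induction "\<Sum>w\<in>Poly_Mapping.keys p. length w" arbitrary: p rule: less_induct)
  case less
  interpret FP: group FP by (rule group_FP)
  let ?K = "Poly_Mapping.keys p"
  have k: "k h g = \<Psi> (inv\<^bsub>FP\<^esub> h \<otimes>\<^bsub>FP\<^esub> g)" if "h \<in> W" "g \<in> W" for h g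
    using that by (simp add: k_def inv_FP mult_FP)
  have k_adj: "k h g = adj (k g h)" for g h
  proof (cases "g \<in> W \<and> h \<in> W")
    case True
    have "inv\<^bsub>FP\<^esub> (inv\<^bsub>FP\<^esub> g \<otimes>\<^bsub>FP\<^esub> h) = inv\<^bsub>FP\<^esub> h \<otimes>\<^bsub>FP\<^esub> g"
      using True unfolding carrier_FP[symmetric] by (simp add: FP.inv_mult_group)
    moreover have "inv\<^bsub>FP\<^esub> g \<otimes>\<^bsub>FP\<^esub> h \<in> W"
      using True FP.m_closed[of "inv\<^bsub>FP\<^esub> g" h] FP.inv_closed[of g] by (simp add: carrier_FP)
    ultimately show ?thesis
      using True \<Psi>_inv_word[of "inv\<^bsub>FP\<^esub> g \<otimes>\<^bsub>FP\<^esub> h"] by (simp add: k inv_FP)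
  qed (auto simp: k_def)
  interpret H: hermitian_form pscale "kform k"
    by (rule hermitian_form_kform) (rule k_adj)
  show ?case
  proof (cases "?K \<subseteq> {[]}")
    case True
    have "kform k p p = cinner (Poly_Mapping.lookup p []) (Poly_Mapping.lookup p [])"
      using kform_superset[of "{[]}" "{[]}" p p k] True by (simp add: k_def W_Nil bapp_simps)
    then show ?thesis by (simp add: hilb.B_self)
  next
    case False
    then have ne: "?K \<noteq> {}" by auto
    obtain v where v: "v \<in> ?K" "\<And>w. w \<in> ?K \<Longrightarrow> length w \<le> length v"
      using obtains_MAX[OF finite_keys ne, of length] by (metis Max_ge finite_imageI finite_keys imageI)
    have "v \<noteq> []" using False v(2) by force
    then obtain v' i b where vb: "v = v' @ [(i, b)]" by (metis append_butlast_last_id surj_pair)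
    then have iI: "i \<in> I" and v'W: "v' \<in> W" and vW: "v' @ [(i, b)] \<in> W"
      using v(1) less.prems by (auto simp: W_append W_Cons)
    have v'_i: "v' = [] \<or> fst (last v') \<noteq> i" using vW by (auto simp: W_append)
    interpret Gi: group "G i" by (rule factor_group) fact
    define T where "T = {c. v' @ [(i, c)] \<in> ?K}"
    define T' where "T' = (\<lambda>c. v' @ [(i, c)]) ` T"
    have T'K: "T' \<subseteq> ?K" by (auto simp: T_def T'_def)
    have inj: "inj_on (\<lambda>c. v' @ [(i, c)]) T" by (simp add: inj_on_def)
    have finT: "finite T"
      using finite_subset[OF T'K finite_keys] inj unfolding T'_def by (rule finite_imageD)
    have TW: "v' @ [(i, c)] \<in> W" if "c \<in> T" for c using that less.prems by (auto simp: T_def)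
    have T: "T \<subseteq> carrier (G i)" "\<one>\<^bsub>G i\<^esub> \<notin> T" using TW by (auto simp: W_append W_Cons)
    define \<xi> where "\<xi> c = Poly_Mapping.lookup p (v' @ [(i, c)])" for c
    define e where "e c = Poly_Mapping.single (v' @ [(i, c)]) (\<xi> c) - Poly_Mapping.single v' (bapp (\<phi> i c) (\<xi> c))" for c
    define E where "E = (\<Sum>c\<in>T. e c)"
    define q where "q = p - E"
    \<comment> \<open>The product of the inverse of \<open>w\<close> with \<open>v'\<close> does not
      end in the factor \<open>i\<close>, so appending \<open>(i, c)\<close> cancels nothing and the
      product map splits off \<open>\<phi> i c\<close>. The two terms of \<open>e c\<close> then
      give the same value.\<close>
    have orth: "kform k (e c) (Poly_Mapping.single w y) = 0"
      if c: "c \<in> T" and w: "w \<in> W" "length w \<le> Suc (length v')" "\<And>c. w \<noteq> v' @ [(i, c)]" for c w y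
    proof -
      let ?x = "foldr (word_cons G) (inv_word w) v'"
      have xW: "?x \<in> W" using w(1) v'W by (intro mult_closed inv_word_closed)
      have last: "?x = [] \<or> fst (last ?x) \<noteq> i"
        by (rule last_letter_mult_inv_word[OF TW[OF c] w])
      have "[(i, c)] \<in> W" using TW[OF c] by (auto simp: W_append)
      then have "?x @ [(i, c)] \<in> W" using last xW by (auto simp: W_append)
      have "foldr (word_cons G) (inv_word w) (v' @ [(i, c)]) = foldr (word_cons G) (inv_word w) (foldr (word_cons G) v' [(i, c)])"
        using TW[OF c] by (simp add: mult_append)
      also have "\<dots> = foldr (word_cons G) ?x [(i, c)]"
        using w(1) v'W \<open>[(i, c)] \<in> W\<close> by (simp add: mult_assoc inv_word_closed)
      also have "\<dots> = ?x @ [(i, c)]" by (rule mult_append) fact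
      finally have "k w (v' @ [(i, c)]) = k w v' * \<phi> i c"
        using w(1) v'W TW[OF c] by (simp add: k_def word_map_append)
      then show ?thesis
        by (simp add: e_def H.B_diff kform_single bapp_simps)
    qed
    have lookup_E: "Poly_Mapping.lookup E w = (if w \<in> T' then Poly_Mapping.lookup p w else 0)" if "w \<noteq> v'" for w
    proof -
      have "Poly_Mapping.lookup E w = (\<Sum>c\<in>T. if v' @ [(i, c)] = w then \<xi> c else 0)"
        using that by (simp add: E_def e_def lookup_sum lookup_minus lookup_single when_def)
      also have "\<dots> = (\<Sum>x\<in>T'. if x = w then Poly_Mapping.lookup p x else 0)"
        unfolding T'_def \<xi>_def by (subst sum.reindex[OF inj]) simp
      also have "\<dots> = (if w \<in> T' then Poly_Mapping.lookup p w else 0)"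
        using finT by (simp add: T'_def)
      finally show ?thesis .
    qed
    have keys_q: "Poly_Mapping.keys q \<subseteq> insert v' (?K - T')"
      using lookup_E by (auto simp: in_keys_iff q_def lookup_minus split: if_splits)
    then have qW: "Poly_Mapping.keys q \<subseteq> W" using less.prems v'W by auto
    have q_orth: "kform k (e c) (Poly_Mapping.single w y) = 0" if "c \<in> T" "w \<in> Poly_Mapping.keys q" for c w y
    proof (rule orth[OF that(1)])
      show "w \<in> W" using qW that(2) by auto
      show "length w \<le> Suc (length v')" using keys_q that(2) v(2)[of w] by (auto simp: vb)
      show "w \<noteq> v' @ [(i, c)]" for c
        using keys_q that(2) by (auto simp: T'_def T_def)
    qed
    have "kform k E q = 0"
      by (simp add: E_def H.B_sum kform_keys_right[of k _ q] q_orth)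
    moreover from this have "kform k q E = 0" by (subst H.B_cnj) simp
    moreover have "p = q + E" by (simp add: q_def)
    ultimately have split: "kform k p p = kform k q q + kform k E E"
      by (simp add: H.B_add H.B_add_right)
    have "kform k E E = (\<Sum>c\<in>T. \<Sum>c'\<in>T. cinner (bapp (\<phi> i (inv\<^bsub>G i\<^esub> c' \<otimes>\<^bsub>G i\<^esub> c) - adj (\<phi> i c') * \<phi> i c) (\<xi> c)) (\<xi> c'))"
    proof -
      have "kform k (e c) (e c') = cinner (bapp (\<phi> i (inv\<^bsub>G i\<^esub> c' \<otimes>\<^bsub>G i\<^esub> c) - adj (\<phi> i c') * \<phi> i c) (\<xi> c)) (\<xi> c')"
        if c: "c \<in> T" "c' \<in> T" for c c'
      proof -
        let ?w = "v' @ [(i, c')]"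
        have cG: "c \<in> carrier (G i)" "c' \<in> carrier (G i)" using c T by auto
        have lW: "[(i, c)] \<in> W" "[(i, c')] \<in> W" using TW[OF c(1)] TW[OF c(2)] by (auto simp: W_append)
        \<comment> \<open>\<open>v'\<close> is itself an admissible word in \<open>orth\<close>, so
          the correction term of \<open>e c'\<close> drops out.\<close>
        have "kform k (e c) (Poly_Mapping.single v' y) = 0" for y
          by (rule orth[OF c(1) v'W]) auto
        then have "kform k (e c) (e c') = kform k (e c) (Poly_Mapping.single ?w (\<xi> c'))"
          unfolding e_def[of c'] by (simp add: H.B_diff_right)
        also have "\<dots> = cinner (bapp (k ?w (v' @ [(i, c)])) (\<xi> c)) (\<xi> c') - cinner (bapp (k ?w v') (bapp (\<phi> i c) (\<xi> c))) (\<xi> c')"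
          by (simp add: e_def H.B_diff kform_single)
        also have "k ?w v' = adj (\<phi> i c')"
        proof -
          have "?w = v' \<otimes>\<^bsub>FP\<^esub> [(i, c')]" using TW[OF c(2)] by (simp only: mult_FP mult_append)
          then have "inv\<^bsub>FP\<^esub> v' \<otimes>\<^bsub>FP\<^esub> ?w = (inv\<^bsub>FP\<^esub> v' \<otimes>\<^bsub>FP\<^esub> v') \<otimes>\<^bsub>FP\<^esub> [(i, c')]"
            using v'W lW unfolding carrier_FP[symmetric] by (simp only: FP.m_assoc FP.inv_closed)
          then have "inv\<^bsub>FP\<^esub> v' \<otimes>\<^bsub>FP\<^esub> ?w = [(i, c')]"
            using v'W lW unfolding carrier_FP[symmetric] by simp
          then have "k v' ?w = \<phi> i c'" using v'W TW[OF c(2)] by (simp add: k)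
          then show ?thesis by (subst k_adj) simp
        qed
        also have "k ?w (v' @ [(i, c)]) = \<phi> i (inv\<^bsub>G i\<^esub> c' \<otimes>\<^bsub>G i\<^esub> c)"
        proof -
          have w: "?w = v' \<otimes>\<^bsub>FP\<^esub> [(i, c')]" "v' @ [(i, c)] = v' \<otimes>\<^bsub>FP\<^esub> [(i, c)]"
            using TW[OF c(1)] TW[OF c(2)] by (simp_all only: mult_FP mult_append)
          have "inv\<^bsub>FP\<^esub> ?w \<otimes>\<^bsub>FP\<^esub> (v' @ [(i, c)]) =
              inv\<^bsub>FP\<^esub> [(i, c')] \<otimes>\<^bsub>FP\<^esub> ((inv\<^bsub>FP\<^esub> v' \<otimes>\<^bsub>FP\<^esub> v') \<otimes>\<^bsub>FP\<^esub> [(i, c)])"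
            unfolding w using v'W lW
            by (simp only: FP.inv_mult_group FP.m_assoc carrier_FP[symmetric] FP.inv_closed FP.m_closed)
          also have "\<dots> = inv_word [(i, c')] \<otimes>\<^bsub>FP\<^esub> [(i, c)]"
            using v'W lW unfolding inv_FP[OF lW(2), symmetric] carrier_FP[symmetric] by simp
          also have "\<dots> = (if inv\<^bsub>G i\<^esub> c' \<otimes>\<^bsub>G i\<^esub> c = \<one>\<^bsub>G i\<^esub> then [] else [(i, inv\<^bsub>G i\<^esub> c' \<otimes>\<^bsub>G i\<^esub> c)])"
            using inv_letter[OF iI, of c'] lW by (simp add: mult_FP W_Cons)
          finally show ?thesis
            using TW[OF c(1)] TW[OF c(2)] by (simp add: k \<phi>_one iI)
        qed
        finally show ?thesis by (simp add: bapp_simps hilb.B_diff)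
      qed
      then show ?thesis
        unfolding E_def H.B_sum H.B_sum_right by (simp cong: sum.cong) (rule sum.swap)
    qed
    then have E: "0 \<le> Re (kform k E E)"
      using posdef_centered[OF factor_group[OF iI] \<phi>_posdef[OF iI] \<phi>_one[OF iI] finT T] by simp
    have "(\<Sum>w\<in>Poly_Mapping.keys q. length w) \<le> (\<Sum>w\<in>insert v' (?K - T'). length w)"
      using keys_q by (intro sum_mono2) auto
    also have "\<dots> \<le> length v' + (\<Sum>w\<in>?K - T'. length w)"
      by (simp add: sum.insert_if)
    also have "\<dots> < (\<Sum>w\<in>T'. length w) + (\<Sum>w\<in>?K - T'. length w)"
    proof -
      have "v \<in> T'" using v(1) by (auto simp: T'_def T_def vb)
      then have "length v \<le> (\<Sum>w\<in>T'. length w)"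
        using finT by (intro member_le_sum) (auto simp: T'_def)
      then show ?thesis by (simp add: vb)
    qed
    also have "\<dots> = (\<Sum>w\<in>?K. length w)"
      using sum.subset_diff[OF T'K finite_keys, of length] by simp
    finally have "0 \<le> Re (kform k q q)" by (rule less.hyps) (rule qW)
    with E split show ?thesis by simp
  qed
qed

theorem posdef_word_map: "posdef FP \<Psi>"
  unfolding posdef_def
proof (intro conjI ballI allI impI)
  show "\<Psi> (inv\<^bsub>FP\<^esub> x) = adj (\<Psi> x)" if "x \<in> carrier FP" for x
    using that by (simp add: carrier_FP inv_FP \<Psi>_inv_word)
  fix S and \<xi> :: "('i \<times> 'g) list \<Rightarrow> 'h"
  assume S: "finite S" "S \<subseteq> carrier FP"
  define k where "k = (\<lambda>h g. if g \<in> W \<and> h \<in> W then \<Psi> (foldr (word_cons G) (inv_word h) g) else 0)"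
  define p where "p = (\<Sum>g\<in>S. Poly_Mapping.single g (\<xi> g))"
  have lookup: "Poly_Mapping.lookup p g = (if g \<in> S then \<xi> g else 0)" for g
    using S by (simp add: p_def lookup_sum lookup_single when_def)
  have keys: "Poly_Mapping.keys p \<subseteq> S" by (auto simp: in_keys_iff lookup split: if_splits)
  have "kform k p p = (\<Sum>g\<in>S. \<Sum>h\<in>S. cinner (bapp (k h g) (Poly_Mapping.lookup p g)) (Poly_Mapping.lookup p h))"
    by (rule kform_superset) (use S keys in auto)
  also have "\<dots> = (\<Sum>g\<in>S. \<Sum>h\<in>S. cinner (bapp (\<Psi> (inv\<^bsub>FP\<^esub> h \<otimes>\<^bsub>FP\<^esub> g)) (\<xi> g)) (\<xi> h))"
    using S by (intro sum.cong refl) (auto simp: k_def lookup carrier_FP inv_FP mult_FP subset_iff)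
  finally show "0 \<le> Re (\<Sum>g\<in>S. \<Sum>h\<in>S. cinner (bapp (\<Psi> (inv\<^bsub>FP\<^esub> h \<otimes>\<^bsub>FP\<^esub> g)) (\<xi> g)) (\<xi> h))"
    using kform_nonneg[of p] keys S by (simp add: k_def carrier_FP)
qed

end

section \<open>Representations on sequence space\<close>

definition bop_of :: "('h::chilbert_space \<Rightarrow> 'h) \<Rightarrow> 'h bop" where
  "bop_of f = Bop (Blinfun f)"

lemma bapp_bop_of:
  assumes "bounded_linear f" "\<And>c x. f (c *\<^sub>C x) = c *\<^sub>C f x"
  shows "bapp (bop_of f) x = f x"
  by (simp add: bop_of_def bapp.rep_eq Bop_inverse bounded_linear_Blinfun_apply assms)

definition contraction :: "('h::chilbert_space \<Rightarrow> 'k::chilbert_space) \<Rightarrow> bool" where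
  "contraction T \<longleftrightarrow> (\<forall>x y. T (x + y) = T x + T y) \<and> (\<forall>c x. T (c *\<^sub>C x) = c *\<^sub>C T x) \<and>
     (\<forall>x. norm (T x) \<le> norm x)"

lemma contraction:
  assumes "contraction T"
  shows "T (x + y) = T x + T y" "T (x - y) = T x - T y" "T (c *\<^sub>C x) = c *\<^sub>C T x" "T 0 = 0"
    "norm (T x) \<le> norm x"
proof -
  show add: "T (x + y) = T x + T y" for x y using assms by (simp add: contraction_def)
  show "T (c *\<^sub>C x) = c *\<^sub>C T x" "norm (T x) \<le> norm x" using assms by (simp_all add: contraction_def)
  show "T (x - y) = T x - T y" "T 0 = 0" using add[of "x - y" y] add[of 0 0] by simp_all
qed

text \<open>\<open>adj\<close> is reserved for operators on one space; the coordinate map into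
  \<open>ell2\<close> below connects two. The Riesz argument is the same.\<close>

lemma ex_adjoint_contraction:
  fixes T :: "'h::chilbert_space \<Rightarrow> 'k::chilbert_space"
  assumes T: "contraction T"
  shows "\<exists>S. contraction S \<and> (\<forall>x y. cinner (T x) y = cinner x (S y))"
proof -
  have bl: "bounded_linear T"
    by (intro bounded_linear_intro[where K = 1]) (simp_all add: scaleR_scaleC contraction[OF T])
  have "\<exists>z. \<forall>x. cinner (T x) y = cinner x z" for y
  proof -
    have "bounded_linear (\<lambda>x. inner (T x) y)"
      by (rule bounded_linear_compose[OF bounded_linear_inner_left bl])
    then obtain z where "\<And>x. inner (T x) y = inner x z"
      using Riesz_real by blast
    note z = this[unfolded inner_eq_Re_cinner]
    have "Im (cinner (T x) y) = Im (cinner x z)" for x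
      using z[of "\<i> *\<^sub>C x"] by (simp add: contraction[OF T] cinner_scaleC_left)
    with z show ?thesis by (auto simp: complex_eq_iff)
  qed
  then obtain S where S: "\<And>x y. cinner (T x) y = cinner x (S y)" by metis
  have "contraction S"
    unfolding contraction_def
  proof (intro conjI allI)
    show "S (x + y) = S x + S y" for x y
      by (rule cinner_extI) (simp add: S[symmetric] cinner_add_right)
    show "S (c *\<^sub>C x) = c *\<^sub>C S x" for c x
      by (rule cinner_extI) (simp add: S[symmetric] cinner_scaleC_right)
    fix y
    have "(norm (S y))\<^sup>2 = Re (cinner (T (S y)) y)"
      by (simp add: S hilb.B_self)
    also have "\<dots> \<le> norm (T (S y)) * norm y"
      using hilb.Cauchy_Schwarz complex_Re_le_cmod order_trans by blast
    also have "\<dots> \<le> norm (S y) * norm y"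
      by (intro mult_right_mono contraction[OF T]) simp
    finally have "norm (S y) * norm (S y) \<le> norm (S y) * norm y"
      by (simp add: power2_eq_square)
    then show "norm (S y) \<le> norm y"
      by (cases "norm (S y) = 0") (auto simp: mult_le_cancel_left)
  qed
  with S show ?thesis by blast
qed

text \<open>Linearly dependent vectors produce zeros, as \<^term>\<open>sgn 0 = 0\<close>.\<close>

fun gram_schmidt :: "(nat \<Rightarrow> 'h::chilbert_space) \<Rightarrow> nat \<Rightarrow> 'h" where
  "gram_schmidt y n = sgn (y n - (\<Sum>m<n. cinner (y n) (gram_schmidt y m) *\<^sub>C gram_schmidt y m))"

declare gram_schmidt.simps [simp del]

lemma gram_schmidt_normalized: "gram_schmidt y n = 0 \<or> norm (gram_schmidt y n) = 1"
  by (subst (1 2) gram_schmidt.simps) (simp add: norm_sgn)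

text \<open>The inner product of a Gram-Schmidt vector with itself is 0 or 1, and it is 0 only if
  the vector vanishes; next to that vector the factor can always be dropped.\<close>

lemma gram_schmidt_absorb: "(c * cinner (gram_schmidt y n) (gram_schmidt y n)) *\<^sub>C gram_schmidt y n = c *\<^sub>C gram_schmidt y n"
  "cinner x (gram_schmidt y n) * cinner (gram_schmidt y n) (gram_schmidt y n) = cinner x (gram_schmidt y n)"
  using gram_schmidt_normalized[of y n] by (auto simp: hilb.B_self scaleC_zero_right)

lemma gram_schmidt_orthogonal_less: "m < n \<Longrightarrow> cinner (gram_schmidt y n) (gram_schmidt y m) = 0"
proof (induction n arbitrary: m rule: less_induct)
  case (less n)
  let ?e = "gram_schmidt y"
  let ?r = "y n - (\<Sum>l<n. cinner (y n) (?e l) *\<^sub>C ?e l)"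
  have orth: "cinner (?e l) (?e m) = 0" if "l < n" "l \<noteq> m" for l
  proof (cases "m < l")
    case False
    then have "cinner (?e m) (?e l) = 0" using less.IH[of m l] less.prems that by simp
    then show ?thesis by (subst cinner_commute) simp
  qed (use less.IH[of l m] that in simp)
  have "cinner ?r (?e m) = cinner (y n) (?e m) - (\<Sum>l<n. cinner (y n) (?e l) * cinner (?e l) (?e m))"
    by (simp add: hilb.B_diff hilb.B_sum cinner_scaleC_left)
  also have "(\<Sum>l<n. cinner (y n) (?e l) * cinner (?e l) (?e m)) =
      (\<Sum>l<n. if l = m then cinner (y n) (?e m) * cinner (?e m) (?e m) else 0)"
    by (intro sum.cong) (auto simp: orth)
  also have "\<dots> = cinner (y n) (?e m)"
    using less.prems by (simp add: gram_schmidt_absorb)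
  finally have "cinner ?r (?e m) = 0" by simp
  then show ?case
    by (subst gram_schmidt.simps) (simp add: sgn_div_norm scaleR_scaleC cinner_scaleC_left)
qed

lemma gram_schmidt_orthogonal: "m \<noteq> n \<Longrightarrow> cinner (gram_schmidt y m) (gram_schmidt y n) = 0"
proof (cases m n rule: linorder_cases)
  case less
  then show ?thesis by (subst cinner_commute) (simp add: gram_schmidt_orthogonal_less)
qed (simp_all add: gram_schmidt_orthogonal_less)

lemma gram_schmidt_span: "y n = (\<Sum>m\<le>n. cinner (y n) (gram_schmidt y m) *\<^sub>C gram_schmidt y m)"
proof -
  let ?e = "gram_schmidt y"
  let ?s = "\<Sum>l<n. cinner (y n) (?e l) *\<^sub>C ?e l"
  have r: "y n - ?s = complex_of_real (norm (y n - ?s)) *\<^sub>C ?e n"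
  proof -
    define r where "r = y n - ?s"
    have "?e n = sgn r" unfolding r_def by (rule gram_schmidt.simps)
    moreover have "r = norm r *\<^sub>R sgn r" by (cases "r = 0") (simp_all add: sgn_div_norm)
    ultimately show ?thesis by (simp add: r_def[symmetric] scaleR_scaleC[symmetric])
  qed
  have "cinner ?s (?e n) = 0"
    by (simp add: hilb.B_sum cinner_scaleC_left gram_schmidt_orthogonal)
  then have "cinner (y n) (?e n) = cinner (y n - ?s) (?e n)"
    by (simp add: hilb.B_diff)
  also have "\<dots> *\<^sub>C ?e n = y n - ?s"
    by (subst r, subst r) (simp add: cinner_scaleC_left gram_schmidt_absorb)
  finally show ?thesis by (simp add: lessThan_Suc_atMost[symmetric])
qed

lemma gram_schmidt_perp:
  assumes "\<And>m. cinner (y m) z = 0"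
  shows "cinner (gram_schmidt y n) z = 0"
proof (induction n rule: less_induct)
  case (less n)
  then show ?case
    by (subst gram_schmidt.simps)
      (simp add: sgn_div_norm scaleR_scaleC cinner_scaleC_left hilb.B_diff hilb.B_sum assms)
qed

lemma gram_schmidt_Bessel: "(\<Sum>n<N. (cmod (cinner x (gram_schmidt y n)))\<^sup>2) \<le> (norm x)\<^sup>2"
proof -
  let ?e = "gram_schmidt y"
  define S where "S = (\<Sum>n<N. (cmod (cinner x (?e n)))\<^sup>2)"
  define s where "s = (\<Sum>n<N. cinner x (?e n) *\<^sub>C ?e n)"
  have xs: "cinner x s = of_real S"
    by (simp add: s_def S_def hilb.B_sum_right cinner_scaleC_right complex_norm_square mult.commute del: of_real_power)
  have "cinner s (?e n) = cinner x (?e n)" if "n < N" for n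
  proof -
    have "cinner s (?e n) = (\<Sum>m<N. if m = n then cinner x (?e n) * cinner (?e n) (?e n) else 0)"
      unfolding s_def hilb.B_sum cinner_scaleC_left
      by (intro sum.cong) (auto simp: gram_schmidt_orthogonal)
    then show ?thesis using that by (simp add: gram_schmidt_absorb)
  qed
  then have "cinner s s = cinner x s"
    by (subst (2 3) s_def) (simp add: hilb.B_sum_right cinner_scaleC_right)
  with xs have "(norm s)\<^sup>2 = S" by (simp add: hilb.nn_square)
  moreover have "0 \<le> (norm (x - s))\<^sup>2" by simp
  ultimately show ?thesis
    unfolding hilb.nn_diff_square S_def[symmetric] by (simp add: xs)
qed

text \<open>\<open>V\<close> lists the coordinates along the Gram-Schmidt vectors of
  \<open>y\<close>, and \<open>Q\<close> is its adjoint. Hence \<open>Q\<close> after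
  \<open>V\<close> fixes the vectors \<open>y n\<close>, and the last conjunct places the range of
  \<open>Q\<close> in their closed span.\<close>

lemma ex_partial_isometry_ell2:
  fixes y :: "nat \<Rightarrow> 'k::chilbert_space"
  shows "\<exists>(V :: 'k \<Rightarrow> ell2) Q. contraction V \<and> contraction Q \<and>
    (\<forall>x f. cinner (V x) f = cinner x (Q f)) \<and> (\<forall>n. Q (V (y n)) = y n) \<and>
    (\<forall>z f. (\<forall>n. cinner (y n) z = 0) \<longrightarrow> cinner (Q f) z = 0)"
proof -
  let ?e = "gram_schmidt y"
  define V where "V x = Ell2 (\<lambda>n. cinner x (?e n))" for x
  have summ: "summable (\<lambda>n. (cmod (cinner x (?e n)))\<^sup>2)" for x
    by (rule summableI_nonneg_bounded[OF _ gram_schmidt_Bessel]) simp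
  have coord: "ell2_coord (V x) n = cinner x (?e n)" for x n
    using summ by (simp add: V_def Ell2_inverse)
  have add: "V (x + z) = V x + V z" for x z
    by (simp add: ell2_coord_inject[symmetric] fun_eq_iff plus_ell2.rep_eq coord cinner_add_left)
  have sc: "V (c *\<^sub>C x) = c *\<^sub>C V x" for c x
    by (simp add: ell2_coord_inject[symmetric] fun_eq_iff scaleC_ell2.rep_eq coord cinner_scaleC_left)
  have bound: "norm (V x) \<le> norm x" for x
  proof (rule power2_le_imp_le)
    show "(norm (V x))\<^sup>2 \<le> (norm x)\<^sup>2"
      unfolding ell2_norm_square coord by (rule suminf_le_const[OF summ gram_schmidt_Bessel])
  qed simp
  have V: "contraction V" using add sc bound by (simp add: contraction_def)
  obtain Q where Q: "contraction Q" "\<And>x f. cinner (V x) f = cinner x (Q f)"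
    using ex_adjoint_contraction[OF V] by blast
  have QVe: "Q (V (?e n)) = ?e n" for n
  proof (rule cinner_extI)
    fix x
    have "ell2_coord (V (?e n)) m = (if m = n then cinner (?e n) (?e n) else 0)" for m
      by (simp add: coord gram_schmidt_orthogonal)
    then have "cinner (V x) (V (?e n)) = (suminf (\<lambda>m. if m = n then cinner x (?e n) * cnj (cinner (?e n) (?e n)) else 0))"
      unfolding cinner_ell2.rep_eq coord[of x] by (intro arg_cong[of _ _ suminf]) (auto simp: fun_eq_iff)
    also have "\<dots> = cinner x (?e n) * cinner (?e n) (?e n)"
      using suminf_finite[of "{n}" "\<lambda>m. if m = n then cinner x (?e n) * cnj (cinner (?e n) (?e n)) else 0"]
        cinner_commute[of "?e n" "?e n"] by simp
    finally show "cinner x (Q (V (?e n))) = cinner x (?e n)"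
      by (simp add: Q(2)[symmetric] gram_schmidt_absorb)
  qed
  have sum: "Q (V (\<Sum>m\<in>M. c m *\<^sub>C ?e m)) = (\<Sum>m\<in>M. c m *\<^sub>C ?e m)" if "finite M" for M c
    using that by (induction M rule: finite_induct) (simp_all add: contraction[OF V] contraction[OF Q(1)] QVe)
  show ?thesis
  proof (intro exI[of _ V] exI[of _ Q] conjI allI impI)
    show "Q (V (y n)) = y n" for n
      using sum[of "{..n}" "\<lambda>m. cinner (y n) (?e m)"] by (simp add: gram_schmidt_span[symmetric])
    show "cinner (Q f) z = 0" if "\<forall>n. cinner (y n) z = 0" for z f
    proof -
      have "cinner z (?e n) = 0" for n
        using gram_schmidt_perp[of y z n] that by (subst cinner_commute) simp
      then have "V z = 0"
        by (simp add: ell2_coord_inject[symmetric] fun_eq_iff coord zero_ell2.rep_eq)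
      then have "cinner z (Q f) = 0" by (simp add: Q(2)[symmetric])
      then show ?thesis by (subst cinner_commute) simp
    qed
  qed (fact V Q)+
qed

text \<open>The closed span of an invariant countable set is separable and invariant.
  \<open>V\<close> carries \<open>u\<close> on this span over to \<open>ell2\<close>; on the
  orthogonal complement of the image the new representation is trivial, which keeps it
  unital.\<close>

lemma (in group) ell2_subrepresentation:
  fixes u :: "'a \<Rightarrow> 'k::chilbert_space bop"
  assumes u: "unitary_rep G u" and Y: "countable Y" "\<And>g x. g \<in> carrier G \<Longrightarrow> x \<in> Y \<Longrightarrow> bapp (u g) x \<in> Y"
  shows "\<exists>(\<kappa> :: 'a \<Rightarrow> ell2 bop) V. unitary_rep G \<kappa> \<and> (\<forall>g\<in>carrier G. \<forall>x\<in>Y. \<forall>z\<in>Y.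
    cinner (bapp (\<kappa> g) (V x)) (V z) = cinner (bapp (u g) x) z)"
proof -
  define y where "y = from_nat_into (insert 0 Y)"
  have range_y: "range y = insert 0 Y"
    unfolding y_def using Y(1) by (intro range_from_nat_into) auto
  obtain V :: "'k \<Rightarrow> ell2" and Q where V: "contraction V" and Q: "contraction Q"
    and VQ: "\<And>x f. cinner (V x) f = cinner x (Q f)" and QVy: "\<And>n. Q (V (y n)) = y n"
    and Qy: "\<And>z f. (\<forall>n. cinner (y n) z = 0) \<Longrightarrow> cinner (Q f) z = 0"
    using ex_partial_isometry_ell2[of y] by blast
  note V = contraction[OF V] and Q = contraction[OF Q]
  have QV: "cinner (Q f) x = cinner f (V x)" for f x
    by (subst (1 2) cinner_commute) (simp add: VQ)
  define perp where "perp z \<longleftrightarrow> (\<forall>x\<in>Y. cinner x z = 0)" for z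
  have perpI: "(\<forall>n. cinner (y n) z = 0) \<longleftrightarrow> perp z" for z
  proof -
    have "(\<forall>n. cinner (y n) z = 0) \<longleftrightarrow> (\<forall>x\<in>range y. cinner x z = 0)" by blast
    then show ?thesis unfolding range_y perp_def by simp
  qed
  \<comment> \<open>The closed span of \<open>Y\<close>, described as a double orthogonal
    complement.\<close>
  define K where "K x \<longleftrightarrow> (\<forall>z. perp z \<longrightarrow> cinner x z = 0)" for x
  have KQ: "K (Q f)" for f
    using Qy unfolding K_def perpI[symmetric] by blast
  have Ku: "K (bapp (u g) x)" if g: "g \<in> carrier G" and x: "K x" for g x
    unfolding K_def
  proof (intro allI impI)
    fix z assume z: "perp z"
    have adj: "adj (u g) = u (inv g)" using g by (simp add: unitary_rep_inv[OF u])
    have "perp (bapp (adj (u g)) z)"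
      unfolding perp_def
    proof
      fix w assume "w \<in> Y"
      then have "bapp (u g) w \<in> Y" by (rule Y(2)[OF g])
      with z show "cinner w (bapp (adj (u g)) z) = 0" by (simp add: perp_def cinner_adj[symmetric])
    qed
    with x show "cinner (bapp (u g) x) z = 0" by (simp add: K_def cinner_adj)
  qed
  have KQV: "Q (V x) = x" if x: "K x" for x
  proof -
    have "cinner (y n) (x - Q (V x)) = 0" for n
    proof -
      have "cinner (y n) (Q (V x)) = cinner (Q (V (y n))) x"
        by (simp only: VQ[symmetric] QV)
      then show ?thesis by (simp add: QVy hilb.B_diff_right)
    qed
    then have perp: "perp (x - Q (V x))" using perpI by blast
    have "cinner (x - Q (V x)) (x - Q (V x)) = 0"
      using perp x KQ[of "V x"] unfolding K_def hilb.B_diff by simp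
    then show ?thesis by (simp add: hilb.B_self)
  qed
  have KY: "K x" if "x \<in> Y" for x using that by (auto simp: K_def perp_def)
  \<comment> \<open>\<open>V\<close> after \<open>Q\<close> is the projection onto the image of the
    span; the second summand is the identity on its complement.\<close>
  define \<kappa> where "\<kappa> g = bop_of (\<lambda>f. V (bapp (u g) (Q f)) + (f - V (Q f)))" for g
  have \<kappa>: "bapp (\<kappa> g) f = V (bapp (u g) (Q f)) + (f - V (Q f))" for g f
    unfolding \<kappa>_def
  proof (rule bapp_bop_of)
    show sc: "V (bapp (u g) (Q (c *\<^sub>C f))) + (c *\<^sub>C f - V (Q (c *\<^sub>C f))) =
        c *\<^sub>C (V (bapp (u g) (Q f)) + (f - V (Q f)))" for c f
      by (simp add: V Q bapp_scaleC scaleC_add_right scaleC_diff_right)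
    show "bounded_linear (\<lambda>f. V (bapp (u g) (Q f)) + (f - V (Q f)))"
    proof (rule bounded_linear_intro[where K = "norm (u g) + 2"])
      show "V (bapp (u g) (Q (f + h))) + (f + h - V (Q (f + h))) =
        V (bapp (u g) (Q f)) + (f - V (Q f)) + (V (bapp (u g) (Q h)) + (h - V (Q h)))" for f h
        by (simp add: V Q bapp_add)
      show "V (bapp (u g) (Q (r *\<^sub>R f))) + (r *\<^sub>R f - V (Q (r *\<^sub>R f))) =
        r *\<^sub>R (V (bapp (u g) (Q f)) + (f - V (Q f)))" for r f
        using sc by (simp add: scaleR_scaleC)
      fix f
      have "norm (V (bapp (u g) (Q f))) \<le> norm (bapp (u g) (Q f))" by (rule V)
      also have "\<dots> \<le> norm (u g) * norm (Q f)" by (rule norm_bapp)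
      also have "\<dots> \<le> norm (u g) * norm f" by (intro mult_left_mono Q) simp
      finally have 1: "norm (V (bapp (u g) (Q f))) \<le> norm (u g) * norm f" .
      have 2: "norm (V (Q f)) \<le> norm f" by (rule order_trans[OF V(5) Q(5)])
      have "norm (V (bapp (u g) (Q f)) + (f - V (Q f))) \<le> norm (V (bapp (u g) (Q f))) + (norm f + norm (V (Q f)))"
        by (intro order_trans[OF norm_triangle_ineq] add_left_mono norm_triangle_ineq4)
      with 1 2 show "norm (V (bapp (u g) (Q f)) + (f - V (Q f))) \<le> norm f * (norm (u g) + 2)"
        by (simp add: algebra_simps)
    qed
  qed
  have QVQ: "Q (V (Q f)) = Q f" for f by (rule KQV[OF KQ])
  have Q\<kappa>: "Q (bapp (\<kappa> g) f) = bapp (u g) (Q f)" if "g \<in> carrier G" for g f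
    by (simp add: \<kappa> Q QVQ KQV Ku[OF that] KQ)
  show ?thesis
  proof (intro exI[of _ \<kappa>] exI[of _ V] conjI ballI)
    show "unitary_rep G \<kappa>"
      unfolding unitary_rep_def
    proof (intro conjI ballI)
      show "\<kappa> \<one> = 1"
        by (rule bop_eqI) (simp add: \<kappa> unitary_rep_one[OF u] bapp_simps)
      fix g assume g: "g \<in> carrier G"
      show "\<kappa> (inv g) = adj (\<kappa> g)"
      proof (rule adj_eqI[symmetric])
        fix f h
        have "cinner (V (Q f)) h = cinner f (V (Q h))" by (simp only: VQ QV)
        moreover have "cinner (V (bapp (u g) (Q f))) h = cinner f (V (bapp (u (inv g)) (Q h)))"
          by (simp only: VQ QV[symmetric] cinner_adj unitary_rep_inv[OF u g])
        ultimately show "cinner (bapp (\<kappa> g) f) h = cinner f (bapp (\<kappa> (inv g)) h)"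
          by (simp add: \<kappa> cinner_add_left cinner_add_right hilb.B_diff hilb.B_diff_right)
      qed
      fix h assume h: "h \<in> carrier G"
      show "\<kappa> (g \<otimes> h) = \<kappa> g * \<kappa> h"
      proof (rule bop_eqI)
        fix f
        have "bapp (\<kappa> g) (bapp (\<kappa> h) f) = V (bapp (u g) (bapp (u h) (Q f))) +
            (bapp (\<kappa> h) f - V (bapp (u h) (Q f)))"
          by (simp add: \<kappa>[of g] Q\<kappa>[OF h])
        then show "bapp (\<kappa> (g \<otimes> h)) f = bapp (\<kappa> g * \<kappa> h) f"
          by (simp add: bapp_simps \<kappa>[of h] \<kappa>[of "g \<otimes> h"] unitary_rep_mult[OF u g h])
      qed
    qed
    fix g x z assume "g \<in> carrier G" "x \<in> Y" "z \<in> Y"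
    then show "cinner (bapp (\<kappa> g) (V x)) (V z) = cinner (bapp (u g) x) z"
      by (simp add: \<kappa> KQV KY VQ Ku)
  qed
qed

text \<open>The space of \<open>u\<close> may be nonseparable, but the forms to be compared depend
  only on the countable array \<open>\<gamma> \<xi>\<close> of matrix coefficients. Such arrays form
  a second countable space, and a negative form value is an open condition on them, so countably
  many families of vectors detect every failure of positivity.\<close>

lemma (in group) ex_ell2_rep:
  fixes u :: "'a \<Rightarrow> 'k::chilbert_space bop"
  assumes u: "unitary_rep G u" and "countable (carrier G)"
  obtains \<kappa> :: "'a \<Rightarrow> ell2 bop" where "unitary_rep G \<kappa>" "dominates G \<kappa> u"
proof -
  define num where "num = to_nat_on (carrier G)"
  define elt where "elt = from_nat_into (carrier G)"
  have elt: "elt (num g) = g" if "g \<in> carrier G" for g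
    unfolding elt_def num_def using assms(2) that by (rule from_nat_into_to_nat_on)
  define \<gamma> :: "(nat \<Rightarrow> 'k) \<Rightarrow> nat \<times> nat \<times> nat \<Rightarrow> complex" where
    "\<gamma> \<xi> = (\<lambda>(m, i, j). cinner (bapp (u (elt m)) (\<xi> j)) (\<xi> i))" for \<xi>
  \<comment> \<open>One family of vectors is chosen for each basic open set that some array meets;
    \<open>Y\<close> is the invariant set which these vectors generate.\<close>
  obtain \<B> :: "(nat \<times> nat \<times> nat \<Rightarrow> complex) set set" where \<B>: "countable \<B>" "topological_basis \<B>"
    using ex_countable_basis by blast
  define \<Xi> where "\<Xi> b = (SOME \<xi>. \<gamma> \<xi> \<in> b)" for b
  have \<Xi>: "\<gamma> (\<Xi> b) \<in> b" if "\<gamma> \<xi> \<in> b" for b \<xi>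
    unfolding \<Xi>_def using that by (rule someI[where P = "\<lambda>\<xi>. \<gamma> \<xi> \<in> b"])
  define Y where "Y = (\<lambda>(b, i, g). bapp (u g) (\<Xi> b i)) ` (\<B> \<times> UNIV \<times> carrier G)"
  have cY: "countable Y" unfolding Y_def using \<B>(1) assms(2) by (intro countable_image countable_SIGMA) auto
  have uY: "bapp (u g) x \<in> Y" if g: "g \<in> carrier G" and x: "x \<in> Y" for g x
  proof -
    obtain b i h where bih: "b \<in> \<B>" "h \<in> carrier G" "x = bapp (u h) (\<Xi> b i)" using x by (auto simp: Y_def)
    then have "bapp (u g) x = bapp (u (g \<otimes> h)) (\<Xi> b i)"
      by (simp add: unitary_rep_mult[OF u g] bapp_simps)
    then show ?thesis using bih g unfolding Y_def by (intro image_eqI[of _ _ "(b, i, g \<otimes> h)"]) auto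
  qed
  have \<Xi>Y: "\<Xi> b i \<in> Y" if "b \<in> \<B>" for b i
    unfolding Y_def using that by (intro image_eqI[of _ _ "(b, i, \<one>)"]) (auto simp: unitary_rep_one[OF u] bapp_simps)
  obtain \<kappa> :: "'a \<Rightarrow> ell2 bop" and V where \<kappa>: "unitary_rep G \<kappa>"
    "\<And>g x z. g \<in> carrier G \<Longrightarrow> x \<in> Y \<Longrightarrow> z \<in> Y \<Longrightarrow> cinner (bapp (\<kappa> g) (V x)) (V z) = cinner (bapp (u g) x) z"
    using ell2_subrepresentation[OF u cY uY] by blast
  have "dominates G \<kappa> u"
    unfolding dominates_def
  proof (intro allI impI)
    fix n and F :: "nat \<Rightarrow> nat \<Rightarrow> 'a \<Rightarrow> complex"
    assume F: "\<forall>i j. F i j \<in> group_algebra G" and pos: "rpos n (\<lambda>i j. ev \<kappa> (F i j))"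
    have form: "form n (\<lambda>i j. ev \<alpha> (F i j)) \<xi> =
        (\<Sum>i<n. \<Sum>j<n. \<Sum>g | F i j g \<noteq> 0. F i j g * cinner (bapp (\<alpha> g) (\<xi> j)) (\<xi> i))"
      for \<alpha> :: "'a \<Rightarrow> 'z::chilbert_space bop" and \<xi>
      by (simp add: form_def fsum_def bapp_sum bapp_simps hilb.B_sum cinner_scaleC_left)
    define h where "h c = Re (\<Sum>i<n. \<Sum>j<n. \<Sum>g | F i j g \<noteq> 0. F i j g * c (num g, i, j))"
      for c :: "nat \<times> nat \<times> nat \<Rightarrow> complex"
    have carr: "g \<in> carrier G" if "F i j g \<noteq> 0" for i j g
      using F that by (auto dest: group_algebra_carrier)
    have h\<gamma>: "Re (form n (\<lambda>i j. ev u (F i j)) \<xi>) = h (\<gamma> \<xi>)" for \<xi>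
      unfolding form h_def \<gamma>_def using carr by (auto simp: elt intro!: arg_cong[of _ _ Re] sum.cong)
    have "continuous_on UNIV h"
      unfolding h_def by (intro continuous_intros continuous_on_product_coordinates)
    then have op: "open {c. h c < 0}"
      using open_Collect_less[of h "\<lambda>_. 0"] by simp
    show "rpos n (\<lambda>i j. ev u (F i j))"
      unfolding rpos_def
    proof (intro allI, rule ccontr)
      fix \<xi> assume "\<not> 0 \<le> Re (form n (\<lambda>i j. ev u (F i j)) \<xi>)"
      then have "\<gamma> \<xi> \<in> {c. h c < 0}" by (simp add: h\<gamma>)
      then obtain b where b: "b \<in> \<B>" "\<gamma> \<xi> \<in> b" "b \<subseteq> {c. h c < 0}"
        by (rule topological_basisE[OF \<B>(2) op])
      from \<Xi>[OF b(2)] b(3) have "Re (form n (\<lambda>i j. ev u (F i j)) (\<Xi> b)) < 0" by (auto simp: h\<gamma>)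
      also have "form n (\<lambda>i j. ev u (F i j)) (\<Xi> b) = form n (\<lambda>i j. ev \<kappa> (F i j)) (\<lambda>i. V (\<Xi> b i))"
        unfolding form by (intro sum.cong refl) (simp add: \<kappa>(2) carr \<Xi>Y[OF b(1)])
      finally show False using pos by (simp add: rpos_def not_less[symmetric])
    qed
  qed
  with \<kappa>(1) show ?thesis by (rule that)
qed

section \<open>Rigidity of the generators\<close>

text \<open>Pairs of quadratic forms that a complete order embedding has to compare.\<close>

definition form_pair ::
  "'j set \<Rightarrow> 'h::chilbert_space bop set \<Rightarrow> ('h bop \<Rightarrow> 'k::chilbert_space bop) \<Rightarrow>
     (('j \<Rightarrow> 'k) \<Rightarrow> complex) \<Rightarrow> (('j \<Rightarrow> 'h) \<Rightarrow> complex) \<Rightarrow> bool" where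
  "form_pair J R \<iota> p q \<longleftrightarrow> (\<exists>X. (\<forall>a\<in>J. \<forall>b\<in>J. X a b \<in> R) \<and>
     p = (\<lambda>\<zeta>. \<Sum>a\<in>J. \<Sum>b\<in>J. cinner (bapp (\<iota> (X a b)) (\<zeta> b)) (\<zeta> a)) \<and>
     q = (\<lambda>\<zeta>. \<Sum>a\<in>J. \<Sum>b\<in>J. cinner (bapp (X a b) (\<zeta> b)) (\<zeta> a)))"

locale operator_system_embedding =
  fixes R :: "'h::chilbert_space bop set" and \<iota> :: "'h bop \<Rightarrow> 'k::chilbert_space bop"
  assumes one_mem: "1 \<in> R" and add_mem: "S \<in> R \<Longrightarrow> T \<in> R \<Longrightarrow> S + T \<in> R"
    and scale_mem: "T \<in> R \<Longrightarrow> c *\<^sub>C T \<in> R"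
    and embedding: "unital_complete_order_embedding R \<iota>"
begin

lemma \<iota>_one: "\<iota> 1 = 1" and \<iota>_add: "S \<in> R \<Longrightarrow> T \<in> R \<Longrightarrow> \<iota> (S + T) = \<iota> S + \<iota> T"
  and \<iota>_scale: "T \<in> R \<Longrightarrow> \<iota> (c *\<^sub>C T) = c *\<^sub>C \<iota> T"
  using embedding by (simp_all add: unital_complete_order_embedding_def unital_clinear_on_def)

lemma zero_mem: "0 \<in> R"
  using scale_mem[OF one_mem, of 0] by simp

lemma \<iota>_zero: "\<iota> 0 = 0"
  using \<iota>_scale[OF one_mem, of 0] by simp

lemma form_pair_single:
  assumes "finite J" "a \<in> J" "b \<in> J" "T \<in> R"
  shows "form_pair J R \<iota> (\<lambda>\<zeta>. cinner (bapp (\<iota> T) (\<zeta> b)) (\<zeta> a)) (\<lambda>\<zeta>. cinner (bapp T (\<zeta> b)) (\<zeta> a))"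
proof -
  define X where "X a' b' = (if a' = a then if b' = b then T else 0 else 0)" for a' b'
  have "(\<Sum>a'\<in>J. \<Sum>b'\<in>J. cinner (bapp (f (X a' b')) (\<zeta> b')) (\<zeta> a')) = cinner (bapp (f T) (\<zeta> b)) (\<zeta> a)"
    if "f 0 = 0" for f :: "'h bop \<Rightarrow> 'x::chilbert_space bop" and \<zeta>
  proof -
    have "(\<Sum>a'\<in>J. \<Sum>b'\<in>J. cinner (bapp (f (X a' b')) (\<zeta> b')) (\<zeta> a')) =
        (\<Sum>a'\<in>J. \<Sum>b'\<in>J. if b' = b then if a' = a then cinner (bapp (f T) (\<zeta> b)) (\<zeta> a) else 0 else 0)"
      by (intro sum.cong refl) (simp add: X_def that bapp_simps)
    then show ?thesis using assms by simp
  qed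
  note 1 = this[of \<iota>, OF \<iota>_zero] and 2 = this[of "\<lambda>T. T", OF refl]
  have "X a' b' \<in> R" for a' b' using assms zero_mem by (simp add: X_def)
  then show ?thesis
    unfolding form_pair_def by (intro exI[of _ X]) (simp add: 1 2)
qed

lemma form_pair_add:
  assumes "form_pair J R \<iota> p q" "form_pair J R \<iota> p' q'"
  shows "form_pair J R \<iota> (\<lambda>\<zeta>. p \<zeta> + p' \<zeta>) (\<lambda>\<zeta>. q \<zeta> + q' \<zeta>)"
proof -
  obtain X where X: "\<And>a b. a \<in> J \<Longrightarrow> b \<in> J \<Longrightarrow> X a b \<in> R"
    "p = (\<lambda>\<zeta>. \<Sum>a\<in>J. \<Sum>b\<in>J. cinner (bapp (\<iota> (X a b)) (\<zeta> b)) (\<zeta> a))"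
    "q = (\<lambda>\<zeta>. \<Sum>a\<in>J. \<Sum>b\<in>J. cinner (bapp (X a b) (\<zeta> b)) (\<zeta> a))"
    using assms(1) unfolding form_pair_def by blast
  obtain Y where Y: "\<And>a b. a \<in> J \<Longrightarrow> b \<in> J \<Longrightarrow> Y a b \<in> R"
    "p' = (\<lambda>\<zeta>. \<Sum>a\<in>J. \<Sum>b\<in>J. cinner (bapp (\<iota> (Y a b)) (\<zeta> b)) (\<zeta> a))"
    "q' = (\<lambda>\<zeta>. \<Sum>a\<in>J. \<Sum>b\<in>J. cinner (bapp (Y a b) (\<zeta> b)) (\<zeta> a))"
    using assms(2) unfolding form_pair_def by blast
  show ?thesis
    unfolding form_pair_def using X(1) Y(1)
    by (intro exI[of _ "\<lambda>a b. X a b + Y a b"])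
      (simp add: X(2,3) Y(2,3) add_mem \<iota>_add bapp_simps cinner_add_left sum.distrib)
qed

lemma form_pair_scale:
  assumes "form_pair J R \<iota> p q"
  shows "form_pair J R \<iota> (\<lambda>\<zeta>. c * p \<zeta>) (\<lambda>\<zeta>. c * q \<zeta>)"
proof -
  obtain X where X: "\<And>a b. a \<in> J \<Longrightarrow> b \<in> J \<Longrightarrow> X a b \<in> R"
    "p = (\<lambda>\<zeta>. \<Sum>a\<in>J. \<Sum>b\<in>J. cinner (bapp (\<iota> (X a b)) (\<zeta> b)) (\<zeta> a))"
    "q = (\<lambda>\<zeta>. \<Sum>a\<in>J. \<Sum>b\<in>J. cinner (bapp (X a b) (\<zeta> b)) (\<zeta> a))"
    using assms unfolding form_pair_def by blast
  show ?thesis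
    unfolding form_pair_def using X(1)
    by (intro exI[of _ "\<lambda>a b. c *\<^sub>C X a b"])
      (simp add: X(2,3) scale_mem \<iota>_scale bapp_simps cinner_scaleC_left sum_distrib_left)
qed

lemma form_pair_zero: "form_pair J R \<iota> (\<lambda>_. 0) (\<lambda>_. 0)"
  unfolding form_pair_def by (intro exI[of _ "\<lambda>_ _. 0"]) (simp add: zero_mem \<iota>_zero bapp_simps)

lemma form_pair_sum:
  assumes "\<And>i. i \<in> M \<Longrightarrow> form_pair J R \<iota> (p i) (q i)"
  shows "form_pair J R \<iota> (\<lambda>\<zeta>. \<Sum>i\<in>M. p i \<zeta>) (\<lambda>\<zeta>. \<Sum>i\<in>M. q i \<zeta>)"
  using assms
  by (induction M rule: infinite_finite_induct) (simp_all add: form_pair_zero form_pair_add)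

text \<open>This uses that \<open>\<iota>\<close> reflects positivity of matrices. The index set
  \<open>J\<close> is enumerated because \<open>mat_pos\<close> takes natural numbers as
  indices.\<close>

lemma form_pair_nonneg:
  assumes J: "finite J" and pq: "form_pair J R \<iota> p q" and pos: "\<And>\<zeta>. p \<zeta> \<in> \<real>" "\<And>\<zeta>. 0 \<le> Re (p \<zeta>)"
  shows "0 \<le> Re (q \<zeta>)"
proof -
  obtain X where X: "\<And>a b. a \<in> J \<Longrightarrow> b \<in> J \<Longrightarrow> X a b \<in> R"
    "p = (\<lambda>\<zeta>. \<Sum>a\<in>J. \<Sum>b\<in>J. cinner (bapp (\<iota> (X a b)) (\<zeta> b)) (\<zeta> a))"
    "q = (\<lambda>\<zeta>. \<Sum>a\<in>J. \<Sum>b\<in>J. cinner (bapp (X a b) (\<zeta> b)) (\<zeta> a))"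
    using pq unfolding form_pair_def by blast
  obtain h where h: "bij_betw h {..<card J} J"
    using ex_bij_betw_nat_finite[OF J] by (auto simp: atLeast0LessThan)
  define g where "g = the_inv_into {..<card J} h"
  have g: "g (h i) = i" if "i < card J" for i
    using h that by (simp add: g_def bij_betw_def the_inv_into_f_f)
  have hJ: "h i \<in> J" if "i < card J" for i using h that by (auto simp: bij_betw_def)
  have reindex: "(\<Sum>a\<in>J. \<Sum>b\<in>J. k a b) = (\<Sum>i<card J. \<Sum>j<card J. k (h i) (h j))" for k :: "_ \<Rightarrow> _ \<Rightarrow> complex"
    by (simp add: sum.reindex_bij_betw[OF h, symmetric])
  have "form (card J) (\<lambda>i j. \<iota> (X (h i) (h j))) \<xi> = p (\<lambda>a. \<xi> (g a))" for \<xi>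
    unfolding X(2) reindex form_def by (intro sum.cong refl) (simp add: g)
  then have "mat_pos (card J) (\<lambda>i j. \<iota> (X (h i) (h j)))"
    using pos by (simp add: mat_pos_alt complex_is_Real_iff)
  moreover have "mat_pos (card J) (\<lambda>i j. \<iota> (X (h i) (h j))) \<longleftrightarrow> mat_pos (card J) (\<lambda>i j. X (h i) (h j))"
    if "\<forall>i<card J. \<forall>j<card J. X (h i) (h j) \<in> R"
    using embedding that unfolding unital_complete_order_embedding_def by simp
  ultimately have "mat_pos (card J) (\<lambda>i j. X (h i) (h j))"
    using X(1) hJ by simp
  then have "0 \<le> Re (form (card J) (\<lambda>i j. X (h i) (h j)) (\<lambda>i. \<zeta> (h i)))"
    by (simp add: mat_pos_alt)
  then show ?thesis unfolding X(3) reindex form_def by simp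
qed

end

lemma (in free_product_of_groups) W_drop: "w \<in> W \<Longrightarrow> drop m w \<in> W"
  by (metis W_append append_take_drop_id)

text \<open>Cauchy-Schwarz against the constant 1; the constant is increased by one to stay positive
  for empty \<open>J\<close>, as it becomes a divisor later.\<close>

lemma sum_square_le:
  fixes f :: "'j \<Rightarrow> real"
  assumes "finite J"
  shows "(\<Sum>j\<in>J. f j)\<^sup>2 \<le> real (card J + 1) * (\<Sum>j\<in>J. (f j)\<^sup>2)"
proof -
  have "(\<Sum>j\<in>J. f j * 1)\<^sup>2 \<le> (\<Sum>j\<in>J. (f j)\<^sup>2) * (\<Sum>j\<in>J. 1\<^sup>2)"
    by (rule Cauchy_Schwarz_ineq_sum)
  also have "\<dots> \<le> (\<Sum>j\<in>J. (f j)\<^sup>2) * real (card J + 1)"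
    by (intro mult_left_mono sum_nonneg) simp_all
  finally show ?thesis by (simp add: mult.commute)
qed

text \<open>The letters generate the unitary group, so an order embedding of their span already
  determines the order of the group algebra. Positivity of a polynomial in the unitaries is
  linearized by a vector \<open>\<zeta>\<close> with one entry for each word, where a multiple \<open>t\<close> of the deviation of
  \<open>\<zeta> (p # x)\<close> from \<open>U [p] (\<zeta> x)\<close> is added as a penalty; expanding the square shows that the
  penalty is linear in \<open>U [p]\<close>.\<close>

definition lin_part :: "nat \<Rightarrow> (nat \<Rightarrow> nat \<Rightarrow> 'w list \<Rightarrow> complex) \<Rightarrow> (nat \<times> 'w list \<Rightarrow> 'h::chilbert_space) \<Rightarrow> complex"
  where "lin_part n F \<zeta> =
    (\<Sum>i<n. \<Sum>j<n. \<Sum>x | F i j x \<noteq> 0. F i j x * cinner (\<zeta> (j, x)) (\<zeta> (i, [])))"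

definition deviation :: "('w list \<Rightarrow> 'h::chilbert_space bop) \<Rightarrow> (nat \<times> 'w list \<Rightarrow> 'h) \<Rightarrow> nat \<times> 'w list \<Rightarrow> 'h"
  where "deviation \<alpha> \<zeta> = (\<lambda>(j, x). \<zeta> (j, x) - bapp (\<alpha> [hd x]) (\<zeta> (j, tl x)))"

text \<open>For unitary \<open>\<alpha>\<close> this is \<open>penalized\<close>, written so that
  every term contains a single operator \<open>\<alpha> y\<close> with \<open>y\<close> empty, a
  letter or the inverse of a letter. The first part is averaged with its conjugate to make the form
  real; the four terms of the second are the expanded square of the deviation, where unitarity has
  removed \<open>\<alpha> [hd x]\<close> from the last one.\<close>

definition penalized_form where
  "penalized_form G n F P J \<alpha> t \<epsilon> \<zeta> =
      1 / 2 * ((\<Sum>i<n. \<Sum>j<n. \<Sum>x | F i j x \<noteq> 0. F i j x * cinner (bapp (\<alpha> []) (\<zeta> (j, x))) (\<zeta> (i, []))) +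
        (\<Sum>i<n. \<Sum>j<n. \<Sum>x | F i j x \<noteq> 0. cnj (F i j x) * cinner (bapp (\<alpha> []) (\<zeta> (i, []))) (\<zeta> (j, x)))) +
      of_real t * (\<Sum>(j, x)\<in>P. cinner (bapp (\<alpha> []) (\<zeta> (j, x))) (\<zeta> (j, x)) +
        (- 1) * cinner (bapp (\<alpha> [hd x]) (\<zeta> (j, tl x))) (\<zeta> (j, x)) +
        (- 1) * cinner (bapp (\<alpha> (inv\<^bsub>G\<^esub> [hd x])) (\<zeta> (j, x))) (\<zeta> (j, tl x)) +
        cinner (bapp (\<alpha> []) (\<zeta> (j, tl x))) (\<zeta> (j, tl x))) +
      of_real \<epsilon> * (\<Sum>a\<in>J. cinner (bapp (\<alpha> []) (\<zeta> a)) (\<zeta> a))"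

definition penalized where
  "penalized n F P J \<alpha> t \<epsilon> \<zeta> = Re (lin_part n F \<zeta>) +
     t * (\<Sum>a\<in>P. (norm (deviation \<alpha> \<zeta> a))\<^sup>2) + \<epsilon> * (\<Sum>a\<in>J. (norm (\<zeta> a))\<^sup>2)"

theorem (in free_product_of_groups) letters_determine_order:
  fixes u :: "('i \<times> 'g) list \<Rightarrow> 'h::chilbert_space bop" and U :: "('i \<times> 'g) list \<Rightarrow> 'k::chilbert_space bop"
  assumes "operator_system_embedding R \<iota>" and u: "unitary_rep FP u" and U: "unitary_rep FP U"
    and letters: "\<And>p. [p] \<in> W \<Longrightarrow> u [p] \<in> R" "\<And>p. [p] \<in> W \<Longrightarrow> \<iota> (u [p]) = U [p]"
  shows "dominates FP U u"
  unfolding dominates_def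
proof (intro allI impI)
  interpret FP: group FP by (rule group_FP)
  interpret operator_system_embedding R \<iota> by fact
  fix n and F :: "nat \<Rightarrow> nat \<Rightarrow> ('i \<times> 'g) list \<Rightarrow> complex"
  assume F: "\<forall>i j. F i j \<in> group_algebra FP" and pos: "rpos n (\<lambda>i j. ev U (F i j))"
  define S0 where "S0 = (\<Union>i<n. \<Union>j<n. {x. F i j x \<noteq> 0})"
  \<comment> \<open>Closed under dropping the first letter, so that every word of the support is
    reached from the empty word one letter at a time within \<open>S\<close>.\<close>
  define S where "S = insert [] (\<Union>x\<in>S0. (\<lambda>m. drop m x) ` {..length x})"
  have F_fin: "finite {x. F i j x \<noteq> 0}" and F_W: "F i j x \<noteq> 0 \<Longrightarrow> x \<in> W" for i j x
    using F group_algebra_finite[of "F i j" FP] group_algebra_carrier[of "F i j" FP x]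
    by (simp_all add: carrier_FP)
  have S0: "finite S0" "S0 \<subseteq> W"
    using F_fin F_W by (auto simp: S0_def)
  have S: "finite S" "S \<subseteq> W" using S0 W_drop by (auto simp: S_def W_Nil)
  have S0S: "x \<in> S" if "x \<in> S0" for x
    unfolding S_def using that by (auto intro!: bexI[of _ x] image_eqI[of _ _ 0])
  have Nil_S: "[] \<in> S" by (simp add: S_def)
  have Cons_S: "x \<in> S" if "p # x \<in> S" for p x
  proof -
    obtain y m where y: "y \<in> S0" "m \<le> length y" "p # x = drop m y" using \<open>p # x \<in> S\<close> by (auto simp: S_def)
    then have "x = drop (Suc m) y" by (metis drop_Suc list.sel(3) tl_drop)
    moreover have "Suc m \<le> length y" using y by (metis drop_all le_SucI list.distinct(1) not_less_eq_eq)
    ultimately show ?thesis using y(1) by (auto simp: S_def)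
  qed
  have letter: "[p] \<in> W" "[p] \<otimes>\<^bsub>FP\<^esub> x = p # x" if "p # x \<in> W" for p x
  proof -
    obtain i g where p: "p = (i, g)" by force
    show "[p] \<in> W" using that by (simp add: p W_Cons W_Nil)
    show "[p] \<otimes>\<^bsub>FP\<^esub> x = p # x" using mult_append[of "[p]" x] that by (simp add: mult_FP)
  qed
  have step: "\<alpha> (p # x) = \<alpha> [p] * \<alpha> x" if "unitary_rep FP \<alpha>" "p # x \<in> W"
    for \<alpha> :: "('i \<times> 'g) list \<Rightarrow> 'x::chilbert_space bop" and p x
    using unitary_rep_mult[OF that(1), of "[p]" x] letter[OF that(2)] W_ConsD[OF that(2)] by (simp add: carrier_FP)
  have supp: "x \<in> S0" if "F i j x \<noteq> 0" "i < n" "j < n" for i j x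
    using that by (auto simp: S0_def)
  define J where "J = {..<n} \<times> S"
  have J: "finite J" using S by (simp add: J_def)
  define P where "P = {..<n} \<times> (S - {[]})"
  have P: "finite P" using S by (simp add: P_def)
  have PJ: "(j, x) \<in> J" "(j, tl x) \<in> J" "[hd x] \<in> W" "x = hd x # tl x" if "(j, x) \<in> P" for j x
  proof -
    show x: "x = hd x # tl x" using that by (simp add: P_def)
    show "(j, x) \<in> J" using that by (simp add: P_def J_def)
    then show "(j, tl x) \<in> J" "[hd x] \<in> W"
      using x Cons_S[of "hd x" "tl x"] letter(1)[of "hd x" "tl x"] S(2) by (auto simp: J_def)
  qed
  have form_ev: "form n (\<lambda>i j. ev \<alpha> (F i j)) \<xi> = (\<Sum>i<n. \<Sum>j<n. \<Sum>x | F i j x \<noteq> 0. F i j x * cinner (bapp (\<alpha> x) (\<xi> j)) (\<xi> i))"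
    for \<alpha> :: "('i \<times> 'g) list \<Rightarrow> 'x::chilbert_space bop" and \<xi>
    by (simp add: form_def fsum_def bapp_sum bapp_simps hilb.B_sum cinner_scaleC_left)
  have Q_eq: "penalized_form FP n F P J \<alpha> t \<epsilon> \<zeta> = of_real (penalized n F P J \<alpha> t \<epsilon> \<zeta>)" if \<alpha>: "unitary_rep FP \<alpha>"
    for \<alpha> :: "('i \<times> 'g) list \<Rightarrow> 'x::chilbert_space bop" and t \<epsilon> \<zeta>
  proof -
    have one: "bapp (\<alpha> []) z = z" for z using unitary_rep_one[OF \<alpha>] by (simp add: one_FP bapp_simps)
    have cA: "(\<Sum>i<n. \<Sum>j<n. \<Sum>x | F i j x \<noteq> 0. cnj (F i j x) * cinner (\<zeta> (i, [])) (\<zeta> (j, x))) = cnj (lin_part n F \<zeta>)"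
      unfolding lin_part_def cnj_sum complex_cnj_mult cinner_commute[of "\<zeta> (_, [])"] by simp
    have "cinner (\<zeta> (j, x)) (\<zeta> (j, x)) +
        (- 1) * cinner (bapp (\<alpha> [hd x]) (\<zeta> (j, tl x))) (\<zeta> (j, x)) +
        (- 1) * cinner (bapp (\<alpha> (inv\<^bsub>FP\<^esub> [hd x])) (\<zeta> (j, x))) (\<zeta> (j, tl x)) +
        cinner (\<zeta> (j, tl x)) (\<zeta> (j, tl x)) = of_real ((norm (deviation \<alpha> \<zeta> (j, x)))\<^sup>2)"
      if "(j, x) \<in> P" for j x
    proof -
      have hd: "[hd x] \<in> carrier FP" using PJ(3)[OF that] by (simp add: carrier_FP)
      have 1: "cinner (bapp (\<alpha> (inv\<^bsub>FP\<^esub> [hd x])) (\<zeta> (j, x))) (\<zeta> (j, tl x)) =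
          cinner (\<zeta> (j, x)) (bapp (\<alpha> [hd x]) (\<zeta> (j, tl x)))"
        by (simp add: unitary_rep_inv[OF \<alpha> hd] cinner_adj)
      show ?thesis
        unfolding hilb.B_self[symmetric] deviation_def 1
        by (simp add: hilb.B_diff hilb.B_diff_right FP.norm_unitary_rep(3)[OF \<alpha> hd])
    qed
    then have "(\<Sum>(j, x)\<in>P. cinner (\<zeta> (j, x)) (\<zeta> (j, x)) +
        (- 1) * cinner (bapp (\<alpha> [hd x]) (\<zeta> (j, tl x))) (\<zeta> (j, x)) +
        (- 1) * cinner (bapp (\<alpha> (inv\<^bsub>FP\<^esub> [hd x])) (\<zeta> (j, x))) (\<zeta> (j, tl x)) +
        cinner (\<zeta> (j, tl x)) (\<zeta> (j, tl x))) = of_real (\<Sum>a\<in>P. (norm (deviation \<alpha> \<zeta> a))\<^sup>2)"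
      unfolding of_real_sum by (intro sum.cong refl) (auto simp del: of_real_power)
    then have "penalized_form FP n F P J \<alpha> t \<epsilon> \<zeta> = 1 / 2 * (lin_part n F \<zeta> + cnj (lin_part n F \<zeta>)) + of_real t * of_real (\<Sum>a\<in>P. (norm (deviation \<alpha> \<zeta> a))\<^sup>2) +
        of_real \<epsilon> * of_real (\<Sum>a\<in>J. (norm (\<zeta> a))\<^sup>2)"
      unfolding penalized_form_def one cA by (simp only: lin_part_def[symmetric] of_real_sum hilb.B_self)
    also have "1 / 2 * (lin_part n F \<zeta> + cnj (lin_part n F \<zeta>)) = of_real (Re (lin_part n F \<zeta>))"
      by (simp add: complex_add_cnj)
    finally show ?thesis by (simp add: penalized_def)
  qed
  have fp: "form_pair J R \<iota> (\<lambda>\<zeta>. cinner (bapp (U y) (\<zeta> b)) (\<zeta> a)) (\<lambda>\<zeta>. cinner (bapp (u y) (\<zeta> b)) (\<zeta> a))"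
    if "a \<in> J" "b \<in> J" "u y \<in> R" "\<iota> (u y) = U y" for a b y
    using form_pair_single[OF J that(1-3)] that(4) by simp
  have Nil_R: "u [] \<in> R" "\<iota> (u []) = U []"
    using unitary_rep_one[OF u] unitary_rep_one[OF U] one_mem \<iota>_one by (simp_all add: one_FP)
  \<comment> \<open>The inverse of a letter is again a letter, so the adjoint term of the expanded
    square has its coefficient in \<open>R\<close> too.\<close>
  have inv_letter_W: "inv\<^bsub>FP\<^esub> [p] \<in> W \<and> (\<exists>p'. inv\<^bsub>FP\<^esub> [p] = [p'])" if "[p] \<in> W" for p
    using that FP.inv_closed[of "[p]"] inv_FP[OF that] by (cases p) (simp add: carrier_FP)
  have inv_R: "u (inv\<^bsub>FP\<^esub> [p]) \<in> R" "\<iota> (u (inv\<^bsub>FP\<^esub> [p])) = U (inv\<^bsub>FP\<^esub> [p])" if "[p] \<in> W" for p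
    using inv_letter_W[OF that] letters by auto
  have JI: "(i, []) \<in> J" "(j, x) \<in> J" if "i < n" "j < n" "F i j x \<noteq> 0" for i j x
    using that supp S0S Nil_S by (auto simp: J_def)
  have Q_pair: "form_pair J R \<iota> (penalized_form FP n F P J U t \<epsilon>) (penalized_form FP n F P J u t \<epsilon>)" for t \<epsilon>
    unfolding penalized_form_def case_prod_beta
    by (intro form_pair_add form_pair_scale form_pair_sum fp Nil_R letters inv_R)
      (use JI PJ in auto)
  have key: "0 \<le> Re (form n (\<lambda>i j. ev u (F i j)) \<xi>) + \<epsilon> * (\<Sum>a\<in>J. (norm (\<xi> (fst a)))\<^sup>2)"
    if \<epsilon>: "0 < \<epsilon>" for \<epsilon> \<xi>
  proof -
    define L where "L = (\<Sum>x\<in>S. real (length x))"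
    define M where "M = L * (\<Sum>i<n. \<Sum>j<n. \<Sum>x | F i j x \<noteq> 0. cmod (F i j x))"
    define N where "N = real (card J + 1)"
    \<comment> \<open>Replacing \<open>\<zeta> (j, x)\<close> by \<open>U x\<close> applied to
      \<open>\<zeta> (j, [])\<close> costs at most \<open>M D Z\<close>, with \<open>D\<close> the
      sum of the deviations and \<open>Z\<close> the sum of the norms. The penalty and the
      \<open>\<epsilon>\<close> term supply at least \<open>t D^2 / N + \<epsilon> Z^2 / N\<close>,
      so by the arithmetic-geometric mean inequality any \<open>t\<close> from a quarter of this
      value on is large enough.\<close>
    define t where "t = N\<^sup>2 * M\<^sup>2 / \<epsilon>"
    have L: "real (length x) \<le> L" if "x \<in> S" for x
      unfolding L_def using S that by (intro member_le_sum) auto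
    have N: "N > 0" by (simp add: N_def)
    have M: "M \<ge> 0" by (simp add: M_def L_def sum_nonneg)
    have "0 \<le> penalized n F P J U t \<epsilon> \<zeta>" for \<zeta>
    proof -
      define D where "D = (\<Sum>a\<in>P. norm (deviation U \<zeta> a))"
      define Z where "Z = (\<Sum>a\<in>J. norm (\<zeta> a))"
      have D0: "0 \<le> D" "0 \<le> Z" by (simp_all add: D_def Z_def sum_nonneg)
      \<comment> \<open>The error accumulated along the word \<open>x\<close>: as
        \<open>U [p]\<close> is isometric, each letter adds at most one deviation to it.\<close>
      define e where "e j x = \<zeta> (j, x) - bapp (U x) (\<zeta> (j, []))" for j x
      have e: "norm (e j x) \<le> real (length x) * D" if "j < n" "x \<in> S" for j x
        using that(2)
      proof (induction x)
        case Nil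
        then show ?case using unitary_rep_one[OF U] by (simp add: e_def one_FP bapp_simps)
      next
        case (Cons p x)
        have px: "p # x \<in> W" using Cons.prems S(2) by auto
        have [simp]: "[p] \<in> carrier FP" using letter(1)[OF px] by (simp add: carrier_FP)
        have P: "(j, p # x) \<in> P" using Cons.prems \<open>j < n\<close> by (simp add: P_def)
        have "e j (p # x) = deviation U \<zeta> (j, p # x) + bapp (U [p]) (e j x)"
          by (simp add: e_def deviation_def step[OF U px] bapp_simps bapp_diff)
        then have "norm (e j (p # x)) \<le> norm (deviation U \<zeta> (j, p # x)) + norm (e j x)"
          using norm_triangle_ineq[of "deviation U \<zeta> (j, p # x)" "bapp (U [p]) (e j x)"]
          by (simp add: FP.norm_unitary_rep(4)[OF U])
        also have "norm (deviation U \<zeta> (j, p # x)) \<le> D"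
          unfolding D_def using P \<open>finite P\<close> by (intro member_le_sum) auto
        also have "norm (e j x) \<le> real (length x) * D"
          by (rule Cons.IH) (rule Cons_S[OF Cons.prems])
        finally show ?case by (simp add: algebra_simps)
      qed
      have "lin_part n F \<zeta> = form n (\<lambda>i j. ev U (F i j)) (\<lambda>j. \<zeta> (j, [])) +
          (\<Sum>i<n. \<Sum>j<n. \<Sum>x | F i j x \<noteq> 0. F i j x * cinner (e j x) (\<zeta> (i, [])))"
        unfolding form_ev lin_part_def sum.distrib[symmetric] distrib_left[symmetric] cinner_add_left[symmetric]
        by (simp add: e_def)
      moreover have "0 \<le> Re (form n (\<lambda>i j. ev U (F i j)) (\<lambda>j. \<zeta> (j, [])))"
        using pos by (simp add: rpos_def)
      moreover have "cmod (\<Sum>i<n. \<Sum>j<n. \<Sum>x | F i j x \<noteq> 0. F i j x * cinner (e j x) (\<zeta> (i, []))) \<le> M * (D * Z)"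
      proof -
        have "cmod (F i j x * cinner (e j x) (\<zeta> (i, []))) \<le> cmod (F i j x) * (L * D * Z)"
          if "i < n" "j < n" "F i j x \<noteq> 0" for i j x
        proof -
          have xS: "x \<in> S" using that supp S0S by blast
          have "cmod (cinner (e j x) (\<zeta> (i, []))) \<le> norm (e j x) * norm (\<zeta> (i, []))"
            by (rule hilb.Cauchy_Schwarz)
          also have "\<dots> \<le> (L * D) * Z"
          proof (rule mult_mono)
            show "norm (e j x) \<le> L * D"
              by (rule order_trans[OF e[OF that(2) xS] mult_right_mono[OF L[OF xS] D0(1)]])
            show "norm (\<zeta> (i, [])) \<le> Z"
              unfolding Z_def using JI(1)[OF that] J by (intro member_le_sum) auto
          qed (simp_all add: D0 L_def sum_nonneg)
          finally show ?thesis by (simp add: norm_mult mult_left_mono)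
        qed
        then have "cmod (\<Sum>i<n. \<Sum>j<n. \<Sum>x | F i j x \<noteq> 0. F i j x * cinner (e j x) (\<zeta> (i, []))) \<le>
            (\<Sum>i<n. \<Sum>j<n. \<Sum>x | F i j x \<noteq> 0. cmod (F i j x) * (L * D * Z))"
          by (intro order_trans[OF norm_sum] sum_mono) auto
        also have "\<dots> = M * (D * Z)"
          by (simp add: M_def sum_distrib_right sum_distrib_left mult_ac)
        finally show ?thesis .
      qed
      then have "\<bar>Re (\<Sum>i<n. \<Sum>j<n. \<Sum>x | F i j x \<noteq> 0. F i j x * cinner (e j x) (\<zeta> (i, [])))\<bar> \<le> M * (D * Z)"
        using abs_Re_le_cmod order_trans by blast
      ultimately have A: "- (M * (D * Z)) \<le> Re (lin_part n F \<zeta>)" by simp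
      have "D\<^sup>2 \<le> N * (\<Sum>a\<in>P. (norm (deviation U \<zeta> a))\<^sup>2)"
      proof -
        have "card P \<le> card J" using J by (intro card_mono) (auto simp: P_def J_def)
        then have "real (card P + 1) * (\<Sum>a\<in>P. (norm (deviation U \<zeta> a))\<^sup>2) \<le> N * (\<Sum>a\<in>P. (norm (deviation U \<zeta> a))\<^sup>2)"
          unfolding N_def by (intro mult_right_mono sum_nonneg) simp_all
        with sum_square_le[OF P, of "\<lambda>a. norm (deviation U \<zeta> a)"] show ?thesis by (simp add: D_def)
      qed
      then have "D\<^sup>2 / N \<le> (\<Sum>a\<in>P. (norm (deviation U \<zeta> a))\<^sup>2)" using N by (simp add: field_simps)
      then have 1: "t * (D\<^sup>2 / N) \<le> t * (\<Sum>a\<in>P. (norm (deviation U \<zeta> a))\<^sup>2)"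
        using \<epsilon> by (intro mult_left_mono) (simp_all add: t_def)
      have "Z\<^sup>2 / N \<le> (\<Sum>a\<in>J. (norm (\<zeta> a))\<^sup>2)"
        using sum_square_le[OF J, of "\<lambda>a. norm (\<zeta> a)"] N by (simp add: Z_def N_def field_simps)
      then have 2: "\<epsilon> * (Z\<^sup>2 / N) \<le> \<epsilon> * (\<Sum>a\<in>J. (norm (\<zeta> a))\<^sup>2)"
        using \<epsilon> by (intro mult_left_mono) simp_all
      have "t * (D\<^sup>2 / N) + \<epsilon> * (Z\<^sup>2 / N) - M * (D * Z) =
          ((N * M * D)\<^sup>2 + (\<epsilon> * Z)\<^sup>2 - (N * M * D) * (\<epsilon> * Z)) / (N * \<epsilon>)"
        using N \<epsilon> by (simp add: t_def field_simps power2_eq_square)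
      also have "\<dots> \<ge> 0"
      proof -
        have "2 * ((N * M * D) * (\<epsilon> * Z)) \<le> (N * M * D)\<^sup>2 + (\<epsilon> * Z)\<^sup>2"
          using sum_squares_bound[of "N * M * D" "\<epsilon> * Z"] by simp
        moreover have "0 \<le> (N * M * D) * (\<epsilon> * Z)" using N M D0 \<epsilon> by simp
        ultimately show ?thesis using N \<epsilon> by simp
      qed
      finally show ?thesis using A 1 2 unfolding penalized_def by linarith
    qed
    then have "0 \<le> Re (penalized_form FP n F P J u t \<epsilon> \<zeta>)" for \<zeta>
      by (intro form_pair_nonneg[OF J Q_pair]) (simp_all add: Q_eq[OF U])
    then have "0 \<le> penalized n F P J u t \<epsilon> \<zeta>" for \<zeta> by (simp add: Q_eq[OF u])
    \<comment> \<open>At this \<open>\<zeta>\<close> all deviations of \<open>u\<close> vanish, so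
      the large factor \<open>t\<close> disappears and only the original form and the
      \<open>\<epsilon>\<close> term remain.\<close>
    from this[of "\<lambda>(j, x). bapp (u x) (\<xi> j)"]
    have "0 \<le> penalized n F P J u t \<epsilon> (\<lambda>(j, x). bapp (u x) (\<xi> j))" .
    also have "penalized n F P J u t \<epsilon> (\<lambda>(j, x). bapp (u x) (\<xi> j)) = Re (form n (\<lambda>i j. ev u (F i j)) \<xi>) + \<epsilon> * (\<Sum>a\<in>J. (norm (\<xi> (fst a)))\<^sup>2)"
    proof -
      have "deviation u (\<lambda>(j, x). bapp (u x) (\<xi> j)) a = 0" if a: "a \<in> P" for a
      proof -
        obtain j x where jx: "a = (j, x)" by force
        have "hd x # tl x \<in> W" using PJ(4)[of j x] PJ(1)[of j x] a S(2) by (auto simp: jx J_def)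
        from step[OF u this] show ?thesis using PJ(4)[of j x] a by (simp add: jx deviation_def bapp_simps)
      qed
      moreover have "norm (bapp (u x) (\<xi> j)) = norm (\<xi> j)" if "(j, x) \<in> J" for j x
        using that S(2) by (intro FP.norm_unitary_rep(4)[OF u]) (auto simp: J_def carrier_FP)
      moreover have "lin_part n F (\<lambda>(j, x). bapp (u x) (\<xi> j)) = form n (\<lambda>i j. ev u (F i j)) \<xi>"
        using unitary_rep_one[OF u] by (simp add: lin_part_def form_ev one_FP bapp_simps)
      ultimately show ?thesis
        unfolding penalized_def by (simp add: case_prod_beta cong: sum.cong)
    qed
    finally show ?thesis .
  qed
  show "rpos n (\<lambda>i j. ev u (F i j))"
    unfolding rpos_def
  proof
    fix \<xi> :: "nat \<Rightarrow> 'h"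
    let ?B = "\<Sum>a\<in>J. (norm (\<xi> (fst a)))\<^sup>2"
    show "0 \<le> Re (form n (\<lambda>i j. ev u (F i j)) \<xi>)"
    proof (rule field_le_epsilon)
      fix e :: real assume e: "0 < e"
      have B: "0 \<le> ?B" by (simp add: sum_nonneg)
      have "e / (?B + 1) * ?B \<le> e" using e B by (simp add: field_simps)
      with key[of "e / (?B + 1)" \<xi>] e B show "0 \<le> Re (form n (\<lambda>i j. ev u (F i j)) \<xi>) + e"
        by (simp add: add_nonneg_pos)
    qed
  qed
qed

section \<open>Extension of unital completely positive maps\<close>

lemma (in group) gram_mat_pos:
  assumes u: "unitary_rep G u" and w: "\<And>i. i < n \<Longrightarrow> w i \<in> carrier G"
  shows "mat_pos n (\<lambda>i j. u (inv (w i) \<otimes> w j))"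
  unfolding mat_pos_alt
proof (intro allI)
  fix \<xi>
  let ?s = "\<Sum>i<n. bapp (u (w i)) (\<xi> i)"
  have "form n (\<lambda>i j. u (inv (w i) \<otimes> w j)) \<xi> =
      (\<Sum>i<n. \<Sum>j<n. cinner (bapp (u (w j)) (\<xi> j)) (bapp (u (w i)) (\<xi> i)))"
    unfolding form_def using w
    by (intro sum.cong refl) (simp add: unitary_rep_mult[OF u] unitary_rep_inv[OF u] bapp_simps cinner_adj)
  also have "\<dots> = cinner ?s ?s"
    by (simp add: hilb.B_sum hilb.B_sum_right)
  finally show "Im (form n (\<lambda>i j. u (inv (w i) \<otimes> w j)) \<xi>) = 0 \<and> 0 \<le> Re (form n (\<lambda>i j. u (inv (w i) \<otimes> w j)) \<xi>)"
    by (simp add: hilb.B_self)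
qed

text \<open>The Gram matrix of unitaries \<open>u (f (w i))\<close> is positive, and its entries lie
  in \<open>R\<close> because \<open>R\<close> contains the image of all of \<open>H\<close>; a
  completely positive map keeps it positive.\<close>

lemma (in group) ucp_posdef:
  assumes u: "unitary_rep G u" and \<phi>: "ucp_on R \<phi>" and H: "group H"
    and f: "\<And>g. g \<in> carrier H \<Longrightarrow> f g \<in> carrier G" "\<And>g. g \<in> carrier H \<Longrightarrow> u (f g) \<in> R"
    and hom: "\<And>g h. g \<in> carrier H \<Longrightarrow> h \<in> carrier H \<Longrightarrow> f (inv\<^bsub>H\<^esub> h \<otimes>\<^bsub>H\<^esub> g) = inv (f h) \<otimes> f g"
  shows "posdef H (\<lambda>g. \<phi> (u (f g)))" "\<phi> (u (f \<one>\<^bsub>H\<^esub>)) = 1"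
proof -
  interpret H: group H by fact
  have f1: "f \<one>\<^bsub>H\<^esub> = \<one>" using hom[of "\<one>\<^bsub>H\<^esub>" "\<one>\<^bsub>H\<^esub>"] f(1) by simp
  show \<phi>1: "\<phi> (u (f \<one>\<^bsub>H\<^esub>)) = 1"
    using \<phi> unitary_rep_one[OF u] f1 by (simp add: ucp_on_def unital_clinear_on_def)
  have pos: "mat_pos n (\<lambda>i j. \<phi> (u (f (inv\<^bsub>H\<^esub> (w i) \<otimes>\<^bsub>H\<^esub> w j))))"
    if w: "\<And>i. i < n \<Longrightarrow> w i \<in> carrier H" for n w
  proof -
    have "mat_pos n (\<lambda>i j. u (f (inv\<^bsub>H\<^esub> (w i) \<otimes>\<^bsub>H\<^esub> w j))) = mat_pos n (\<lambda>i j. u (inv (f (w i)) \<otimes> f (w j)))"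
      by (rule mat_pos_cong) (simp add: hom w)
    then have "mat_pos n (\<lambda>i j. u (f (inv\<^bsub>H\<^esub> (w i) \<otimes>\<^bsub>H\<^esub> w j)))"
      using gram_mat_pos[OF u, of n "\<lambda>i. f (w i)"] w f(1) by simp
    moreover have "\<forall>i<n. \<forall>j<n. u (f (inv\<^bsub>H\<^esub> (w i) \<otimes>\<^bsub>H\<^esub> w j)) \<in> R" using w f(2) by simp
    ultimately show ?thesis
      using \<phi> unfolding ucp_on_def by simp
  qed
  show "posdef H (\<lambda>g. \<phi> (u (f g)))"
    unfolding posdef_def
  proof (intro conjI ballI allI impI)
    fix g assume g: "g \<in> carrier H"
    let ?a = "\<phi> (u (f g))" and ?b = "\<phi> (u (f (inv\<^bsub>H\<^esub> g)))"
    \<comment> \<open>The form of the 2 x 2 matrix for the unit and \<open>g\<close> is real. Its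
      diagonal contributions are real anyway, so the imaginary parts of the two others
      cancel.\<close>
    have im: "Im (cinner (bapp ?a x) y) = - Im (cinner (bapp ?b y) x)" for x y
    proof -
      define w where "w i = (if i = 0 then \<one>\<^bsub>H\<^esub> else g)" for i :: nat
      define \<xi> where "\<xi> i = (if i = 0 then y else x)" for i :: nat
      have two: "{..<2::nat} = {0, 1}" by auto
      have "mat_pos 2 (\<lambda>i j. \<phi> (u (f (inv\<^bsub>H\<^esub> (w i) \<otimes>\<^bsub>H\<^esub> w j))))"
        using g by (intro pos) (simp add: w_def)
      then have "Im (form 2 (\<lambda>i j. \<phi> (u (f (inv\<^bsub>H\<^esub> (w i) \<otimes>\<^bsub>H\<^esub> w j)))) \<xi>) = 0"
        by (simp add: mat_pos_alt)
      then show ?thesis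
        using g by (simp add: form_def two w_def \<xi>_def \<phi>1 bapp_simps hilb.Im_B_self)
    qed
    have "cinner (bapp ?a x) y = cinner x (bapp ?b y)" for x y
    proof -
      have 1: "Im (cinner (bapp ?a x) y) = Im (cinner x (bapp ?b y))" for x y
        using im[of x y] by (subst cinner_commute[of x]) simp
      \<comment> \<open>Multiplying \<open>x\<close> by \<open>\<i>\<close> turns the statement
        about imaginary parts into one about real parts.\<close>
      from 1[of x y] 1[of "\<i> *\<^sub>C x" y] show ?thesis
        by (simp add: complex_eq_iff bapp_scaleC cinner_scaleC_left)
    qed
    then show "?b = adj ?a" by (rule adj_eqI[symmetric])
  next
    fix S \<xi> assume S: "finite S" "S \<subseteq> carrier H"
    obtain h where h: "bij_betw h {..<card S} S"
      using ex_bij_betw_nat_finite[OF S(1)] by (auto simp: atLeast0LessThan)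
    have hS: "h i \<in> carrier H" if "i < card S" for i using h that S(2) by (auto simp: bij_betw_def)
    have "(\<Sum>g\<in>S. \<Sum>k\<in>S. cinner (bapp (\<phi> (u (f (inv\<^bsub>H\<^esub> k \<otimes>\<^bsub>H\<^esub> g)))) (\<xi> g)) (\<xi> k)) =
        form (card S) (\<lambda>i j. \<phi> (u (f (inv\<^bsub>H\<^esub> (h i) \<otimes>\<^bsub>H\<^esub> h j)))) (\<lambda>i. \<xi> (h i))"
      by (subst sum.swap) (simp add: form_def sum.reindex_bij_betw[OF h, symmetric])
    then show "0 \<le> Re (\<Sum>g\<in>S. \<Sum>k\<in>S. cinner (bapp (\<phi> (u (f (inv\<^bsub>H\<^esub> k \<otimes>\<^bsub>H\<^esub> g)))) (\<xi> g)) (\<xi> k))"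
      using pos[of "card S" h] hS by (simp add: mat_pos_alt)
  qed
qed

section \<open>Generated C*-algebras and double commutants\<close>

lemma cstar_gen_subalgebra: "cstar_subalgebra (cstar_gen S)"
  unfolding cstar_gen_def cstar_subalgebra_def by (auto intro: closed_Inter)

lemma cstar_gen_incl: "S \<subseteq> cstar_gen S"
  by (auto simp: cstar_gen_def)

lemma cstar_gen_least: "cstar_subalgebra A \<Longrightarrow> S \<subseteq> A \<Longrightarrow> cstar_gen S \<subseteq> A"
  by (auto simp: cstar_gen_def)

lemma (in group) cstar_subalgebra_closure_ev:
  assumes u: "unitary_rep G u"
  shows "cstar_subalgebra (closure (ev u ` group_algebra G))"
proof -
  let ?A = "ev u ` group_algebra G"
  have one: "1 \<in> ?A"
    using group_algebra_point_mass[OF one_closed, of 1] unitary_rep_one[OF u]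
    by (intro image_eqI[of _ _ "point_mass \<one> 1"]) (simp_all add: ev_point_mass)
  have add: "S + T \<in> ?A" if "S \<in> ?A" "T \<in> ?A" for S T
    using that by (auto simp: ev_add[where G = G, symmetric] intro!: imageI group_algebra_add)
  have sc: "c *\<^sub>C T \<in> ?A" if "T \<in> ?A" for c T
    using that by (auto simp: ev_scale[where G = G, symmetric] intro!: imageI group_algebra_scale)
  have mult: "S * T \<in> ?A" if "S \<in> ?A" "T \<in> ?A" for S T
    using that by (auto simp: ev_convolution[OF u, symmetric] intro!: imageI group_algebra_convolution)
  have adj: "adj T \<in> ?A" if "T \<in> ?A" for T
    using that by (auto simp: ev_involution[OF u, symmetric] intro!: imageI group_algebra_involution)
  have cmult: "S * T \<in> closure ?A" if ST: "S \<in> closure ?A" "T \<in> closure ?A" for S T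
  proof -
    obtain f g where f: "\<And>n. f n \<in> ?A" "f \<longlonglongrightarrow> S" and g: "\<And>n. g n \<in> ?A" "g \<longlonglongrightarrow> T"
      using ST unfolding closure_sequential by blast
    have "(\<lambda>n. f n * g n) \<longlonglongrightarrow> S * T" by (intro tendsto_intros f g)
    then show ?thesis
      unfolding closure_sequential by (intro exI[of _ "\<lambda>n. f n * g n"] conjI allI mult f g)
  qed
  have "adj T \<in> closure ?A" if "T \<in> closure ?A" for T
    using image_closure_subset[OF continuous_on_adj closed_closure, of ?A ?A] adj closure_subset[of ?A] that
    by blast
  moreover have "S + T \<in> closure ?A" if "S \<in> closure ?A" "T \<in> closure ?A" for S T
    using add sc that by (rule closure_subspaceI(1))
  moreover have "c *\<^sub>C T \<in> closure ?A" if "T \<in> closure ?A" for c T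
    using add sc that by (rule closure_subspaceI(2))
  moreover have "1 \<in> closure ?A" using closure_subset one by (rule subsetD)
  ultimately show ?thesis
    using cmult by (simp add: cstar_subalgebra_def)
qed

lemma ucp_on_subset: "ucp_on A \<Phi> \<Longrightarrow> B \<subseteq> A \<Longrightarrow> ucp_on B \<Phi>"
  unfolding ucp_on_def unital_clinear_on_def by (simp add: subset_iff)

text \<open>These are the operations by which values of the extension arise from values of
  \<open>\<phi>\<close>: products along words, linear combinations and norm limits.\<close>

lemma commutant_commutant:
  fixes M :: "'h::chilbert_space bop set"
  defines "N \<equiv> commutant (commutant M)"
  shows "M \<subseteq> N" "1 \<in> N" "S \<in> N \<Longrightarrow> T \<in> N \<Longrightarrow> S * T \<in> N" "S \<in> N \<Longrightarrow> T \<in> N \<Longrightarrow> S + T \<in> N"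
    "T \<in> N \<Longrightarrow> c *\<^sub>C T \<in> N" "closed N"
proof -
  show "M \<subseteq> N" "1 \<in> N" by (auto simp: N_def commutant_def)
  show "S \<in> N \<Longrightarrow> T \<in> N \<Longrightarrow> S + T \<in> N" "T \<in> N \<Longrightarrow> c *\<^sub>C T \<in> N"
    by (simp_all add: N_def commutant_def algebra_simps scaleC_bop_mult)
  show "S * T \<in> N" if "S \<in> N" "T \<in> N"
    unfolding N_def commutant_def[of "commutant M"]
  proof (intro CollectI ballI)
    fix A assume "A \<in> commutant M"
    then have "S * A = A * S" "T * A = A * T" using that by (simp_all add: N_def commutant_def[of "commutant M"])
    then show "S * T * A = A * (S * T)" by (metis mult.assoc)
  qed
  have "N = (\<Inter>A\<in>commutant M. {T. T * A = A * T})" by (auto simp: N_def commutant_def[of "commutant M"])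
  moreover have "closed {T. T * A = A * T}" for A :: "'h bop"
    by (intro closed_Collect_eq continuous_intros)
  ultimately show "closed N" by (simp add: closed_INT)
qed

context free_product_of_groups
begin

lemma factor_elem_closed: "i \<in> I \<Longrightarrow> g \<in> carrier (G i) \<Longrightarrow> factor_elem G i g \<in> W"
  unfolding factor_elem_def by (rule word_cons_closed) (auto simp: W_Nil)

lemma factor_elem_mult:
  assumes "i \<in> I" "g \<in> carrier (G i)" "h \<in> carrier (G i)"
  shows "factor_elem G i (g \<otimes>\<^bsub>G i\<^esub> h) = factor_elem G i g \<otimes>\<^bsub>FP\<^esub> factor_elem G i h"
proof -
  have "word_cons G (i, \<one>\<^bsub>G i\<^esub>) w = w" for w by (cases w) auto
  then show ?thesis
    unfolding factor_elem_def mult_FP word_cons_mult[OF assms W_Nil, symmetric]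
    by (auto simp: word_cons.simps(1)[of G i g])
qed

lemma factor_elem_inv_mult:
  assumes "i \<in> I" "g \<in> carrier (G i)" "h \<in> carrier (G i)"
  shows "factor_elem G i (inv\<^bsub>G i\<^esub> h \<otimes>\<^bsub>G i\<^esub> g) = inv\<^bsub>FP\<^esub> (factor_elem G i h) \<otimes>\<^bsub>FP\<^esub> factor_elem G i g"
proof -
  interpret Gi: group "G i" by (rule factor_group) fact
  interpret FP: group FP by (rule group_FP)
  have "factor_elem G i (inv\<^bsub>G i\<^esub> h) = inv\<^bsub>FP\<^esub> (factor_elem G i h)"
  proof (rule FP.inv_equality[symmetric])
    show "factor_elem G i (inv\<^bsub>G i\<^esub> h) \<otimes>\<^bsub>FP\<^esub> factor_elem G i h = \<one>\<^bsub>FP\<^esub>"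
      using assms by (simp add: factor_elem_mult[symmetric]) (simp add: factor_elem_def one_FP)
  qed (use assms in \<open>simp_all add: carrier_FP factor_elem_closed\<close>)
  then show ?thesis using assms by (simp add: factor_elem_mult)
qed

lemma factor_elem_letter: "[(i, g)] \<in> W \<Longrightarrow> factor_elem G i g = [(i, g)]"
  by (simp add: factor_elem_def W_Cons)

end

text \<open>The spanning set contains the image of every element of every factor, which is what
  makes \<open>\<phi>\<close> positive definite on each of them. Countability of the words is used
  to move the full representation to \<open>ell2\<close>.\<close>

theorem (in free_product_of_groups) ucp_extension:
  fixes u :: "('i \<times> 'g) list \<Rightarrow> 'k::chilbert_space bop" and \<iota> :: "'k bop \<Rightarrow> 'e::chilbert_space bop"
    and \<phi> :: "'k bop \<Rightarrow> 'h::chilbert_space bop"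
  assumes cW: "countable W" and full: "is_full_group_rep FP u"
    and R: "R = bopm.span (insert 1 {u (factor_elem G i g) | i g. i \<in> I \<and> g \<in> carrier (G i)})"
    and env: "is_cstar_envelope R \<iota>" and \<phi>: "ucp_on R \<phi>"
  shows "\<exists>\<Phi> :: 'e bop \<Rightarrow> 'h bop. ucp_on (cstar_gen (\<iota> ` R)) \<Phi> \<and>
           \<Phi> ` cstar_gen (\<iota> ` R) \<subseteq> commutant (commutant (\<phi> ` R)) \<and> (\<forall>x\<in>R. \<Phi> (\<iota> x) = \<phi> x)"
proof -
  interpret FP: group FP by (rule group_FP)
  let ?C = "group_algebra FP"
  let ?E = "insert 1 {u (factor_elem G i g) | i g. i \<in> I \<and> g \<in> carrier (G i)}"
  note u = is_full_group_rep_unitary[OF full]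
  have R1: "1 \<in> R" and R_add: "\<And>S T. S \<in> R \<Longrightarrow> T \<in> R \<Longrightarrow> S + T \<in> R"
    and R_scale: "\<And>c T. T \<in> R \<Longrightarrow> c *\<^sub>C T \<in> R"
    unfolding R by (auto intro: bopm.span_base bopm.span_add bopm.span_scale)
  have R_factor: "u (factor_elem G i g) \<in> R" if "i \<in> I" "g \<in> carrier (G i)" for i g
    unfolding R using that by (intro bopm.span_base) auto
  have R_letter: "u [p] \<in> R" if "[p] \<in> W" for p
  proof -
    obtain i g where p: "p = (i, g)" by force
    then show ?thesis using R_factor[of i g] that factor_elem_letter[of i g] by (auto simp: W_Cons)
  qed
  \<comment> \<open>The spanning elements come from words of length at most one, as the unit of a
    factor corresponds to the empty word.\<close>
  have E_cases: "x = u [] \<or> (\<exists>p. [p] \<in> W \<and> x = u [p])" if "x \<in> ?E" for x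
  proof -
    have "u [] = 1" using unitary_rep_one[OF u] by (simp add: one_FP)
    moreover have "factor_elem G i g = [] \<or> ([(i, g)] \<in> W \<and> factor_elem G i g = [(i, g)])"
      if "i \<in> I" "g \<in> carrier (G i)" for i g
      using that by (simp add: factor_elem_def W_Cons W_Nil)
    ultimately show ?thesis using that by force
  qed
  have R_ev: "\<exists>f\<in>?C. x = ev u f" if "x \<in> R" for x
    using that unfolding R
  proof (induction rule: bopm.span_induct_alt)
    case base
    then show ?case by (intro bexI[of _ "\<lambda>_. 0"]) (simp_all add: group_algebra_zero)
  next
    case (step c x y)
    obtain g where g: "g \<in> ?C" "y = ev u g" using step by blast
    obtain w where w: "w \<in> W" "x = u w" using E_cases[OF step(1)] W_Nil by blast
    have pm: "point_mass w 1 \<in> ?C" using w by (simp add: group_algebra_point_mass carrier_FP)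
    have "c *\<^sub>C x + y = ev u (\<lambda>z. c * point_mass w 1 z + g z)"
      unfolding ev_add[OF group_algebra_scale[OF pm] g(1)] ev_scale[OF pm] by (simp add: ev_point_mass w g)
    then show ?case using group_algebra_add[OF group_algebra_scale[OF pm] g(1)] by blast
  qed

  \<comment> \<open>The envelope property is formulated for embeddings into the operators on
    \<open>ell2\<close>.\<close>
  obtain \<kappa>' :: "('i \<times> 'g) list \<Rightarrow> ell2 bop" where \<kappa>': "unitary_rep FP \<kappa>'" "dominates FP \<kappa>' u"
    using FP.ex_ell2_rep[OF u] cW by (auto simp: carrier_FP)
  \<comment> \<open>Domination in both directions makes \<open>\<kappa>\<close> an embedding: this
    direction gives complete positivity, the other gives injectivity and reflection of
    positivity.\<close>
  have u\<kappa>': "dominates FP u \<kappa>'"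
    by (rule FP.full_group_rep_dominates[OF full FP.unitary_rep_posdef[OF \<kappa>'(1)]])
  obtain \<kappa> where \<kappa>: "ucp_on (closure (ev u ` ?C)) \<kappa>" "\<And>f. f \<in> ?C \<Longrightarrow> \<kappa> (ev u f) = ev \<kappa>' f"
    using dominates_imp_ucp[OF u\<kappa>' FP.one_closed unitary_rep_one[OF u] unitary_rep_one[OF \<kappa>'(1)]] by metis
  have R_closure: "R \<subseteq> closure (ev u ` ?C)"
    using R_ev closure_subset[of "ev u ` ?C"] by blast
  have \<kappa>_letter: "\<kappa> (u w) = \<kappa>' w" if "w \<in> W" for w
    using \<kappa>(2)[of "point_mass w 1"] that by (simp add: group_algebra_point_mass carrier_FP ev_point_mass)
  have "unital_complete_order_embedding R \<kappa>"
    unfolding unital_complete_order_embedding_def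
  proof (intro conjI allI impI)
    have ucp: "ucp_on R \<kappa>" by (rule ucp_on_subset[OF \<kappa>(1) R_closure])
    then show "unital_clinear_on R \<kappa>" by (simp add: ucp_on_def)
    show "inj_on \<kappa> R"
    proof (rule inj_onI)
      fix x y assume "x \<in> R" "y \<in> R" and eq: "\<kappa> x = \<kappa> y"
      then obtain f g where f: "f \<in> ?C" "x = ev u f" and g: "g \<in> ?C" "y = ev u g" using R_ev by metis
      have h: "(\<lambda>z. f z + (- 1) * g z) \<in> ?C" by (intro group_algebra_add group_algebra_scale f g)
      have ev: "ev \<alpha> (\<lambda>z. f z + (- 1) * g z) = ev \<alpha> f - ev \<alpha> g" for \<alpha> :: "('i \<times> 'g) list \<Rightarrow> 'x::chilbert_space bop"
        unfolding ev_add[OF f(1) group_algebra_scale[OF g(1)]] ev_scale[OF g(1)] by (simp add: bopm.scale_minus_left)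
      have "norm (x - y) \<le> norm (\<kappa> x - \<kappa> y)"
        using dominates_norm[OF \<kappa>'(2) FP.one_closed unitary_rep_one[OF \<kappa>'(1)] unitary_rep_one[OF u] h]
        by (simp only: ev f(2) g(2) \<kappa>(2)[OF f(1)] \<kappa>(2)[OF g(1)])
      with eq show "x = y" by simp
    qed
    fix n :: nat and X assume X: "\<forall>i<n. \<forall>j<n. X i j \<in> R"
    show "mat_pos n (\<lambda>i j. \<kappa> (X i j)) = mat_pos n X"
    proof
      assume pos: "mat_pos n (\<lambda>i j. \<kappa> (X i j))"
      have "\<forall>i j. \<exists>f. f \<in> ?C \<and> (i < n \<longrightarrow> j < n \<longrightarrow> X i j = ev u f)"
        using X R_ev group_algebra_zero[of FP] by (metis (no_types, lifting))
      then obtain F where F: "\<And>i j. F i j \<in> ?C" "\<And>i j. i < n \<Longrightarrow> j < n \<Longrightarrow> X i j = ev u (F i j)" by metis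
      have "mat_pos n (\<lambda>i j. ev \<kappa>' (F i j))"
        using pos mat_pos_cong[of n "\<lambda>i j. \<kappa> (X i j)" "\<lambda>i j. ev \<kappa>' (F i j)"] F \<kappa>(2) by simp
      then have "mat_pos n (\<lambda>i j. ev u (F i j))" by (rule dominates_mat_pos[OF \<kappa>'(2) F(1)])
      then show "mat_pos n X" using mat_pos_cong[of n X "\<lambda>i j. ev u (F i j)"] F(2) by simp
    qed (use ucp X in \<open>simp add: ucp_on_def\<close>)
  qed
  with env have "\<exists>\<pi>. unital_star_hom (cstar_gen (\<kappa> ` R)) \<pi> \<and>
      \<pi> ` cstar_gen (\<kappa> ` R) \<subseteq> cstar_gen (\<iota> ` R) \<and> (\<forall>x\<in>R. \<iota> x = \<pi> (\<kappa> x))"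
    by (simp add: is_cstar_envelope_def)
  then obtain \<pi> where \<pi>: "unital_star_hom (cstar_gen (\<kappa> ` R)) \<pi>" "\<And>x. x \<in> R \<Longrightarrow> \<iota> x = \<pi> (\<kappa> x)"
    by blast
  define U where "U w = \<pi> (\<kappa>' w)" for w
  \<comment> \<open>\<open>\<pi>\<close> is known to be multiplicative on the generated C*-algebra,
    which contains \<open>\<kappa>' w\<close> for every word because it contains the
    letters.\<close>
  have \<kappa>'_gen: "\<kappa>' w \<in> cstar_gen (\<kappa> ` R)" if "w \<in> W" for w
    using that
  proof (induction w)
    case Nil
    then show ?case
      using cstar_gen_subalgebra[of "\<kappa> ` R"] unitary_rep_one[OF \<kappa>'(1)] by (simp add: one_FP cstar_subalgebra_def)
  next
    case (Cons p w)
    have p: "[p] \<in> W" "w \<in> W" using Cons.prems by (cases p; simp add: W_Cons W_Nil)+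
    have "p # w = [p] \<otimes>\<^bsub>FP\<^esub> w" using mult_append[of "[p]" w] Cons.prems by (simp add: mult_FP)
    then have "\<kappa>' (p # w) = \<kappa>' [p] * \<kappa>' w"
      using unitary_rep_mult[OF \<kappa>'(1), of "[p]" w] p by (simp add: carrier_FP)
    moreover have "\<kappa>' [p] \<in> cstar_gen (\<kappa> ` R)"
      using cstar_gen_incl[of "\<kappa> ` R"] R_letter[OF p(1)] \<kappa>_letter[OF p(1)] by force
    ultimately show ?case
      using Cons.IH[OF p(2)] cstar_gen_subalgebra[of "\<kappa> ` R"] by (simp add: cstar_subalgebra_def)
  qed
  have U: "unitary_rep FP U"
    unfolding unitary_rep_def
  proof (intro conjI ballI)
    show "U \<one>\<^bsub>FP\<^esub> = 1" using \<pi>(1) unitary_rep_one[OF \<kappa>'(1)] by (simp add: U_def unital_star_hom_def)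
    fix x assume x: "x \<in> carrier FP"
    then show "U (inv\<^bsub>FP\<^esub> x) = adj (U x)"
      using \<pi>(1) \<kappa>'_gen[of x] unitary_rep_inv[OF \<kappa>'(1) x] by (simp add: U_def unital_star_hom_def carrier_FP)
    fix y assume y: "y \<in> carrier FP"
    show "U (x \<otimes>\<^bsub>FP\<^esub> y) = U x * U y"
      using \<pi>(1) \<kappa>'_gen[of x] \<kappa>'_gen[of y] x y unitary_rep_mult[OF \<kappa>'(1) x y]
      by (simp add: U_def unital_star_hom_def carrier_FP)
  qed
  have U_letter: "\<iota> (u w) = U w" if "w \<in> W" "u w \<in> R" for w
    using \<pi>(2)[OF that(2)] \<kappa>_letter[OF that(1)] by (simp add: U_def)
  have emb: "unital_complete_order_embedding R \<iota>" using env by (simp add: is_cstar_envelope_def)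
  \<comment> \<open>\<open>\<pi>\<close> leads from \<open>\<kappa>'\<close> to \<open>U\<close>;
    the comparison back from \<open>U\<close> relies on \<open>\<iota>\<close> reflecting positivity
    on \<open>R\<close>.\<close>
  have "dominates FP U u"
  proof (rule letters_determine_order[OF _ u U])
    show "operator_system_embedding R \<iota>"
      by unfold_locales (fact R1 R_add R_scale emb)+
  qed (use R_letter U_letter in auto)

  define \<phi>' where "\<phi>' i g = \<phi> (u (factor_elem G i g))" for i g
  have "free_product_maps I G \<phi>'"
  proof
    fix i assume i: "i \<in> I"
    interpret Gi: group "G i" by (rule factor_group[OF i])
    have "group (G i)" by (rule factor_group[OF i])
    have \<phi>': "\<phi>' i = (\<lambda>g. \<phi> (u (factor_elem G i g)))" by (simp add: \<phi>'_def fun_eq_iff)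
    from FP.ucp_posdef[OF u \<phi> \<open>group (G i)\<close>, of "factor_elem G i"] i
    show "posdef (G i) (\<phi>' i)" "\<phi>' i \<one>\<^bsub>G i\<^esub> = 1"
      by (simp_all add: \<phi>' carrier_FP factor_elem_closed R_factor factor_elem_inv_mult)
  qed
  then interpret free_product_maps I G \<phi>' .
  have "dominates FP u \<Psi>" by (rule FP.full_group_rep_dominates[OF full posdef_word_map])
  with \<open>dominates FP U u\<close> have dU: "dominates FP U \<Psi>" by (rule dominates_trans)
  have \<Psi>1: "\<Psi> \<one>\<^bsub>FP\<^esub> = 1" by (simp add: one_FP)
  obtain \<Phi> where \<Phi>: "ucp_on (closure (ev U ` ?C)) \<Phi>" "\<And>f. f \<in> ?C \<Longrightarrow> \<Phi> (ev U f) = ev \<Psi> f"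
    "\<And>x. x \<in> closure (ev U ` ?C) \<Longrightarrow> \<Phi> x \<in> closure (ev \<Psi> ` ?C)"
    using dominates_imp_ucp[OF dU FP.one_closed unitary_rep_one[OF U] \<Psi>1] by metis
  have \<Phi>_U: "\<Phi> (U w) = \<Psi> w" "U w \<in> closure (ev U ` ?C)" if "w \<in> W" for w
  proof -
    have pm: "point_mass w 1 \<in> ?C" using that by (simp add: group_algebra_point_mass carrier_FP)
    from \<Phi>(2)[OF pm] show "\<Phi> (U w) = \<Psi> w" by (simp add: ev_point_mass)
    have "U w \<in> ev U ` ?C" using imageI[OF pm, of "ev U"] by (simp add: ev_point_mass)
    then show "U w \<in> closure (ev U ` ?C)" by (rule subsetD[OF closure_subset])
  qed
  have cl: "cstar_subalgebra (closure (ev U ` ?C))" by (rule FP.cstar_subalgebra_closure_ev[OF U])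
  have \<iota>_lin: "\<iota> (S + T) = \<iota> S + \<iota> T" "\<iota> (c *\<^sub>C S) = c *\<^sub>C \<iota> S" if "S \<in> R" "T \<in> R" for S T c
    using emb that by (simp_all add: unital_complete_order_embedding_def unital_clinear_on_def)
  have \<phi>_lin: "\<phi> (S + T) = \<phi> S + \<phi> T" "\<phi> (c *\<^sub>C S) = c *\<^sub>C \<phi> S" if "S \<in> R" "T \<in> R" for S T c
    using \<phi> that by (simp_all add: ucp_on_def unital_clinear_on_def)
  have \<Phi>_lin: "\<Phi> (S + T) = \<Phi> S + \<Phi> T" "\<Phi> (c *\<^sub>C S) = c *\<^sub>C \<Phi> S"
    if "S \<in> closure (ev U ` ?C)" "T \<in> closure (ev U ` ?C)" for S T c
    using \<Phi>(1) that by (simp_all add: ucp_on_def unital_clinear_on_def)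
  \<comment> \<open>Membership of \<open>\<iota> x\<close> in the closure is carried through the
    induction, since \<open>\<Phi>\<close> is known to be linear only there.\<close>
  have ext: "x \<in> R \<and> \<iota> x \<in> closure (ev U ` ?C) \<and> \<Phi> (\<iota> x) = \<phi> x" if "x \<in> R" for x
    using that unfolding R
  proof (induction rule: bopm.span_induct_alt)
    case base
    have "0 \<in> R" using R_scale[OF R1, of 0] by simp
    moreover have "\<iota> 0 = 0" "\<phi> 0 = 0"
      using \<iota>_lin(2)[OF R1 R1, of 0] \<phi>_lin(2)[OF R1 R1, of 0] by simp_all
    moreover have "0 \<in> closure (ev U ` ?C)"
      using cl unfolding cstar_subalgebra_def by (metis bopm.scale_zero_left)
    moreover from this have "\<Phi> 0 = 0" using \<Phi>_lin(2)[of 0 0 0] by simp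
    ultimately show ?case by (simp add: R[symmetric])
  next
    case (step c x y)
    note y = step(2)[folded R]
    have "x \<in> R" using step(1) unfolding R by (rule bopm.span_base)
    \<comment> \<open>On words of length at most one the product map \<open>\<Psi>\<close> agrees
      with \<open>\<phi>\<close> after \<open>u\<close>.\<close>
    obtain w where w: "w \<in> W" "x = u w" "\<Psi> w = \<phi> (u w)"
    proof (rule disjE[OF E_cases[OF step(1)]])
      assume "x = u []"
      moreover have "\<phi> (u []) = 1"
        using \<phi> unitary_rep_one[OF u] by (simp add: one_FP ucp_on_def unital_clinear_on_def)
      ultimately show ?thesis using W_Nil by (intro that[of "[]"]) auto
    next
      assume "\<exists>p. [p] \<in> W \<and> x = u [p]"
      then obtain i g where "[(i, g)] \<in> W" "x = u [(i, g)]" by auto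
      then show ?thesis by (intro that[of "[(i, g)]"]) (simp_all add: \<phi>'_def factor_elem_letter)
    qed
    have "\<iota> x = U w" using U_letter[OF w(1)] \<open>x \<in> R\<close> w(2) by simp
    then have x: "\<iota> x \<in> closure (ev U ` ?C)" "\<Phi> (\<iota> x) = \<phi> x" using \<Phi>_U[OF w(1)] w by simp_all
    have cx: "c *\<^sub>C x \<in> R" "c *\<^sub>C \<iota> x \<in> closure (ev U ` ?C)"
      using R_scale[OF \<open>x \<in> R\<close>] cl x(1) by (simp_all add: cstar_subalgebra_def)
    have "\<iota> (c *\<^sub>C x + y) = c *\<^sub>C \<iota> x + \<iota> y"
      using cx(1) y \<open>x \<in> R\<close> by (simp add: \<iota>_lin)
    moreover have "c *\<^sub>C \<iota> x + \<iota> y \<in> closure (ev U ` ?C)"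
      using cl cx(2) y by (simp add: cstar_subalgebra_def)
    moreover have "\<Phi> (c *\<^sub>C \<iota> x + \<iota> y) = \<phi> (c *\<^sub>C x + y)"
      using \<Phi>_lin(1)[OF cx(2), of "\<iota> y"] \<Phi>_lin(2)[OF x(1) x(1), of c] \<phi>_lin(1)[OF cx(1), of y]
        \<phi>_lin(2)[OF \<open>x \<in> R\<close> \<open>x \<in> R\<close>, of c] y x(2) by simp
    ultimately show ?case using R_add[OF cx(1), of y] y by (simp add: R[symmetric])
  qed
  have gen: "cstar_gen (\<iota> ` R) \<subseteq> closure (ev U ` ?C)"
    using ext by (intro cstar_gen_least[OF cl]) blast
  let ?N = "commutant (commutant (\<phi> ` R))"
  note N = commutant_commutant[where M = "\<phi> ` R"]
  have \<Psi>N: "\<Psi> w \<in> ?N" if "w \<in> W" for w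
    using that
  proof (induction w)
    case (Cons p w)
    obtain i g where p: "p = (i, g)" by force
    have "\<phi>' i g \<in> \<phi> ` R" using Cons.prems R_factor[of i g] by (auto simp: p \<phi>'_def W_Cons)
    then show ?case using Cons N(1,3) by (auto simp: p W_Cons)
  qed (simp add: N)
  have "ev \<Psi> f \<in> ?N" if "f \<in> ?C" for f
  proof -
    have "(\<Sum>w\<in>S. f w *\<^sub>C \<Psi> w) \<in> ?N" if "finite S" "S \<subseteq> W" for S
      using that
    proof (induction S rule: finite_induct)
      case empty
      show ?case using N(5)[OF N(2), of 0] by simp
    qed (auto intro!: N \<Psi>N)
    from this[OF group_algebra_finite[OF that]] show ?thesis
      using group_algebra_carrier[OF that] by (auto simp: fsum_def carrier_FP)
  qed
  then have "closure (ev \<Psi> ` ?C) \<subseteq> ?N"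
    by (intro closure_minimal N) blast
  then show ?thesis
    using ucp_on_subset[OF \<Phi>(1) gen] \<Phi>(3) gen ext by (intro exI[of _ \<Phi>] conjI) blast+
qed

section \<open>The two families as free products of cyclic groups\<close>

lemma is_NC_free_product:
  assumes "is_NC d R"
  obtains u where "is_full_group_rep (free_product {1..d} NC_factors) u"
    "R = bopm.span (insert 1 {u (factor_elem NC_factors i g) | i g. i \<in> {1..d} \<and> g \<in> carrier (NC_factors i)})"
proof -
  obtain u where u: "is_full_group_rep (free_product {1..d} NC_factors) u"
    "R = bopm.span (insert 1 {u (factor_elem NC_factors i 1) | i. i \<in> {1..d}})"
    using assms unfolding is_NC_def by blast
  have one: "u (factor_elem NC_factors i 0) = 1" for i
    using unitary_rep_one[OF is_full_group_rep_unitary[OF u(1)]]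
    by (simp add: factor_elem_def NC_factors_def free_product_def)
  \<comment> \<open>In a group of order two the generator is the only nontrivial element, so the
    given symmetries and the unit exhaust all factors.\<close>
  have "carrier (NC_factors i) = {0, 1}" for i
    by (auto simp: NC_factors_def carrier_integer_mod_group)
  then have "insert 1 {u (factor_elem NC_factors i g) | i g. i \<in> {1..d} \<and> g \<in> carrier (NC_factors i)} =
      insert 1 {u (factor_elem NC_factors i 1) | i. i \<in> {1..d}}"
    using one by auto
  with u show ?thesis by (intro that[of u]) simp_all
qed

text \<open>The powers of \<open>w\<close> with exponent below \<open>k\<close> run through the
  image of the cyclic factor; the exponent 0 provides the unit.\<close>

lemma is_NCP_free_product:
  assumes "is_NCP k R" "k \<ge> 1"
  obtains u where "is_full_group_rep (free_product {1, 2} (NCP_factors k)) u"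
    "R = bopm.span (insert 1 {u (factor_elem (NCP_factors k) i g) | i g. i \<in> {1, 2} \<and> g \<in> carrier (NCP_factors k i)})"
proof -
  let ?G = "NCP_factors k"
  obtain u w v where u: "is_full_group_rep (free_product {1, 2} ?G) u"
    and w: "w = u (factor_elem ?G 1 (1 mod int k))" and v: "v = u (factor_elem ?G 2 1)"
    and R: "R = bopm.span (insert v {w ^ j | j. j < k})"
    using assms(1) unfolding is_NCP_def by blast
  interpret free_product_of_groups "{1, 2}" ?G
    by (rule free_product_of_groups.intro) (simp add: NCP_factors_def)
  note ur = is_full_group_rep_unitary[OF u]
  have one: "u (factor_elem ?G i 0) = 1" for i
    using unitary_rep_one[OF ur] by (simp add: factor_elem_def NCP_factors_def free_product_def)
  have c1: "carrier (?G 1) = {0..<int k}" and c2: "carrier (?G 2) = {0, 1}"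
    using assms(2) by (auto simp: NCP_factors_def carrier_integer_mod_group)
  have pow: "w ^ j = u (factor_elem ?G 1 (int j mod int k))" for j
  proof (induction j)
    case 0
    then show ?case by (simp add: one)
  next
    case (Suc j)
    have mem: "1 mod int k \<in> carrier (?G 1)" "int j mod int k \<in> carrier (?G 1)"
      unfolding c1 using assms(2) by simp_all
    have "1 mod int k \<otimes>\<^bsub>?G 1\<^esub> (int j mod int k) = int (Suc j) mod int k"
      by (simp add: NCP_factors_def mod_add_eq)
    then have fe: "factor_elem ?G 1 (int (Suc j) mod int k) =
        factor_elem ?G 1 (1 mod int k) \<otimes>\<^bsub>FP\<^esub> factor_elem ?G 1 (int j mod int k)"
      using factor_elem_mult[OF _ mem] by simp
    have closed: "factor_elem ?G 1 (1 mod int k) \<in> carrier FP" "factor_elem ?G 1 (int j mod int k) \<in> carrier FP"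
      unfolding carrier_FP by (rule factor_elem_closed, simp, rule mem)+
    show ?case
      by (simp only: fe unitary_rep_mult[OF ur closed] power_Suc Suc.IH) (simp only: w)
  qed
  have "insert v {w ^ j | j. j < k} =
      insert 1 {u (factor_elem ?G i g) | i g. i \<in> {1, 2} \<and> g \<in> carrier (?G i)}" (is "?A = ?B")
  proof (intro equalityI subsetI)
    fix x assume "x \<in> ?A"
    then consider "x = v" | j where "j < k" "x = w ^ j" by auto
    then show "x \<in> ?B"
    proof cases
      case 1
      have "(1::int) \<in> carrier (?G 2)" by (simp add: c2)
      then show ?thesis using 1 v by blast
    next
      case 2
      then have "int j \<in> carrier (?G 1)" "x = u (factor_elem ?G 1 (int j))"
        unfolding c1 by (simp_all add: pow)
      then show ?thesis by blast
    qed
  next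
    fix x assume "x \<in> ?B"
    then consider "x = 1" | g where "g \<in> carrier (?G 1)" "x = u (factor_elem ?G 1 g)"
      | g where "g \<in> carrier (?G 2)" "x = u (factor_elem ?G 2 g)" by auto
    then show "x \<in> ?A"
    proof cases
      case 1
      then have "x = w ^ 0" by simp
      then show ?thesis using assms(2) by fastforce
    next
      case (2 g)
      then have "x = w ^ nat g" "nat g < k" unfolding c1 by (simp_all add: pow nat_less_iff)
      then show ?thesis by blast
    next
      case (3 g)
      then consider "x = 1" | "x = v" using one v by (auto simp: c2)
      then show ?thesis
      proof cases
        case 1
        then have "x = w ^ 0" by simp
        then show ?thesis using assms(2) by fastforce
      qed simp
    qed
  qed
  with u R show ?thesis by (intro that[of u]) simp_all
qed

theorem theorem7p5:
  fixes R :: "'k::chilbert_space bop set"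
    and \<iota> :: "'k bop \<Rightarrow> 'e::chilbert_space bop"
    and \<phi> :: "'k bop \<Rightarrow> 'h::chilbert_space bop"
  assumes "(\<exists>d. is_NC d R) \<or> (\<exists>k\<ge>1. is_NCP k R)"
    and "is_cstar_envelope R \<iota>"
    and "ucp_on R \<phi>"
  shows "\<exists>\<Phi> :: 'e bop \<Rightarrow> 'h bop.
           ucp_on (cstar_gen (\<iota> ` R)) \<Phi> \<and>
           \<Phi> ` cstar_gen (\<iota> ` R) \<subseteq> commutant (commutant (\<phi> ` R)) \<and>
           (\<forall>x\<in>R. \<Phi> (\<iota> x) = \<phi> x)"
proof -
  obtain I :: "nat set" and G :: "nat \<Rightarrow> int monoid" and u where
    G: "\<And>i. i \<in> I \<Longrightarrow> group (G i)" and u: "is_full_group_rep (free_product I G) u"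
    "R = bopm.span (insert 1 {u (factor_elem G i g) | i g. i \<in> I \<and> g \<in> carrier (G i)})"
    using assms(1)
  proof (elim disjE exE conjE)
    fix d assume "is_NC d R"
    then show thesis
      by (rule is_NC_free_product) (rule that[of "{1..d}" NC_factors], simp_all add: NC_factors_def)
  next
    fix k :: nat assume "k \<ge> 1" "is_NCP k R"
    from this(2,1) show thesis
      by (rule is_NCP_free_product) (rule that[of "{1, 2}" "NCP_factors k"], simp_all add: NCP_factors_def)
  qed
  interpret free_product_of_groups I G by (rule free_product_of_groups.intro) (rule G)
  show ?thesis
    \<comment> \<open>The open premise is countability of the set of reduced words, whose type is
      countable.\<close>
    by (rule ucp_extension[OF _ u assms(2,3)]) simp
qed

end
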